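(* Let $d\ge 1$ and let $f(x_0,x_1)=\zeta_0x_0^d+\cdots+\zeta_kx_0^{d-k}x_1^k+\cdots+\zeta_dx_1^d$ where $\zeta_0,\ldots,\zeta_d$ are independent random variables uniformly distributed in $\mathbb{Z}_p$. Then the expected number of zeroes of $f$ in $\mathbb{P}^1=\mathbb{P}^1(\mathbb{Q}_p)$ is $1$. Moreover the density of zeroes on $\mathbb{P}^1$ is uniform, i.e. for every Borel set $U\subseteq\mathbb{P}^1$ the expected number of zeroes of $f$ in $U$ equals $\mu(U)/\mu(\mathbb{P}^1)$.
   Context: $p$ is a prime; "uniformly distributed in $\mathbb{Z}_p$" means distributed according to the Haar probability measure on $\mathbb{Z}_p$. Let $S^1=\{(a_0,a_1)\in\mathbb{Q}_p^2:\max(|a_0|_p,|a_1|_p)=1\}$ and $\varphi:S^1\to\mathbb{P}^1$ the natural projection. The measure $\mu$ on $\mathbb{P}^1$ is $\mu(U)=\frac{1}{1-p^{-1}}\mu(\varphi^{-1}(U))$, where on $\mathbb{Q}_p^2$ $\mu$ is the Haar measure with $\mu(\mathbb{Z}_p^2)=1$; up to scaling it is the unique $\mathrm{GL}_2(\mathbb{Z}_p)$-invariant measure on $\mathbb{P}^1$. *)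

theory Defs
  imports "HOL-Probability.Probability" "Berlekamp_Zassenhaus.Finite_Field"
begin

section \<open>The \<open>p\<close>-adic absolute value on the rationals\<close>

definition rat_padic_norm :: "nat \<Rightarrow> rat \<Rightarrow> real" where
  "rat_padic_norm p q =
     (if q = 0 then 0
      else real p powi (int (multiplicity (int p) (snd (quotient_of q)))
                        - int (multiplicity (int p) (fst (quotient_of q)))))"

lemma rat_padic_norm_0 [simp]: "rat_padic_norm p 0 = 0"
  by (simp add: rat_padic_norm_def)

lemma rat_padic_norm_1 [simp]: "rat_padic_norm p 1 = 1"
  by (simp add: rat_padic_norm_def)

lemma rat_padic_norm_nonneg [simp]: "rat_padic_norm p x \<ge> 0"
  by (simp add: rat_padic_norm_def)

lemma rat_padic_norm_minus [simp]: "rat_padic_norm p (- x) = rat_padic_norm p x"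
proof -
  have "multiplicity (int p) (- a) = multiplicity (int p) a" for a
    by (simp add: multiplicity_def)
  then show ?thesis
    by (auto simp: rat_padic_norm_def rat_uminus_code Let_def split: prod.splits)
qed

lemma rat_padic_norm_minus_commute: "rat_padic_norm p (x - y) = rat_padic_norm p (y - x)"
  by (metis minus_diff_eq rat_padic_norm_minus)

context
  fixes p :: nat
  assumes prime: "prime p"
begin

lemma rat_padic_norm_Fract:
  assumes "a \<noteq> 0" "b \<noteq> 0"
  shows "rat_padic_norm p (of_int a / of_int b) =
           real p powi (int (multiplicity (int p) b) - int (multiplicity (int p) a))"
proof -
  define q :: rat where "q = of_int a / of_int b"
  obtain m n where mn: "quotient_of q = (m, n)" by force
  have q: "q = of_int m / of_int n" and n: "n > 0"
    using quotient_of_div[OF mn] quotient_of_denom_pos[OF mn] by auto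
  have "q \<noteq> 0" using assms by (simp add: q_def)
  then have m: "m \<noteq> 0" using q by auto
  have "(of_int a * of_int n :: rat) = of_int m * of_int b"
    using q_def q assms n by (simp add: field_simps)
  then have eq: "a * n = m * b"
    by (metis of_int_eq_iff of_int_mult)
  have pe: "prime_elem (int p)" using prime by auto
  have "multiplicity (int p) a + multiplicity (int p) n
      = multiplicity (int p) m + multiplicity (int p) b"
    using arg_cong[OF eq, of "multiplicity (int p)"] assms n m
    by (simp add: prime_elem_multiplicity_mult_distrib[OF pe])
  then have "int (multiplicity (int p) n) - int (multiplicity (int p) m)
           = int (multiplicity (int p) b) - int (multiplicity (int p) a)"
    by linarith
  with \<open>q \<noteq> 0\<close> mn show ?thesis by (simp add: rat_padic_norm_def flip: q_def)
qed

lemma rat_padic_norm_eq_0_iff [simp]: "rat_padic_norm p x = 0 \<longleftrightarrow> x = 0"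
  using prime_gt_0_nat[OF prime] by (simp add: rat_padic_norm_def)

lemma rat_padic_norm_mult: "rat_padic_norm p (x * y) = rat_padic_norm p x * rat_padic_norm p y"
proof (cases "x = 0 \<or> y = 0")
  case False
  obtain a b where x: "x = of_int a / of_int b" "b > 0"
    by (metis quotient_of_denom_pos quotient_of_div surj_pair)
  obtain c d where y: "y = of_int c / of_int d" "d > 0"
    by (metis quotient_of_denom_pos quotient_of_div surj_pair)
  have nz: "a \<noteq> 0" "c \<noteq> 0" using False x y by auto
  have xy: "x * y = of_int (a * c) / of_int (b * d)" using x y by simp
  have pe: "prime_elem (int p)" using prime by auto
  show ?thesis
    unfolding xy unfolding x(1) y(1)
    using nz x(2) y(2) prime_gt_0_nat[OF prime]
    by (subst (1 2 3) rat_padic_norm_Fract)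
       (auto simp: prime_elem_multiplicity_mult_distrib[OF pe] simp flip: power_int_add
             intro!: arg_cong2[where f = "(powi)"])
qed auto

lemma rat_padic_norm_inverse: "rat_padic_norm p (inverse x) = inverse (rat_padic_norm p x)"
proof (cases "x = 0")
  case False
  then have "rat_padic_norm p (inverse x) * rat_padic_norm p x = 1"
    by (simp flip: rat_padic_norm_mult)
  then show ?thesis
    by (metis inverse_unique mult.commute)
qed auto

lemma rat_padic_norm_add_le_max:
  "rat_padic_norm p (x + y) \<le> max (rat_padic_norm p x) (rat_padic_norm p y)"
proof (cases "x = 0 \<or> y = 0 \<or> x + y = 0")
  case False
  obtain a b where x: "x = of_int a / of_int b" "b > 0"
    by (metis quotient_of_denom_pos quotient_of_div surj_pair)
  obtain c d where y: "y = of_int c / of_int d" "d > 0"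
    by (metis quotient_of_denom_pos quotient_of_div surj_pair)
  define A B D where "A = a * d" and "B = c * b" and "D = b * d"
  have D: "D \<noteq> 0" using x y by (simp add: D_def)
  have x': "x = of_int A / of_int D" and y': "y = of_int B / of_int D"
    using x y by (auto simp: A_def B_def D_def)
  have xy: "x + y = of_int (A + B) / of_int D"
    unfolding x' y' by (simp add: add_divide_distrib)
  have nz: "A \<noteq> 0" "B \<noteq> 0" "A + B \<noteq> 0" using False x' y' xy by auto
  have pr: "\<not> is_unit (int p)" using prime by (metis not_prime_unit prime_nat_int_transfer)
  have "min (multiplicity (int p) A) (multiplicity (int p) B) \<le> multiplicity (int p) (A + B)"
    using nz(3) pr by (rule multiplicity_geI) (intro dvd_add multiplicity_dvd' min.cobounded1 min.cobounded2)
  then have "int (multiplicity (int p) D) - int (multiplicity (int p) (A + B))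
        \<le> int (multiplicity (int p) D) - int (multiplicity (int p) A)
      \<or> int (multiplicity (int p) D) - int (multiplicity (int p) (A + B))
        \<le> int (multiplicity (int p) D) - int (multiplicity (int p) B)"
    by linarith
  moreover have "real p powi i \<le> real p powi j" if "i \<le> j" for i j
    using that prime_ge_1_nat[OF prime] by (intro power_int_increasing) auto
  ultimately show ?thesis
    unfolding xy unfolding x' y' rat_padic_norm_Fract[OF nz(1) D] rat_padic_norm_Fract[OF nz(2) D]
      rat_padic_norm_Fract[OF nz(3) D] le_max_iff_disj by blast
qed (auto simp: le_max_iff_disj)

lemma rat_padic_norm_add_le: "rat_padic_norm p (x + y) \<le> rat_padic_norm p x + rat_padic_norm p y"
  using rat_padic_norm_add_le_max[of x y] rat_padic_norm_nonneg[of p x] rat_padic_norm_nonneg[of p y]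
  by linarith

lemma rat_padic_norm_diff_le: "\<bar>rat_padic_norm p x - rat_padic_norm p y\<bar> \<le> rat_padic_norm p (x - y)"
  using rat_padic_norm_add_le[of "x - y" y] rat_padic_norm_add_le[of "y - x" x]
  by (simp add: rat_padic_norm_minus_commute[of p y x])

end


section \<open>\<open>\<rat>\<^sub>p\<close> as the completion of the rationals\<close>

definition padic_Cauchy :: "nat \<Rightarrow> (nat \<Rightarrow> rat) \<Rightarrow> bool" where
  "padic_Cauchy p X \<longleftrightarrow> (\<forall>e>0. \<exists>N. \<forall>m\<ge>N. \<forall>n\<ge>N. rat_padic_norm p (X m - X n) < e)"

definition padic_null :: "nat \<Rightarrow> (nat \<Rightarrow> rat) \<Rightarrow> bool" where
  "padic_null p X \<longleftrightarrow> (\<lambda>n. rat_padic_norm p (X n)) \<longlonglongrightarrow> 0"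

definition padic_rel :: "nat \<Rightarrow> (nat \<Rightarrow> rat) \<Rightarrow> (nat \<Rightarrow> rat) \<Rightarrow> bool" where
  "padic_rel p X Y \<longleftrightarrow> padic_Cauchy p X \<and> padic_Cauchy p Y \<and> padic_null p (\<lambda>n. X n - Y n)"

lemma padic_Cauchy_const [simp]: "padic_Cauchy p (\<lambda>n. c)"
  by (simp add: padic_Cauchy_def)

lemma padic_null_zero [simp]: "padic_null p (\<lambda>n. 0)"
  by (simp add: padic_null_def)

lemma padic_Cauchy_minus: "padic_Cauchy p X \<Longrightarrow> padic_Cauchy p (\<lambda>n. - X n)"
  unfolding padic_Cauchy_def by (simp add: rat_padic_norm_minus_commute)

lemma padic_null_minus: "padic_null p X \<Longrightarrow> padic_null p (\<lambda>n. - X n)"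
  unfolding padic_null_def by simp

context
  fixes p :: nat
  assumes prime: "prime p"
begin

lemma padic_Cauchy_add:
  assumes "padic_Cauchy p X" "padic_Cauchy p Y"
  shows "padic_Cauchy p (\<lambda>n. X n + Y n)"
  unfolding padic_Cauchy_def
proof safe
  fix e :: real assume e: "e > 0"
  obtain M where M: "\<And>m n. m \<ge> M \<Longrightarrow> n \<ge> M \<Longrightarrow> rat_padic_norm p (X m - X n) < e"
    using assms(1) e unfolding padic_Cauchy_def by blast
  obtain N where N: "\<And>m n. m \<ge> N \<Longrightarrow> n \<ge> N \<Longrightarrow> rat_padic_norm p (Y m - Y n) < e"
    using assms(2) e unfolding padic_Cauchy_def by blast
  have "rat_padic_norm p (X m + Y m - (X n + Y n)) < e" if "m \<ge> max M N" "n \<ge> max M N" for m n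
    using rat_padic_norm_add_le_max[OF prime, of "X m - X n" "Y m - Y n"] M[of m n] N[of m n] that
    by (simp add: algebra_simps)
  then show "\<exists>N. \<forall>m\<ge>N. \<forall>n\<ge>N. rat_padic_norm p (X m + Y m - (X n + Y n)) < e"
    by blast
qed

lemma padic_null_add:
  assumes "padic_null p X" "padic_null p Y"
  shows "padic_null p (\<lambda>n. X n + Y n)"
proof -
  have "(\<lambda>n. rat_padic_norm p (X n) + rat_padic_norm p (Y n)) \<longlonglongrightarrow> 0"
    using tendsto_add[OF assms[unfolded padic_null_def]] by simp
  then show ?thesis
    unfolding padic_null_def
    by (rule Lim_null_comparison[rotated]) (simp add: rat_padic_norm_add_le[OF prime])
qed

lemma padic_Cauchy_norm_convergent:
  assumes "padic_Cauchy p X"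
  shows "convergent (\<lambda>n. rat_padic_norm p (X n))"
proof -
  have "Cauchy (\<lambda>n. rat_padic_norm p (X n))"
    unfolding Cauchy_def dist_real_def
    using assms unfolding padic_Cauchy_def
    by (meson le_less_trans rat_padic_norm_diff_le[OF prime])
  then show ?thesis by (simp add: Cauchy_convergent_iff)
qed

lemma padic_Cauchy_bounded:
  assumes "padic_Cauchy p X"
  obtains B where "B > 0" "\<And>n. rat_padic_norm p (X n) \<le> B"
proof -
  have "Bseq (\<lambda>n. rat_padic_norm p (X n))"
    by (intro convergent_imp_Bseq padic_Cauchy_norm_convergent assms)
  then show ?thesis by (auto elim!: BseqE intro: that)
qed

lemma padic_null_mult:
  assumes "padic_Cauchy p X" "padic_null p Y"
  shows "padic_null p (\<lambda>n. X n * Y n)"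
proof -
  obtain B where B: "B > 0" "\<And>n. rat_padic_norm p (X n) \<le> B"
    using padic_Cauchy_bounded[OF assms(1)] by blast
  have "(\<lambda>n. B * rat_padic_norm p (Y n)) \<longlonglongrightarrow> 0"
    using assms(2) unfolding padic_null_def by (rule tendsto_mult_right_zero)
  then show ?thesis
    unfolding padic_null_def
    by (rule Lim_null_comparison[rotated])
       (auto simp: rat_padic_norm_mult[OF prime] intro!: always_eventually mult_right_mono B)
qed

lemma padic_Cauchy_mult:
  assumes "padic_Cauchy p X" "padic_Cauchy p Y"
  shows "padic_Cauchy p (\<lambda>n. X n * Y n)"
  unfolding padic_Cauchy_def
proof safe
  fix e :: real assume e: "e > 0"
  obtain B where B: "B > 0" "\<And>n. rat_padic_norm p (X n) \<le> B"
    using padic_Cauchy_bounded[OF assms(1)] by blast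
  obtain C where C: "C > 0" "\<And>n. rat_padic_norm p (Y n) \<le> C"
    using padic_Cauchy_bounded[OF assms(2)] by blast
  obtain M where M: "\<And>m n. m \<ge> M \<Longrightarrow> n \<ge> M \<Longrightarrow> rat_padic_norm p (X m - X n) < e / C"
    using assms(1) e C unfolding padic_Cauchy_def by (meson divide_pos_pos)
  obtain N where N: "\<And>m n. m \<ge> N \<Longrightarrow> n \<ge> N \<Longrightarrow> rat_padic_norm p (Y m - Y n) < e / B"
    using assms(2) e B unfolding padic_Cauchy_def by (meson divide_pos_pos)
  have "rat_padic_norm p (X m * Y m - X n * Y n) < e" if "m \<ge> max M N" "n \<ge> max M N" for m n
  proof -
    have "rat_padic_norm p ((X m - X n) * Y m) \<le> rat_padic_norm p (X m - X n) * C"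
      by (auto simp: rat_padic_norm_mult[OF prime] intro!: mult_left_mono C)
    also have "\<dots> < e"
      using M[of m n] that C by (simp add: field_simps)
    finally have 1: "rat_padic_norm p ((X m - X n) * Y m) < e" .
    have "rat_padic_norm p (X n * (Y m - Y n)) \<le> B * rat_padic_norm p (Y m - Y n)"
      by (auto simp: rat_padic_norm_mult[OF prime] intro!: mult_right_mono B)
    also have "\<dots> < e"
      using N[of m n] that B by (simp add: field_simps)
    finally have 2: "rat_padic_norm p (X n * (Y m - Y n)) < e" .
    show ?thesis
      using rat_padic_norm_add_le_max[OF prime, of "(X m - X n) * Y m" "X n * (Y m - Y n)"] 1 2
      by (simp add: algebra_simps)
  qed
  then show "\<exists>N. \<forall>m\<ge>N. \<forall>n\<ge>N. rat_padic_norm p (X m * Y m - X n * Y n) < e"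
    by blast
qed

lemma padic_Cauchy_not_null:
  assumes "padic_Cauchy p X" "\<not> padic_null p X"
  obtains b N where "b > 0" "\<And>n. n \<ge> N \<Longrightarrow> rat_padic_norm p (X n) > b"
proof -
  obtain L where L: "(\<lambda>n. rat_padic_norm p (X n)) \<longlonglongrightarrow> L"
    using padic_Cauchy_norm_convergent[OF assms(1)] by (auto simp: convergent_def)
  have "L \<ge> 0" by (rule LIMSEQ_le_const[OF L]) auto
  moreover have "L \<noteq> 0" using L assms(2) by (auto simp: padic_null_def)
  ultimately have "L > 0" by simp
  then have "eventually (\<lambda>n. rat_padic_norm p (X n) > L / 2) sequentially"
    by (intro order_tendstoD(1)[OF L]) auto
  with that[of "L / 2"] \<open>L > 0\<close> show ?thesis by (auto simp: eventually_sequentially)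
qed

lemma rat_padic_norm_inverse_diff:
  assumes "x \<noteq> 0" "y \<noteq> 0"
  shows "rat_padic_norm p (inverse x - inverse y) =
           rat_padic_norm p (x - y) / (rat_padic_norm p x * rat_padic_norm p y)"
proof -
  have "inverse x - inverse y = (y - x) * (inverse x * inverse y)"
    using assms by (simp add: field_simps)
  then show ?thesis
    by (simp only: rat_padic_norm_mult[OF prime] rat_padic_norm_inverse[OF prime]
          divide_inverse inverse_mult_distrib rat_padic_norm_minus_commute[of p y x])
qed

lemma padic_Cauchy_inverse:
  assumes "padic_Cauchy p X" "\<not> padic_null p X"
  shows "padic_Cauchy p (\<lambda>n. inverse (X n))"
  unfolding padic_Cauchy_def
proof safe
  fix e :: real assume e: "e > 0"
  obtain b M where b: "b > 0" "\<And>n. n \<ge> M \<Longrightarrow> rat_padic_norm p (X n) > b"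
    using padic_Cauchy_not_null[OF assms] by blast
  obtain N where N: "\<And>m n. m \<ge> N \<Longrightarrow> n \<ge> N \<Longrightarrow> rat_padic_norm p (X m - X n) < e * (b * b)"
    using assms(1) e b unfolding padic_Cauchy_def by (meson mult_pos_pos)
  have "rat_padic_norm p (inverse (X m) - inverse (X n)) < e"
    if mn: "m \<ge> max M N" "n \<ge> max M N" for m n
  proof -
    have nz: "X m \<noteq> 0" "X n \<noteq> 0" using b(1) b(2)[of m] b(2)[of n] mn by auto
    have "rat_padic_norm p (X m) * rat_padic_norm p (X n) > b * b"
      using b(1) b(2)[of m] b(2)[of n] mn by (intro mult_strict_mono) auto
    then have "e * (b * b) < e * (rat_padic_norm p (X m) * rat_padic_norm p (X n))"
      using e by simp
    with N[of m n] mn have "rat_padic_norm p (X m - X n) < e * (rat_padic_norm p (X m) * rat_padic_norm p (X n))"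
      by simp
    moreover have "rat_padic_norm p (X m) * rat_padic_norm p (X n) > 0"
      using nz by (simp add: less_le prime)
    ultimately show ?thesis
      by (simp add: rat_padic_norm_inverse_diff nz divide_less_eq)
  qed
  then show "\<exists>N. \<forall>m\<ge>N. \<forall>n\<ge>N. rat_padic_norm p (inverse (X m) - inverse (X n)) < e"
    by blast
qed

lemma padic_null_eventually_zero:
  assumes "eventually (\<lambda>n. X n = 0) sequentially"
  shows "padic_null p X"
  unfolding padic_null_def
  by (rule tendsto_eventually) (use assms in \<open>auto elim!: eventually_mono\<close>)

lemma padic_null_inverse_mult:
  assumes "padic_Cauchy p X" "\<not> padic_null p X"
  shows "padic_null p (\<lambda>n. inverse (X n) * X n - 1)"
proof -
  obtain b M where b: "b > 0" "\<And>n. n \<ge> M \<Longrightarrow> rat_padic_norm p (X n) > b"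
    using padic_Cauchy_not_null[OF assms] by blast
  have "inverse (X n) * X n - 1 = 0" if "n \<ge> M" for n
  proof -
    have "X n \<noteq> 0" using b(1) b(2)[OF that] by auto
    then show ?thesis by simp
  qed
  then show ?thesis
    by (intro padic_null_eventually_zero) (auto simp: eventually_sequentially)
qed

lemma padic_null_cong:
  assumes "padic_null p (\<lambda>n. X n - Y n)"
  shows "padic_null p X \<longleftrightarrow> padic_null p Y"
proof
  assume "padic_null p X"
  from padic_null_add[OF this padic_null_minus[OF assms]] show "padic_null p Y" by simp
next
  assume "padic_null p Y"
  from padic_null_add[OF this assms] show "padic_null p X" by simp
qed

lemma padic_null_inverse_diff:
  assumes "padic_Cauchy p X" "\<not> padic_null p X" "padic_Cauchy p Y" "\<not> padic_null p Y"
    and "padic_null p (\<lambda>n. X n - Y n)"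
  shows "padic_null p (\<lambda>n. inverse (X n) - inverse (Y n))"
proof -
  obtain b M where b: "b > 0" "\<And>n. n \<ge> M \<Longrightarrow> rat_padic_norm p (X n) > b"
    using padic_Cauchy_not_null[OF assms(1,2)] by blast
  obtain c N where c: "c > 0" "\<And>n. n \<ge> N \<Longrightarrow> rat_padic_norm p (Y n) > c"
    using padic_Cauchy_not_null[OF assms(3,4)] by blast
  have "padic_null p (\<lambda>n. inverse (X n) * (inverse (Y n) * (Y n - X n)))"
    using assms padic_null_minus[OF assms(5)]
    by (intro padic_null_mult padic_Cauchy_inverse) auto
  moreover have "inverse (X n) - inverse (Y n) = inverse (X n) * (inverse (Y n) * (Y n - X n))"
    if "n \<ge> max M N" for n
  proof -
    have "X n \<noteq> 0" "Y n \<noteq> 0" using b(1) b(2)[of n] c(1) c(2)[of n] that by auto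
    then show ?thesis by (simp add: field_simps)
  qed
  then have "eventually (\<lambda>n. inverse (X n) * (inverse (Y n) * (Y n - X n))
               = inverse (X n) - inverse (Y n)) sequentially"
    by (intro eventually_sequentiallyI[of "max M N"]) simp
  ultimately show ?thesis
    unfolding padic_null_def by (subst tendsto_cong[rotated]) (auto elim!: eventually_mono)
qed

lemma padic_rel_refl: "padic_Cauchy p X \<Longrightarrow> padic_rel p X X"
  by (simp add: padic_rel_def)

lemma padic_rel_sym: "padic_rel p X Y \<Longrightarrow> padic_rel p Y X"
  unfolding padic_rel_def using padic_null_minus[of p "\<lambda>n. X n - Y n"] by simp

lemma padic_rel_trans: "padic_rel p X Y \<Longrightarrow> padic_rel p Y Z \<Longrightarrow> padic_rel p X Z"
  unfolding padic_rel_def using padic_null_add[of "\<lambda>n. X n - Y n" "\<lambda>n. Y n - Z n"] by simp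

lemma part_equivp_padic_rel: "part_equivp (padic_rel p)"
proof (rule part_equivpI)
  show "\<exists>X. padic_rel p X X"
    by (rule exI[of _ "\<lambda>n. 0"]) (simp add: padic_rel_refl)
  show "symp (padic_rel p)" by (rule sympI) (rule padic_rel_sym)
  show "transp (padic_rel p)" by (rule transpI) (rule padic_rel_trans)
qed

lemma padic_rel_lim_norm:
  assumes "padic_rel p X Y"
  shows "lim (\<lambda>n. rat_padic_norm p (X n)) = lim (\<lambda>n. rat_padic_norm p (Y n))"
proof -
  have "(\<lambda>n. rat_padic_norm p (X n)) \<longlonglongrightarrow> lim (\<lambda>n. rat_padic_norm p (X n))"
    using assms padic_Cauchy_norm_convergent by (simp add: convergent_LIMSEQ_iff padic_rel_def)
  moreover have "(\<lambda>n. rat_padic_norm p (X n) - rat_padic_norm p (Y n)) \<longlonglongrightarrow> 0"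
    by (rule Lim_null_comparison[where g = "\<lambda>n. rat_padic_norm p (X n - Y n)"])
       (use assms in \<open>auto simp: padic_rel_def padic_null_def rat_padic_norm_diff_le[OF prime]\<close>)
  ultimately have "(\<lambda>n. rat_padic_norm p (Y n)) \<longlonglongrightarrow> lim (\<lambda>n. rat_padic_norm p (X n)) - 0"
    using tendsto_diff by fastforce
  then show ?thesis by (simp add: limI)
qed

end

text \<open>
  The prime \<open>p\<close> is carried by the type: \<open>p = CARD('a)\<close>, where the type variable \<open>'a\<close> of class
  \<^class>\<open>prime_card\<close> ranges over the types of prime cardinality.  The command
  for partial quotients cannot handle a relation that depends on a type not occurring in its
  arguments, so the type of equivalence classes is set up by hand.
\<close>

typedef (overloaded) 'a padic =
    "{{Y. padic_rel CARD('a::prime_card) X Y} | X. padic_Cauchy CARD('a) X}"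
  by (auto intro!: exI[of _ "\<lambda>n. 0"])

definition abs_padic :: "(nat \<Rightarrow> rat) \<Rightarrow> 'a::prime_card padic" where
  "abs_padic X = Abs_padic {Y. padic_rel CARD('a) X Y}"

definition rep_padic :: "'a::prime_card padic \<Rightarrow> nat \<Rightarrow> rat" where
  "rep_padic x = (SOME X. X \<in> Rep_padic x)"

definition cr_padic :: "(nat \<Rightarrow> rat) \<Rightarrow> 'a::prime_card padic \<Rightarrow> bool" where
  "cr_padic X x \<longleftrightarrow> padic_rel CARD('a) X X \<and> abs_padic X = x"

lemma Quotient_padic:
  "Quotient (padic_rel CARD('a::prime_card)) abs_padic rep_padic (cr_padic :: _ \<Rightarrow> 'a padic \<Rightarrow> _)"
proof -
  let ?R = "padic_rel CARD('a)"
  note sym = padic_rel_sym[OF prime_card, where ?'a1 = 'a]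
    and trans = padic_rel_trans[OF prime_card, where ?'a1 = 'a]
  have rep: "?R (rep_padic x) (rep_padic x) \<and> abs_padic (rep_padic x) = x" for x :: "'a padic"
  proof -
    obtain X where X: "Rep_padic x = {Y. ?R X Y}" "padic_Cauchy CARD('a) X"
      using Rep_padic[of x] by blast
    then have "X \<in> Rep_padic x" by (simp add: padic_rel_refl[OF prime_card])
    then have XR: "?R X (rep_padic x)"
      unfolding rep_padic_def using X(1) by (metis mem_Collect_eq someI)
    then have "{Y. ?R (rep_padic x) Y} = Rep_padic x"
      unfolding X(1) using sym trans by blast
    then show ?thesis
      using XR sym trans by (metis Rep_padic_inverse abs_padic_def)
  qed
  have eq: "(abs_padic X :: 'a padic) = abs_padic Y \<longleftrightarrow> ?R X Y"
    if XY: "padic_Cauchy CARD('a) X" "padic_Cauchy CARD('a) Y" for X Y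
  proof -
    have "(abs_padic X :: 'a padic) = abs_padic Y \<longleftrightarrow> {Z. ?R X Z} = {Z. ?R Y Z}"
      unfolding abs_padic_def using XY by (intro Abs_padic_inject) auto
    also have "\<dots> \<longleftrightarrow> ?R X Y"
      using sym trans padic_rel_refl[OF prime_card XY(2)] by blast
    finally show ?thesis .
  qed
  show ?thesis
    unfolding Quotient_alt_def cr_padic_def
    using rep eq padic_rel_def[of "CARD('a)"] padic_rel_refl[OF prime_card, where ?'a1 = 'a] by metis
qed

setup_lifting Quotient_padic

instantiation padic :: (prime_card) field
begin

lift_definition zero_padic :: "'a padic" is "\<lambda>n. 0"
  by (simp add: padic_rel_def)

lift_definition one_padic :: "'a padic" is "\<lambda>n. 1"
  by (simp add: padic_rel_def)

lift_definition plus_padic :: "'a padic \<Rightarrow> 'a padic \<Rightarrow> 'a padic" is "\<lambda>X Y n. X n + Y n"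
  unfolding padic_rel_def add_diff_add
  by (simp add: padic_Cauchy_add padic_null_add prime_card)

lift_definition uminus_padic :: "'a padic \<Rightarrow> 'a padic" is "\<lambda>X n. - X n"
  by (auto simp only: padic_rel_def minus_diff_minus intro: padic_Cauchy_minus padic_null_minus)

lift_definition times_padic :: "'a padic \<Rightarrow> 'a padic \<Rightarrow> 'a padic" is "\<lambda>X Y n. X n * Y n"
proof -
  fix X X' Y Y' :: "nat \<Rightarrow> rat"
  assume "padic_rel CARD('a) X X'" "padic_rel CARD('a) Y Y'"
  then have "padic_null CARD('a) (\<lambda>n. X n * (Y n - Y' n) + Y' n * (X n - X' n))"
    and "padic_Cauchy CARD('a) (\<lambda>n. X n * Y n)" "padic_Cauchy CARD('a) (\<lambda>n. X' n * Y' n)"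
    by (auto simp: padic_rel_def intro!: padic_null_add padic_null_mult padic_Cauchy_mult prime_card)
  then show "padic_rel CARD('a) (\<lambda>n. X n * Y n) (\<lambda>n. X' n * Y' n)"
    by (simp add: padic_rel_def algebra_simps)
qed

lift_definition inverse_padic :: "'a padic \<Rightarrow> 'a padic"
  is "\<lambda>X. if padic_null CARD('a) X then (\<lambda>n. 0) else (\<lambda>n. inverse (X n))"
proof -
  fix X Y :: "nat \<Rightarrow> rat"
  assume "padic_rel CARD('a) X Y"
  then show "padic_rel CARD('a)
    (if padic_null CARD('a) X then (\<lambda>n. 0) else (\<lambda>n. inverse (X n)))
    (if padic_null CARD('a) Y then (\<lambda>n. 0) else (\<lambda>n. inverse (Y n)))"
    using padic_null_cong[OF prime_card, of X Y]
    by (auto simp: padic_rel_def padic_Cauchy_inverse padic_null_inverse_diff prime_card)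
qed

definition "x - y = x + - y" for x y :: "'a padic"

definition "x div y = x * inverse y" for x y :: "'a padic"

instance
proof
  fix a b c :: "'a padic"
  show "a + b = b + a"
    by transfer (simp add: ac_simps padic_rel_def padic_Cauchy_add prime_card)
  show "(a + b) + c = a + (b + c)"
    by transfer (simp add: ac_simps padic_rel_def padic_Cauchy_add prime_card)
  show "0 + a = a"
    by transfer (simp add: padic_rel_def)
  show "- a + a = 0"
    by transfer (simp add: padic_rel_def)
  show "a - b = a + - b"
    by (rule minus_padic_def)
  show "(a * b) * c = a * (b * c)"
    by transfer (simp add: ac_simps padic_rel_def padic_Cauchy_mult prime_card)
  show "a * b = b * a"
    by transfer (simp add: ac_simps padic_rel_def padic_Cauchy_mult prime_card)
  show "1 * a = a"
    by transfer (simp add: padic_rel_def)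
  show "(a + b) * c = a * c + b * c"
    by transfer
       (simp add: distrib_right padic_rel_def padic_Cauchy_add padic_Cauchy_mult prime_card)
  show "(0::'a padic) \<noteq> 1"
    by transfer (simp add: padic_rel_def padic_null_def LIMSEQ_const_iff)
  show "a \<noteq> 0 \<Longrightarrow> inverse a * a = 1"
    by transfer
       (auto simp: padic_rel_def padic_null_inverse_mult padic_Cauchy_inverse padic_Cauchy_mult
          prime_card)
  show "a div b = a * inverse b"
    by (rule divide_padic_def)
  show "inverse (0::'a padic) = 0"
    by transfer (simp add: padic_rel_def)
qed

end

lift_definition padic_norm :: "'p::prime_card padic \<Rightarrow> real"
  is "\<lambda>X. lim (\<lambda>n. rat_padic_norm CARD('p) (X n))"
  by (rule padic_rel_lim_norm[OF prime_card])

lemma padic_Cauchy_norm_LIMSEQ: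
  assumes "padic_Cauchy CARD('p::prime_card) X"
  shows "(\<lambda>n. rat_padic_norm CARD('p) (X n)) \<longlonglongrightarrow> lim (\<lambda>n. rat_padic_norm CARD('p) (X n))"
  using padic_Cauchy_norm_convergent[OF prime_card assms] by (simp add: convergent_LIMSEQ_iff)

lemma padic_norm_eq_0_iff [simp]: "padic_norm x = 0 \<longleftrightarrow> x = 0"
proof (transfer, safe)
  fix X :: "nat \<Rightarrow> rat"
  assume X: "padic_rel CARD('a) X X" and "lim (\<lambda>n. rat_padic_norm CARD('a) (X n)) = 0"
  then show "padic_rel CARD('a) X (\<lambda>n. 0)"
    using padic_Cauchy_norm_LIMSEQ[of X, where ?'p = 'a]
    by (simp add: padic_rel_def padic_null_def)
next
  fix X :: "nat \<Rightarrow> rat"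
  assume "padic_rel CARD('a) X (\<lambda>n. 0)"
  then show "lim (\<lambda>n. rat_padic_norm CARD('a) (X n)) = 0"
    by (auto simp: padic_rel_def padic_null_def intro: limI)
qed

lemma padic_norm_0 [simp]: "padic_norm 0 = 0"
  by simp

lemma padic_norm_minus [simp]: "padic_norm (- x) = padic_norm x"
  by transfer simp

lemma padic_norm_mult: "padic_norm (x * y) = padic_norm x * padic_norm y"
  by transfer
     (auto simp: padic_rel_def rat_padic_norm_mult prime_card
        intro!: limI tendsto_mult padic_Cauchy_norm_LIMSEQ)

lemma padic_norm_add_le_max: "padic_norm (x + y) \<le> max (padic_norm x) (padic_norm y)"
proof transfer
  fix X Y :: "nat \<Rightarrow> rat"
  assume "padic_rel CARD('a) X X" "padic_rel CARD('a) Y Y"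
  then have XY: "padic_Cauchy CARD('a) X" "padic_Cauchy CARD('a) Y"
    by (auto simp: padic_rel_def)
  show "lim (\<lambda>n. rat_padic_norm CARD('a) (X n + Y n))
      \<le> max (lim (\<lambda>n. rat_padic_norm CARD('a) (X n))) (lim (\<lambda>n. rat_padic_norm CARD('a) (Y n)))"
    by (rule tendsto_le[OF _ tendsto_max[OF XY[THEN padic_Cauchy_norm_LIMSEQ]]
          padic_Cauchy_norm_LIMSEQ[OF padic_Cauchy_add[OF prime_card XY]]])
       (auto simp: rat_padic_norm_add_le_max[OF prime_card])
qed

lemma padic_norm_nonneg [simp]: "padic_norm x \<ge> 0"
  using padic_norm_add_le_max[of x "- x"] by simp

instantiation padic :: (prime_card) metric_space
begin

definition "dist x y = padic_norm (x - y)" for x y :: "'a padic"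

definition "uniformity = (INF e\<in>{0<..}. principal {(x, y). dist x (y :: 'a padic) < e})"

definition "open U \<longleftrightarrow> (\<forall>x\<in>U. eventually (\<lambda>(x', y). x' = x \<longrightarrow> y \<in> U) uniformity)"
  for U :: "'a padic set"

instance
proof
  fix x y z :: "'a padic"
  show "dist x y = 0 \<longleftrightarrow> x = y" by (simp add: dist_padic_def)
  show "dist x y \<le> dist x z + dist y z"
  proof -
    have "padic_norm (x - y) \<le> max (padic_norm (x - z)) (padic_norm (z - y))"
      using padic_norm_add_le_max[of "x - z" "z - y"] by simp
    also have "\<dots> \<le> padic_norm (x - z) + padic_norm (z - y)" by simp
    also have "padic_norm (z - y) = padic_norm (y - z)"
      using padic_norm_minus[of "z - y"] by simp
    finally show ?thesis by (simp add: dist_padic_def)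
  qed
qed (rule uniformity_padic_def open_padic_def)+

end

definition padic_integers :: "'p::prime_card padic set" where
  "padic_integers = {x. padic_norm x \<le> 1}"


section \<open>Haar measure\<close>

text \<open>
  A Haar measure on a subgroup \<open>G\<close> of an abelian topological group.  Regularity is not
  listed: it is automatic for locally finite Borel measures on the second countable, locally compact
  groups \<open>\<int>\<^sub>p\<close> and \<open>\<rat>\<^sub>p\<^sup>2\<close> for which the notion is used below.
\<close>

definition haar_measure_on :: "'a::{topological_space, ab_group_add} set \<Rightarrow> 'a measure \<Rightarrow> bool" where
  "haar_measure_on G \<mu> \<longleftrightarrow>
     space \<mu> = G \<and> sets \<mu> = sets (restrict_space borel G) \<and>
     (\<forall>g\<in>G. \<forall>A\<in>sets \<mu>. emeasure \<mu> ((+) g ` A) = emeasure \<mu> A) \<and>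
     (\<forall>K\<subseteq>G. compact K \<longrightarrow> emeasure \<mu> K < \<infinity>) \<and>
     (\<forall>U. open U \<and> U \<inter> G \<noteq> {} \<longrightarrow> 0 < emeasure \<mu> (U \<inter> G))"

text \<open>
  \<open>X\<close> is uniformly distributed in the compact group \<open>G\<close>: its law, which is a probability measure
  as \<open>M\<close> is one, is a Haar measure on \<open>G\<close>.
\<close>

definition uniformly_distributed_in ::
    "'w measure \<Rightarrow> 'a::{topological_space, ab_group_add} set \<Rightarrow> ('w \<Rightarrow> 'a) \<Rightarrow> bool" where
  "uniformly_distributed_in M G X \<longleftrightarrow>
     X \<in> measurable M (restrict_space borel G) \<and>
     haar_measure_on G (distr M (restrict_space borel G) X)"


section \<open>The projective line\<close>

definition proportional :: "'a::field \<times> 'a \<Rightarrow> 'a \<times> 'a \<Rightarrow> bool" where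
  "proportional v w \<longleftrightarrow> v \<noteq> 0 \<and> w \<noteq> 0 \<and> (\<exists>c. c \<noteq> 0 \<and> w = (c * fst v, c * snd v))"

lemma part_equivp_proportional: "part_equivp proportional"
proof (rule part_equivpI)
  show "\<exists>v::'a \<times> 'a. proportional v v"
    by (rule exI[of _ "(1, 0)"]) (auto simp: proportional_def zero_prod_def intro!: exI[of _ 1])
  show "symp (proportional :: 'a \<times> 'a \<Rightarrow> _)"
  proof (rule sympI)
    fix v w :: "'a \<times> 'a"
    assume "proportional v w"
    then obtain c where "v \<noteq> 0" "w \<noteq> 0" "c \<noteq> 0" "w = (c * fst v, c * snd v)"
      by (auto simp: proportional_def)
    then show "proportional w v"
      by (auto simp: proportional_def intro!: exI[of _ "inverse c"] prod_eqI)
  qed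
  show "transp (proportional :: 'a \<times> 'a \<Rightarrow> _)"
  proof (rule transpI)
    fix u v w :: "'a \<times> 'a"
    assume "proportional u v" "proportional v w"
    then obtain c d where "u \<noteq> 0" "w \<noteq> 0" "c \<noteq> 0" "d \<noteq> 0"
        "v = (c * fst u, c * snd u)" "w = (d * fst v, d * snd v)"
      by (auto simp: proportional_def)
    then show "proportional u w"
      by (auto simp: proportional_def intro!: exI[of _ "d * c"])
  qed
qed

quotient_type (overloaded) 'a proj_line = "'a::field \<times> 'a" / partial: proportional
  morphisms proj_rep proj_point
  by (rule part_equivp_proportional)

text \<open>The quotient topology of the punctured plane.\<close>

instantiation proj_line :: ("{field, t1_space}") topological_space
begin

definition "open U \<longleftrightarrow> open {v. v \<noteq> 0 \<and> proj_point v \<in> U}" for U :: "'a proj_line set"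

instance
proof
  have "{v. v \<noteq> (0::'a \<times> 'a)} = - {0}" by auto
  then show "open (UNIV :: 'a proj_line set)" by (auto simp: open_proj_line_def)
next
  fix S T :: "'a proj_line set"
  assume "open S" "open T"
  moreover have "{v. v \<noteq> 0 \<and> proj_point v \<in> S \<inter> T}
      = {v. v \<noteq> 0 \<and> proj_point v \<in> S} \<inter> {v. v \<noteq> 0 \<and> proj_point v \<in> T}" by auto
  ultimately show "open (S \<inter> T)" by (auto simp: open_proj_line_def)
next
  fix K :: "'a proj_line set set"
  assume "\<forall>S\<in>K. open S"
  moreover have "{v. v \<noteq> 0 \<and> proj_point v \<in> \<Union>K} = (\<Union>S\<in>K. {v. v \<noteq> 0 \<and> proj_point v \<in> S})"
    by auto
  ultimately show "open (\<Union>K)" by (auto simp: open_proj_line_def)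
qed

end

definition padic_unit_sphere :: "('p::prime_card padic \<times> 'p padic) set" where
  "padic_unit_sphere = {(a0, a1). max (padic_norm a0) (padic_norm a1) = 1}"

definition proj_line_measure ::
    "('p::prime_card padic \<times> 'p padic) measure \<Rightarrow> 'p padic proj_line set \<Rightarrow> ennreal" where
  "proj_line_measure \<mu> U =
     ennreal (1 / (1 - 1 / real CARD('p))) * emeasure \<mu> {a \<in> padic_unit_sphere. proj_point a \<in> U}"


section \<open>Zeroes of binary forms\<close>

definition binary_form :: "nat \<Rightarrow> (nat \<Rightarrow> 'a::field) \<Rightarrow> 'a \<times> 'a \<Rightarrow> 'a" where
  "binary_form d c = (\<lambda>(x0, x1). \<Sum>k\<le>d. c k * x0 ^ (d - k) * x1 ^ k)"

definition proj_zeroes :: "('a::field \<times> 'a \<Rightarrow> 'a) \<Rightarrow> 'a proj_line set" where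
  "proj_zeroes f = {proj_point v | v. v \<noteq> 0 \<and> f v = 0}"

text \<open>The number of elements, \<open>\<infinity>\<close> for an infinite set.\<close>

definition num_elements :: "'a set \<Rightarrow> ennreal" where
  "num_elements A = emeasure (count_space UNIV) A"

end

theory Submission
  imports Defs
begin

text \<open>
  Zeros are counted in two disjoint charts that cover the projective line: the points \<open>[1 : x]\<close> with
  \<open>x \<in> \<int>\<^sub>p\<close> and the points \<open>[x : 1]\<close> with \<open>x \<in> p\<int>\<^sub>p\<close>. In the first one the form becomes the polynomial
  \<open>g(x) = \<Sum> \<zeta>\<^sub>k x\<^sup>k\<close>, in the second one the polynomial with the coefficients reversed. Reversal does not
  change the joint law of the coefficients, so both charts are covered by one statement
  (\<open>num_zeros_Borel\<close>): the expected number of zeros of \<open>g\<close> in a Borel set \<open>A \<subseteq> \<int>\<^sub>p\<close> is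
  \<open>p / (p + 1)\<close> times the Haar measure of \<open>A\<close>. The measure on the projective line is in both charts
  the Haar measure (\<open>proj_line_measure_charts\<close>), with total mass \<open>1 + 1/p = (p + 1) / p\<close>, and the
  theorem follows.

  The statement about \<open>g\<close> is a \<open>p\<close>-adic Kac-Rice computation. It rests on two facts about a point
  \<open>b \<in> \<int>\<^sub>p\<close>. First, \<open>g(b)\<close> and \<open>g'(b)\<close> are independent and uniform: \<open>g(b)\<close> is \<open>\<zeta>\<^sub>0\<close> plus a term that
  depends on \<open>\<zeta>\<^sub>1, \<dots>, \<zeta>\<^sub>d\<close>, \<open>g'(b)\<close> is \<open>\<zeta>\<^sub>1\<close> plus a term that depends on \<open>\<zeta>\<^sub>2, \<dots>, \<zeta>\<^sub>d\<close>, and a uniform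
  variable stays uniform after an independent translation (\<open>emeasure_eval_deriv\<close>). Second, by Hensel's
  lemma, if \<open>|g'(b)| > p\<^sup>-\<^sup>m\<close> then \<open>g\<close> has exactly one zero in \<open>b + p\<^sup>m\<int>\<^sub>p\<close> when
  \<open>|g(b)| \<le> p\<^sup>-\<^sup>m |g'(b)|\<close>, and none otherwise (\<open>hensel_unique\<close>, \<open>hensel_exists_iff\<close>).

  The expected number of zeros in \<open>b + p\<^sup>m\<int>\<^sub>p\<close> is therefore \<open>p\<^sup>-\<^sup>m\<close> times the mean of \<open>|g'(b)|\<close>,
  which is \<open>\<Sum>\<^sub>j p\<^sup>-\<^sup>j (p\<^sup>-\<^sup>j - p\<^sup>-\<^sup>j\<^sup>-\<^sup>1) = p / (p + 1)\<close>, up to an error caused by the event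
  \<open>|g'(b)| \<le> p\<^sup>-\<^sup>m\<close>. On that event a zero forces \<open>|g(b)| \<le> p\<^sup>-\<^sup>2\<^sup>m\<close>, so zeros occur there with
  probability at most \<open>p\<^sup>-\<^sup>3\<^sup>m\<close>, and there are at most \<open>d\<close> of them. A ball of radius \<open>p\<^sup>-\<^sup>n\<close> is the union of
  \<open>p\<^sup>k\<close> balls of radius \<open>p\<^sup>-\<^sup>n\<^sup>-\<^sup>k\<close>; the sum of the \<open>p\<^sup>k\<close> errors tends to \<open>0\<close> as \<open>k\<close> grows, and what
  remains is the exact value \<open>p\<^sup>-\<^sup>n p / (p + 1)\<close> (\<open>expectation_zero_count_ball\<close>). Since balls generate
  the Borel sets and any two of them are nested or disjoint, Dynkin's lemma extends the formula to all
  Borel sets.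
\<close>

section \<open>The ideals of \<open>\<int>\<^sub>p\<close> and their cosets\<close>

text \<open>
  The ideal \<open>p\<^sup>n\<int>\<^sub>p\<close>, so that \<open>x - y \<in> padic_ideal n\<close> is congruence modulo \<open>p\<^sup>n\<close>; a ball of radius
  \<open>p\<^sup>-\<^sup>n\<close> is a coset of it.
\<close>

definition padic_ideal :: "nat \<Rightarrow> 'p::prime_card padic set" where
  "padic_ideal n = {x. padic_norm x \<le> 1 / real CARD('p) ^ n}"

definition padic_ball :: "'p::prime_card padic \<Rightarrow> nat \<Rightarrow> 'p padic set" where
  "padic_ball a n = {x. x - a \<in> padic_ideal n}"

lemma card_gt_1: "1 < real CARD('p::prime_card)"
  using prime_gt_1_nat[OF prime_card, where ?'a1 = 'p] by simp

lemma card_pos: "0 < real CARD('p::prime_card)"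
  using card_gt_1[where 'p = 'p] by linarith

lemma padic_norm_1 [simp]: "padic_norm 1 = 1"
proof -
  have "padic_norm (1 :: 'a padic) * padic_norm (1 :: 'a padic) = padic_norm (1 :: 'a padic)"
    by (simp flip: padic_norm_mult)
  then show ?thesis using padic_norm_eq_0_iff[of "1 :: 'a padic"] by simp
qed

lemma padic_norm_inverse: "padic_norm (inverse x) = inverse (padic_norm x)"
proof (cases "x = 0")
  case False
  then have "padic_norm (inverse x) * padic_norm x = 1"
    by (simp flip: padic_norm_mult)
  then show ?thesis by (metis inverse_unique mult.commute)
qed auto

lemma padic_norm_divide: "padic_norm (x / y) = padic_norm x / padic_norm y"
  by (simp add: divide_inverse padic_norm_mult padic_norm_inverse)

lemma padic_norm_minus_commute: "padic_norm (x - y) = padic_norm (y - x)"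
  using padic_norm_minus[of "x - y"] by simp

text \<open>
  All triangles are isosceles: the ultrametric inequality is applied to \<open>x + y\<close> and to
  \<open>x = (x + y) - y\<close>.
\<close>

lemma padic_norm_add_eq_left:
  assumes "padic_norm y < padic_norm x"
  shows "padic_norm (x + y) = padic_norm x"
  using padic_norm_add_le_max[of x y] padic_norm_add_le_max[of "x + y" "- y"] assms by auto

lemma padic_ideal_0: "padic_ideal 0 = padic_integers"
  by (simp add: padic_ideal_def padic_integers_def)

lemma zero_in_padic_ideal [simp]: "0 \<in> padic_ideal n"
  by (simp add: padic_ideal_def)

lemma zero_in_padic_integers [simp]: "0 \<in> padic_integers"
  by (simp add: padic_integers_def)

lemma one_in_padic_integers [simp]: "1 \<in> padic_integers"
  by (simp add: padic_integers_def)

lemma padic_ideal_add: "x \<in> padic_ideal n \<Longrightarrow> y \<in> padic_ideal n \<Longrightarrow> x + y \<in> padic_ideal n"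
  unfolding padic_ideal_def using padic_norm_add_le_max[of x y] by auto

lemma padic_ideal_minus [simp]: "- x \<in> padic_ideal n \<longleftrightarrow> x \<in> padic_ideal n"
  by (simp add: padic_ideal_def)

lemma padic_ideal_diff: "x \<in> padic_ideal n \<Longrightarrow> y \<in> padic_ideal n \<Longrightarrow> x - y \<in> padic_ideal n"
  using padic_ideal_add[of x n "- y"] by simp

lemma padic_ideal_minus_commute: "x - y \<in> padic_ideal n \<longleftrightarrow> y - x \<in> padic_ideal n"
  using padic_ideal_minus[of "x - y" n] by simp

lemma padic_ideal_mult:
  fixes x y :: "'p::prime_card padic"
  assumes "x \<in> padic_ideal m" "y \<in> padic_ideal n"
  shows "x * y \<in> padic_ideal (m + n)"
proof -
  have "padic_norm x * padic_norm y \<le> (1 / real CARD('p) ^ m) * (1 / real CARD('p) ^ n)"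
    using assms by (intro mult_mono) (auto simp: padic_ideal_def)
  then show ?thesis by (simp add: padic_ideal_def padic_norm_mult power_add)
qed

lemma padic_ideal_mult_left: "x \<in> padic_integers \<Longrightarrow> y \<in> padic_ideal n \<Longrightarrow> x * y \<in> padic_ideal n"
  using padic_ideal_mult[of x 0 y n] by (simp add: padic_ideal_0)

lemma padic_ideal_mult_right: "x \<in> padic_ideal n \<Longrightarrow> y \<in> padic_integers \<Longrightarrow> x * y \<in> padic_ideal n"
  using padic_ideal_mult_left[of y x n] by (simp add: mult.commute)

lemma padic_ideal_sum: "(\<And>i. i \<in> I \<Longrightarrow> f i \<in> padic_ideal n) \<Longrightarrow> sum f I \<in> padic_ideal n"
  by (induction I rule: infinite_finite_induct) (auto intro: padic_ideal_add)

lemma padic_ideal_antimono: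
  assumes "m \<le> n"
  shows "padic_ideal n \<subseteq> (padic_ideal m :: 'p::prime_card padic set)"
proof -
  have "1 / real CARD('p) ^ n \<le> 1 / real CARD('p) ^ m"
    using assms card_gt_1[where 'p='p] by (intro divide_left_mono power_increasing) auto
  then show ?thesis unfolding padic_ideal_def by auto
qed

lemma padic_ideal_subset_integers: "padic_ideal n \<subseteq> padic_integers"
  using padic_ideal_antimono[of 0 n] by (simp add: padic_ideal_0)

lemmas padic_integers_add = padic_ideal_add[of _ 0, unfolded padic_ideal_0]
lemmas padic_integers_diff = padic_ideal_diff[of _ 0, unfolded padic_ideal_0]
lemmas padic_integers_mult = padic_ideal_mult_left[of _ _ 0, unfolded padic_ideal_0]
lemmas padic_integers_sum = padic_ideal_sum[of _ _ 0, unfolded padic_ideal_0]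

lemma padic_integers_power: "x \<in> padic_integers \<Longrightarrow> x ^ k \<in> padic_integers"
  by (induction k) (auto intro: padic_integers_mult)

lemma of_nat_in_padic_integers [simp]: "of_nat k \<in> padic_integers"
proof (induction k)
  case (Suc k)
  then show ?case using padic_integers_add[OF one_in_padic_integers] by simp
qed (simp add: padic_integers_def)

lemma padic_ideal_eq_0_iff:
  fixes x :: "'p::prime_card padic"
  shows "(\<forall>n. x \<in> padic_ideal n) \<longleftrightarrow> x = 0"
proof
  assume x: "\<forall>n. x \<in> padic_ideal n"
  show "x = 0"
  proof (rule ccontr)
    assume "x \<noteq> 0"
    then have pos: "padic_norm x > 0" using padic_norm_nonneg[of x] padic_norm_eq_0_iff[of x] by linarith
    obtain n where "(1 / real CARD('p)) ^ n < padic_norm x"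
      using real_arch_pow_inv[OF pos, of "1 / real CARD('p)"] card_gt_1[where 'p='p] by auto
    with x show False by (auto simp: padic_ideal_def power_one_over not_le dest!: spec[of _ n])
  qed
qed simp

lemma padic_ball_self [simp]: "a \<in> padic_ball a n"
  by (simp add: padic_ball_def)

text \<open>
  Cosets of a subgroup: every point of a ball is a centre of it. Hence two balls are nested or
  disjoint.
\<close>

lemma padic_ball_eq:
  assumes "b \<in> padic_ball a n"
  shows "padic_ball b n = padic_ball a n"
proof -
  have "x - b \<in> padic_ideal n \<longleftrightarrow> x - a \<in> padic_ideal n" for x
    using assms padic_ideal_add[of "x - b" n "b - a"] padic_ideal_diff[of "x - a" n "b - a"]
    by (auto simp: padic_ball_def)
  then show ?thesis by (simp add: padic_ball_def)
qed

lemma padic_ball_antimono: "m \<le> n \<Longrightarrow> padic_ball a n \<subseteq> padic_ball a m"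
  unfolding padic_ball_def using padic_ideal_antimono[of m n] by blast

lemma padic_ball_Int:
  assumes "m \<le> n"
  shows "padic_ball a m \<inter> padic_ball b n = {} \<or> padic_ball a m \<inter> padic_ball b n = padic_ball b n"
  using padic_ball_eq[of _ a m] padic_ball_eq[of _ b n] padic_ball_antimono[OF assms] by blast

lemma padic_ball_subset_integers: "a \<in> padic_integers \<Longrightarrow> padic_ball a n \<subseteq> padic_integers"
proof
  fix x assume a: "a \<in> padic_integers" and "x \<in> padic_ball a n"
  then have "x - a \<in> padic_integers" using padic_ideal_subset_integers by (auto simp: padic_ball_def)
  from padic_integers_add[OF this a] show "x \<in> padic_integers" by simp
qed

lemma padic_ball_Int_integers:
  "padic_ball a n \<inter> padic_integers = (if a \<in> padic_integers then padic_ball a n else {})"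
proof (cases "a \<in> padic_integers")
  case True
  then show ?thesis using padic_ball_subset_integers[OF True] by auto
next
  case False
  have "x \<notin> padic_integers" if "x \<in> padic_ball a n" for x
  proof
    assume "x \<in> padic_integers"
    moreover have "a \<in> padic_ball x n" using that by (simp add: padic_ball_def padic_ideal_minus_commute)
    ultimately show False using False padic_ball_subset_integers by blast
  qed
  with False show ?thesis by auto
qed

lemma padic_ball_translate: "(+) c ` padic_ball a n = padic_ball (c + a) n"
proof safe
  fix x assume "x \<in> padic_ball (c + a) n"
  then have "x - c \<in> padic_ball a n" by (simp add: padic_ball_def diff_diff_eq)
  then show "x \<in> (+) c ` padic_ball a n" by (intro image_eqI[of _ _ "x - c"]) auto
qed (simp add: padic_ball_def)

section \<open>Density of the rationals and of the integers\<close>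

definition padic_of_rat :: "rat \<Rightarrow> 'p::prime_card padic" where
  "padic_of_rat q = abs_padic (\<lambda>_. q)"

lemma abs_padic_diff:
  assumes "padic_Cauchy CARD('p) X" "padic_Cauchy CARD('p) Y"
  shows "abs_padic X - abs_padic Y = (abs_padic (\<lambda>n. X n - Y n) :: 'p::prime_card padic)"
  using assms
  by (simp add: minus_padic_def uminus_padic.abs_eq plus_padic.abs_eq padic_rel_def padic_Cauchy_minus prime_card)

lemma padic_norm_abs_padic_le:
  assumes "padic_Cauchy CARD('p) X" "\<And>n. n \<ge> N \<Longrightarrow> rat_padic_norm CARD('p) (X n) \<le> e"
  shows "padic_norm (abs_padic X :: 'p::prime_card padic) \<le> e"
proof -
  have "padic_norm (abs_padic X :: 'p padic) = lim (\<lambda>n. rat_padic_norm CARD('p) (X n))"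
    using assms(1) by (simp add: padic_norm.abs_eq padic_rel_def)
  also have "\<dots> \<le> e"
    using padic_Cauchy_norm_LIMSEQ[OF assms(1)] assms(2) by (intro LIMSEQ_le_const2) auto
  finally show ?thesis .
qed

lemma padic_of_rat_diff: "padic_of_rat (x - y) = padic_of_rat x - padic_of_rat y"
  by (simp add: padic_of_rat_def abs_padic_diff)

lemma padic_norm_of_rat: "padic_norm (padic_of_rat q :: 'p::prime_card padic) = rat_padic_norm CARD('p) q"
  by (simp add: padic_of_rat_def padic_norm.abs_eq padic_rel_def)

lemma padic_of_rat_of_nat: "padic_of_rat (of_nat n) = of_nat n"
proof (induction n)
  case 0
  show ?case by (simp add: padic_of_rat_def zero_padic_def)
next
  case (Suc n)
  have "padic_of_rat (of_nat (Suc n)) = (padic_of_rat 1 + padic_of_rat (of_nat n) :: 'a padic)"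
    by (simp add: padic_of_rat_def plus_padic.abs_eq padic_rel_def)
  then show ?case using Suc by (simp add: padic_of_rat_def one_padic_def)
qed

text \<open>
  The rational terms of a Cauchy sequence converge to the \<open>p\<close>-adic number that it represents. This
  gives density of the rationals, and by a diagonal argument completeness.
\<close>

lemma abs_padic_approx:
  assumes "padic_Cauchy CARD('p) X" "e > 0"
  obtains N where "\<And>n. n \<ge> N \<Longrightarrow> padic_norm (abs_padic X - padic_of_rat (X n) :: 'p::prime_card padic) < e"
proof -
  have "e / 2 > 0" using assms by simp
  then obtain N where N: "\<And>m n. m \<ge> N \<Longrightarrow> n \<ge> N \<Longrightarrow> rat_padic_norm CARD('p) (X m - X n) < e / 2"
    using assms(1) unfolding padic_Cauchy_def by blast
  have "padic_norm (abs_padic X - padic_of_rat (X n) :: 'p padic) < e" if "n \<ge> N" for n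
  proof -
    have C: "padic_Cauchy CARD('p) (\<lambda>m. X m - X n)"
      using padic_Cauchy_add[OF prime_card assms(1) padic_Cauchy_const[of _ "- X n"]] by simp
    have "padic_norm (abs_padic X - padic_of_rat (X n) :: 'p padic) \<le> e / 2"
      unfolding padic_of_rat_def abs_padic_diff[OF assms(1) padic_Cauchy_const]
      using N that by (intro padic_norm_abs_padic_le[OF C, of N]) (auto intro: less_imp_le)
    then show ?thesis using assms(2) by simp
  qed
  then show ?thesis using that by blast
qed

lemma padic_rat_dense:
  fixes x :: "'p::prime_card padic"
  assumes "e > 0"
  obtains q where "padic_norm (x - padic_of_rat q) < e"
proof -
  have "cr_padic (rep_padic x) x"
    using Quotient_padic[where ?'a = 'p] unfolding Quotient_alt_def cr_padic_def by blast
  then have x: "padic_Cauchy CARD('p) (rep_padic x)" "abs_padic (rep_padic x) = x"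
    by (auto simp: cr_padic_def padic_rel_def)
  show ?thesis using abs_padic_approx[OF x(1) assms] x(2) that by (metis order_refl)
qed

instance padic :: (prime_card) complete_space
proof
  fix X :: "nat \<Rightarrow> 'a padic"
  assume X: "Cauchy X"
  \<comment> \<open>Each term is replaced by a close rational; the rationals form a Cauchy sequence with the same limit.\<close>
  have "\<exists>q. padic_norm (X n - padic_of_rat q) < inverse (Suc n)" for n
    using padic_rat_dense[of "inverse (Suc n)" "X n"] by auto
  then obtain q where q: "\<And>n. padic_norm (X n - padic_of_rat (q n)) < inverse (Suc n)"
    by metis
  have close: "\<exists>N. \<forall>n\<ge>N. padic_norm (X n - padic_of_rat (q n)) < e" if "e > 0" for e
  proof -
    obtain N where N: "inverse (real (Suc N)) < e" using reals_Archimedean[OF \<open>e > 0\<close>] by blast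
    have "padic_norm (X n - padic_of_rat (q n)) < e" if "n \<ge> N" for n
    proof -
      have "inverse (real (Suc n)) \<le> inverse (Suc N)" using that by (intro le_imp_inverse_le) auto
      then show ?thesis using q[of n] N by linarith
    qed
    then show ?thesis by blast
  qed
  have C: "padic_Cauchy CARD('a) q"
    unfolding padic_Cauchy_def
  proof safe
    fix e :: real assume e: "e > 0"
    obtain M where M: "\<And>m n. m \<ge> M \<Longrightarrow> n \<ge> M \<Longrightarrow> padic_norm (X m - X n) < e"
      using X e unfolding Cauchy_def dist_padic_def by blast
    obtain N where N: "\<And>n. n \<ge> N \<Longrightarrow> padic_norm (X n - padic_of_rat (q n)) < e"
      using close[OF e] by blast
    have "rat_padic_norm CARD('a) (q m - q n) < e" if "m \<ge> max M N" "n \<ge> max M N" for m n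
    proof -
      have "padic_of_rat (q m - q n) = ((padic_of_rat (q m) - X m) + (X m - X n)) + (X n - padic_of_rat (q n))"
        by (simp add: padic_of_rat_diff)
      moreover have "padic_norm (padic_of_rat (q m) - X m) < e"
        using N[of m] that by (simp add: padic_norm_minus_commute)
      moreover have "padic_norm (X m - X n) < e" "padic_norm (X n - padic_of_rat (q n)) < e"
        using M N that by auto
      ultimately have "padic_norm (padic_of_rat (q m - q n) :: 'a padic) < e"
        using padic_norm_add_le_max[of "(padic_of_rat (q m) - X m) + (X m - X n)" "X n - padic_of_rat (q n)"]
          padic_norm_add_le_max[of "padic_of_rat (q m) - X m" "X m - X n"] by simp
      then show ?thesis by (simp add: padic_norm_of_rat)
    qed
    then show "\<exists>N. \<forall>m\<ge>N. \<forall>n\<ge>N. rat_padic_norm CARD('a) (q m - q n) < e" by blast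
  qed
  have "X \<longlonglongrightarrow> abs_padic q"
    unfolding LIMSEQ_def dist_padic_def
  proof safe
    fix e :: real assume e: "e > 0"
    obtain M where M: "\<And>n. n \<ge> M \<Longrightarrow> padic_norm (abs_padic q - padic_of_rat (q n) :: 'a padic) < e"
      using abs_padic_approx[OF C e] by blast
    obtain N where N: "\<And>n. n \<ge> N \<Longrightarrow> padic_norm (X n - padic_of_rat (q n)) < e"
      using close[OF e] by blast
    have "padic_norm (X n - abs_padic q) < e" if "n \<ge> max M N" for n
      using padic_norm_add_le_max[of "X n - padic_of_rat (q n)" "padic_of_rat (q n) - abs_padic q"]
        M[of n] N[of n] that by (simp add: padic_norm_minus_commute)
    then show "\<exists>no. \<forall>n\<ge>no. padic_norm (X n - abs_padic q) < e" by blast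
  qed
  then show "convergent X" by (auto simp: convergent_def)
qed

text \<open>
  A rational that is closer to \<open>x\<close> than \<open>0\<close> is has the same norm as \<open>x\<close>, so the nonzero values of the
  norm on \<open>\<rat>\<^sub>p\<close> are those on \<open>\<rat>\<close>.
\<close>

lemma padic_norm_cases:
  fixes x :: "'p::prime_card padic"
  assumes "x \<noteq> 0"
  obtains k :: int where "padic_norm x = real CARD('p) powi k"
proof -
  have pos: "padic_norm x > 0" using assms padic_norm_nonneg[of x] padic_norm_eq_0_iff[of x] by linarith
  obtain q where q: "padic_norm (x - padic_of_rat q) < padic_norm x"
    using padic_rat_dense[OF pos] by blast
  have "padic_norm x = padic_norm (padic_of_rat q :: 'p padic)"
    using padic_norm_add_eq_left[of "padic_of_rat q - x" x] q by (simp add: padic_norm_minus_commute)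
  then show ?thesis using that pos by (auto simp: padic_norm_of_rat rat_padic_norm_def split: if_splits)
qed

text \<open>
  The value group is discrete, so \<open>p\<^sup>j\<int>\<^sub>p\<close> without \<open>p\<^sup>j\<^sup>+\<^sup>1\<int>\<^sub>p\<close> is a sphere. This turns the strict
  inequalities on norms in Hensel's lemma into membership in ideals.
\<close>

lemma padic_norm_eq_power_if:
  fixes x :: "'p::prime_card padic"
  assumes "x \<in> padic_ideal j" "x \<notin> padic_ideal (Suc j)"
  shows "padic_norm x = 1 / real CARD('p) ^ j"
proof -
  have "x \<noteq> 0" using assms by auto
  then obtain k where k: "padic_norm x = real CARD('p) powi k" by (rule padic_norm_cases)
  have c: "1 < real CARD('p)" by (rule card_gt_1)
  have *: "1 / real CARD('p) ^ n = real CARD('p) powi (- int n)" for n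
    by (simp add: power_int_minus divide_inverse)
  have mono: "real CARD('p) powi i \<le> real CARD('p) powi i' \<longleftrightarrow> i \<le> i'" for i i'
    using power_int_strict_increasing[of i' i "real CARD('p)"]
      power_int_increasing[of i i' "real CARD('p)"] c by linarith
  have "k \<le> - int j"
    using assms(1) unfolding padic_ideal_def mem_Collect_eq * k mono .
  moreover have "\<not> k \<le> - int (Suc j)"
    using assms(2) unfolding padic_ideal_def mem_Collect_eq * k mono .
  ultimately have "k = - int j" by linarith
  then show ?thesis unfolding * k by simp
qed

lemma rat_padic_norm_of_int_le_iff:
  assumes "z \<noteq> 0"
  shows "rat_padic_norm CARD('p::prime_card) (of_int z) \<le> 1 / real CARD('p) ^ n \<longleftrightarrow> int CARD('p) ^ n dvd z"
proof -
  have c: "1 < real CARD('p)" by (rule card_gt_1)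
  have "rat_padic_norm CARD('p) (of_int z) = real CARD('p) powi - int (multiplicity (int CARD('p)) z)"
    using rat_padic_norm_Fract[OF prime_card assms, of 1, where ?'a1 = 'p] by simp
  also have "\<dots> \<le> 1 / real CARD('p) ^ n \<longleftrightarrow> n \<le> multiplicity (int CARD('p)) z"
    using c by (simp add: power_int_minus divide_inverse)
  also have "\<dots> \<longleftrightarrow> int CARD('p) ^ n dvd z"
    using assms prime_gt_1_nat[OF prime_card, where ?'a1 = 'p] by (subst power_dvd_iff_le_multiplicity) auto
  finally show ?thesis .
qed

lemma of_nat_diff_in_padic_ideal_iff:
  "(of_nat s - of_nat t :: 'p::prime_card padic) \<in> padic_ideal n \<longleftrightarrow> [s = t] (mod CARD('p) ^ n)"
proof -
  have "padic_norm (of_nat s - of_nat t :: 'p padic) = rat_padic_norm CARD('p) (of_int (int s - int t))"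
    by (simp flip: padic_of_rat_of_nat padic_norm_of_rat padic_of_rat_diff)
  moreover have "[s = t] (mod CARD('p) ^ n) \<longleftrightarrow> int CARD('p) ^ n dvd int s - int t"
    by (simp add: cong_iff_dvd_diff flip: cong_int_iff)
  ultimately show ?thesis
    using rat_padic_norm_of_int_le_iff[of "int s - int t" n, where 'p = 'p]
    by (cases "int s - int t = 0") (auto simp: padic_ideal_def)
qed

text \<open>
  The residue ring \<open>\<int>\<^sub>p / p\<^sup>n\<close> is represented by the numbers below \<open>p\<^sup>n\<close>: a nearby rational \<open>a / b\<close> is a
  \<open>p\<close>-adic integer, so \<open>p\<close> does not divide \<open>b\<close> and \<open>b\<close> can be inverted modulo \<open>p\<^sup>n\<close>.
\<close>

lemma padic_integers_residue:
  fixes x :: "'p::prime_card padic"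
  assumes "x \<in> padic_integers"
  obtains s where "s < CARD('p) ^ n" "x \<in> padic_ball (of_nat s) n"
proof -
  let ?p = "CARD('p)"
  have "0 < 1 / real ?p ^ n" using card_pos[where 'p = 'p] by simp
  then obtain q where q: "padic_norm (x - padic_of_rat q) < 1 / real ?p ^ n"
    using padic_rat_dense by blast
  then have xq: "x - padic_of_rat q \<in> padic_ideal n" by (simp add: padic_ideal_def)
  then have "x - (x - padic_of_rat q) \<in> padic_integers"
    using assms padic_ideal_subset_integers padic_integers_diff by blast
  then have qn: "rat_padic_norm ?p q \<le> 1"
    by (simp add: padic_integers_def padic_norm_of_rat)
  have "\<exists>s. rat_padic_norm ?p (q - of_nat s) \<le> 1 / real ?p ^ n"
  proof (cases "q = 0")
    case True
    then show ?thesis by (intro exI[of _ 0]) auto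
  next
    case False
    obtain a b where ab: "quotient_of q = (a, b)" by force
    have b: "b > 0" and cop: "coprime a b" and qab: "q = of_int a / of_int b"
      using ab quotient_of_denom_pos quotient_of_coprime quotient_of_div by auto
    have a: "a \<noteq> 0" using False qab by auto
    \<comment> \<open>Otherwise the norm of the fraction, which is in lowest terms, would exceed 1.\<close>
    have nb: "\<not> int ?p dvd b"
    proof
      assume pb: "int ?p dvd b"
      have pr: "prime (int ?p)" using prime_card[where 'a = 'p] by simp
      have "\<not> int ?p dvd a" using pb cop pr by (meson coprime_common_divisor not_prime_unit)
      then have "multiplicity (int ?p) a = 0" by (rule not_dvd_imp_multiplicity_0)
      moreover have "multiplicity (int ?p) b > 0"
        using pb b pr by (simp add: prime_multiplicity_gt_zero_iff)
      ultimately have "rat_padic_norm ?p q > 1"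
        using rat_padic_norm_Fract[OF prime_card a, of b, where ?'a1 = 'p] b card_gt_1[where 'p='p]
        by (simp add: qab one_less_power)
      then show False using qn by simp
    qed
    have pr: "prime (int ?p)" using prime_card[where 'a = 'p] by simp
    have "coprime b (int ?p ^ n)"
      using prime_imp_coprime[OF pr nb] by (simp add: coprime_commute)
    then obtain c where c: "[b * c = 1] (mod int ?p ^ n)" using cong_solve_coprime_int by blast
    define s where "s = nat ((a * c) mod int ?p ^ n)"
    have pn: "int ?p ^ n > 0" using prime_gt_0_nat[OF prime_card, where ?'a1 = 'p] by simp
    have s: "int s = (a * c) mod int ?p ^ n" using pn by (simp add: s_def)
    have "[a - int s * b = a - a * c * b] (mod int ?p ^ n)"
      unfolding s by (intro cong_diff cong_mult) auto
    also have "[a - a * c * b = a - a * 1] (mod int ?p ^ n)"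
      using c by (subst mult.assoc, intro cong_diff cong_mult) (auto simp: mult.commute)
    finally have dv: "int ?p ^ n dvd a - int s * b" by (simp add: cong_0_iff)
    have e: "q - of_nat s = of_int (a - int s * b) * inverse (of_int b)"
      using b by (simp add: qab field_simps)
    have "rat_padic_norm ?p (of_int b) = 1"
      using rat_padic_norm_Fract[OF prime_card, of b 1, where ?'a1 = 'p] b nb
      by (simp add: not_dvd_imp_multiplicity_0)
    then have "rat_padic_norm ?p (q - of_nat s) = rat_padic_norm ?p (of_int (a - int s * b))"
      unfolding e rat_padic_norm_mult[OF prime_card] rat_padic_norm_inverse[OF prime_card] by simp
    also have "\<dots> \<le> 1 / real ?p ^ n"
    proof (cases "a - int s * b = 0")
      case False
      then show ?thesis using rat_padic_norm_of_int_le_iff[of "a - int s * b" n, where 'p = 'p] dv by blast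
    next
      case True
      show ?thesis unfolding True by simp
    qed
    finally show ?thesis by blast
  qed
  then obtain s where "rat_padic_norm ?p (q - of_nat s) \<le> 1 / real ?p ^ n" by blast
  then have "padic_norm (padic_of_rat q - of_nat s :: 'p padic) \<le> 1 / real ?p ^ n"
    by (simp flip: padic_of_rat_of_nat padic_norm_of_rat padic_of_rat_diff)
  then have "padic_of_rat q - of_nat s \<in> (padic_ideal n :: 'p padic set)" by (simp add: padic_ideal_def)
  from padic_ideal_add[OF xq this] have "x - of_nat s \<in> padic_ideal n" by simp
  moreover have "of_nat s - of_nat (s mod ?p ^ n) \<in> (padic_ideal n :: 'p padic set)"
    unfolding of_nat_diff_in_padic_ideal_iff by (simp add: cong_def)
  ultimately have "x - of_nat s + (of_nat s - of_nat (s mod ?p ^ n)) \<in> padic_ideal n"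
    by (rule padic_ideal_add)
  then have "x - of_nat (s mod ?p ^ n) \<in> padic_ideal n" by simp
  then show ?thesis
    using that[of "s mod ?p ^ n"] card_pos[where 'p = 'p] by (simp add: padic_ball_def)
qed

section \<open>Topology of \<open>\<rat>\<^sub>p\<close>\<close>

lemma open_contains_padic_ball:
  fixes S :: "'p::prime_card padic set"
  assumes "open S" "x \<in> S"
  obtains n where "padic_ball x n \<subseteq> S"
proof -
  obtain e where e: "e > 0" "ball x e \<subseteq> S" using assms open_contains_ball by blast
  obtain n where n: "(1 / real CARD('p)) ^ n < e"
    using real_arch_pow_inv[OF e(1), of "1 / real CARD('p)"] card_gt_1[where 'p='p] by auto
  have "padic_ball x n \<subseteq> ball x e"
    using n by (auto simp: padic_ball_def padic_ideal_def dist_padic_def power_one_over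
        padic_norm_minus_commute[of x])
  with e that show ?thesis by blast
qed

lemma open_padic_ball: "open (padic_ball (a :: 'p::prime_card padic) n)"
  unfolding open_contains_ball
proof
  fix x assume "x \<in> padic_ball a n"
  then have eq: "padic_ball a n = padic_ball x n" by (simp add: padic_ball_eq)
  have "ball x (1 / real CARD('p) ^ n) \<subseteq> padic_ball a n"
    unfolding eq by (auto simp: padic_ball_def padic_ideal_def dist_padic_def
        padic_norm_minus_commute[of x])
  then show "\<exists>e>0. ball x e \<subseteq> padic_ball a n" using card_pos[where 'p='p] by (metis divide_pos_pos zero_less_one zero_less_power)
qed

lemma closed_padic_ball: "closed (padic_ball (a :: 'p::prime_card padic) n)"
proof -
  have "x \<notin> padic_ball a n" if "b \<notin> padic_ball a n" "x \<in> padic_ball b n" for b x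
    using that padic_ball_eq[of x a n] padic_ball_eq[of x b n] padic_ball_self[of b n] by blast
  then have eq: "- padic_ball a n = (\<Union>b\<in>- padic_ball a n. padic_ball b n)"
    using padic_ball_self by blast
  have "open (- padic_ball a n)"
    by (subst eq) (intro open_UN ballI open_padic_ball)
  then show ?thesis by (simp add: closed_def)
qed

lemma padic_integers_eq_ball: "padic_integers = padic_ball 0 0"
  by (simp add: padic_ball_def padic_ideal_0)

lemma padic_ideal_eq_ball: "padic_ideal n = padic_ball 0 n"
  by (simp add: padic_ball_def)

text \<open>
  Totally bounded because there are finitely many residues modulo \<open>p\<^sup>n\<close>.
\<close>

lemma compact_padic_integers: "compact (padic_integers :: 'p::prime_card padic set)"
  unfolding compact_eq_totally_bounded complete_eq_closed
proof safe
  show "closed (padic_integers :: 'p padic set)"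
    by (simp add: padic_integers_eq_ball closed_padic_ball)
  fix e :: real assume e: "e > 0"
  obtain n where n: "(1 / real CARD('p)) ^ n < e"
    using real_arch_pow_inv[OF e, of "1 / real CARD('p)"] card_gt_1[where 'p='p] by auto
  have "padic_integers \<subseteq> (\<Union>x\<in>of_nat ` {..<CARD('p) ^ n}. ball (x :: 'p padic) e)"
  proof
    fix x :: "'p padic" assume "x \<in> padic_integers"
    then obtain s where s: "s < CARD('p) ^ n" "x \<in> padic_ball (of_nat s) n" by (rule padic_integers_residue)
    then have "x \<in> ball (of_nat s) e"
      using n by (auto simp: padic_ball_def padic_ideal_def dist_padic_def power_one_over
          padic_norm_minus_commute[of _ x])
    with s show "x \<in> (\<Union>x\<in>of_nat ` {..<CARD('p) ^ n}. ball (x :: 'p padic) e)" by blast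
  qed
  then show "\<exists>k. finite k \<and> (padic_integers :: 'p padic set) \<subseteq> (\<Union>x\<in>k. ball x e)"
    by (intro exI[of _ "of_nat ` {..<CARD('p) ^ n}"]) auto
qed

text \<open>
  Makes the set of all balls countable.
\<close>

lemma padic_ball_rat_center:
  obtains q where "padic_ball (a :: 'p::prime_card padic) n = padic_ball (padic_of_rat q) n"
proof -
  have "0 < 1 / real CARD('p) ^ n" using card_pos[where 'p = 'p] by simp
  then obtain q where "padic_norm (a - padic_of_rat q) < 1 / real CARD('p) ^ n"
    using padic_rat_dense by blast
  then have "a \<in> padic_ball (padic_of_rat q) n" by (simp add: padic_ball_def padic_ideal_def)
  from padic_ball_eq[OF this] that show ?thesis by blast
qed

definition padic_balls :: "'p::prime_card padic set set" where
  "padic_balls = range (\<lambda>(a, n). padic_ball a n)"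

lemma countable_padic_balls: "countable (padic_balls :: 'p::prime_card padic set set)"
proof -
  have "(padic_balls :: 'p padic set set) \<subseteq> range (\<lambda>(q, n). padic_ball (padic_of_rat q) n)"
  proof
    fix B :: "'p padic set" assume "B \<in> padic_balls"
    then obtain a n where B: "B = padic_ball a n" by (auto simp: padic_balls_def)
    obtain q where "padic_ball a n = padic_ball (padic_of_rat q) n" by (rule padic_ball_rat_center)
    then show "B \<in> range (\<lambda>(q, n). padic_ball (padic_of_rat q) n)"
      unfolding B by (intro range_eqI[of _ _ "(q, n)"]) simp
  qed
  then show ?thesis by (rule countable_subset) auto
qed

lemma topological_basis_padic_balls: "topological_basis (padic_balls :: 'p::prime_card padic set set)"
proof (rule topological_basisI)
  fix S :: "'p padic set" and x assume "open S" "x \<in> S"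
  then obtain n where "padic_ball x n \<subseteq> S" by (rule open_contains_padic_ball)
  then show "\<exists>B'\<in>padic_balls. x \<in> B' \<and> B' \<subseteq> S"
    unfolding padic_balls_def by (intro bexI[of _ "padic_ball x n"]) auto
qed (auto simp: padic_balls_def open_padic_ball)

instance padic :: (prime_card) second_countable_topology
proof
  show "\<exists>B :: 'a padic set set. countable B \<and> open = generate_topology B"
    using countable_padic_balls topological_basis_imp_subbasis[OF topological_basis_padic_balls] by blast
qed

instance padic :: (prime_card) topological_comm_monoid_add
proof
  fix a b :: "'a padic"
  let ?F = "nhds a \<times>\<^sub>F nhds b"
  have "((\<lambda>x. dist (fst x) a + dist (snd x) b) \<longlongrightarrow> dist a a + dist b b) ?F"
    by (intro tendsto_intros filterlim_fst filterlim_snd)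
  then have lim: "((\<lambda>x. dist (fst x) a + dist (snd x) b) \<longlongrightarrow> 0) ?F" by simp
  have le: "dist (fst x + snd x) (a + b) \<le> dist (fst x) a + dist (snd x) b" for x
  proof -
    have "padic_norm ((fst x - a) + (snd x - b)) \<le> padic_norm (fst x - a) + padic_norm (snd x - b)"
      using padic_norm_add_le_max[of "fst x - a" "snd x - b"] padic_norm_nonneg[of "fst x - a"]
        padic_norm_nonneg[of "snd x - b"] by linarith
    then show ?thesis by (simp add: dist_padic_def algebra_simps)
  qed
  then have "((\<lambda>x. dist (fst x + snd x) (a + b)) \<longlongrightarrow> 0) ?F"
    using tendsto_sandwich[OF always_eventually always_eventually tendsto_const lim, of "\<lambda>x. dist (fst x + snd x) (a + b)"] le
    by simp
  then show "((\<lambda>x. fst x + snd x) \<longlongrightarrow> a + b) ?F" by (rule tendsto_dist_iff[THEN iffD2])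
qed

lemma continuous_on_padic_mult_right: "continuous_on A (\<lambda>x. x * c :: 'p::prime_card padic)"
proof -
  have "dist (x * c) (y * c) = padic_norm c * dist x y" for x y
    by (simp add: dist_padic_def padic_norm_mult flip: left_diff_distrib)
  then show ?thesis
    by (intro lipschitz_on_continuous_on[of "padic_norm c"] lipschitz_onI) auto
qed

lemma borel_measurable_padic_mult_const [measurable (raw)]:
  fixes f :: "'a \<Rightarrow> 'p::prime_card padic"
  assumes "f \<in> borel_measurable M"
  shows "(\<lambda>x. f x * c) \<in> borel_measurable M"
  using borel_measurable_continuous_on[OF continuous_on_padic_mult_right assms] .

lemma sets_padic_ball [measurable, simp]: "padic_ball a n \<in> sets borel"
  by (simp add: open_padic_ball)

lemma sets_padic_ideal [measurable, simp]: "padic_ideal n \<in> sets borel"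
  by (simp add: padic_ideal_eq_ball)

lemma sets_padic_integers [measurable, simp]: "padic_integers \<in> sets borel"
  by (simp add: padic_integers_eq_ball)

text \<open>
  Dynkin's lemma with balls as generators: together with the empty set they are closed under
  intersection because two balls are nested or disjoint.
\<close>

lemma padic_borel_induct [consumes 1, case_names ball empty compl union]:
  fixes A :: "'p::prime_card padic set"
  assumes A: "A \<in> sets borel"
    and ball: "\<And>a n. P (padic_ball a n)"
    and empty: "P {}"
    and compl: "\<And>A. A \<in> sets borel \<Longrightarrow> P A \<Longrightarrow> P (- A)"
    and union: "\<And>A. disjoint_family A \<Longrightarrow> range A \<subseteq> sets borel \<Longrightarrow> (\<And>i. P (A i)) \<Longrightarrow> P (\<Union>i::nat. A i)"
  shows "P A"
proof -
  let ?G = "insert {} (padic_balls :: 'p padic set set)"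
  have basis: "topological_basis ?G"
    using topological_basis_padic_balls by (metis Sup_insert insert_iff open_empty subset_insertI2 sup_bot_left topological_basis_def)
  have "borel = sigma UNIV ?G"
    using borel_eq_countable_basis[OF _ basis] countable_padic_balls by simp
  then have borel: "sets borel = sigma_sets UNIV ?G"
    using sets_measure_of[of ?G UNIV "\<lambda>_. 0"] by simp
  have stable: "Int_stable ?G"
  proof (rule Int_stableI)
    fix S T assume "S \<in> ?G" "T \<in> ?G"
    then consider "S = {} \<or> T = {}" | a m b n where "S = padic_ball a m" "T = padic_ball b n"
      unfolding padic_balls_def by auto
    then show "S \<inter> T \<in> ?G"
    proof cases
      case 2
      show ?thesis
      proof (cases "m \<le> n")
        case True
        then show ?thesis using padic_ball_Int[of m n a b] 2 by (auto simp: padic_balls_def)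
      next
        case False
        then show ?thesis using padic_ball_Int[of n m b a] 2 by (auto simp: padic_balls_def Int_commute)
      qed
    qed auto
  qed
  show ?thesis
  proof (rule sigma_sets_induct_disjoint[OF stable, of UNIV A P])
    show "A \<in> sigma_sets UNIV ?G" using A by (simp add: borel)
  next
    fix B assume "B \<in> ?G"
    then show "P B" using ball empty unfolding padic_balls_def by auto
  next
    fix B assume "B \<in> sigma_sets UNIV ?G" "P B"
    then show "P (UNIV - B)" using compl unfolding borel Compl_eq_Diff_UNIV by blast
  next
    fix B :: "nat \<Rightarrow> 'p padic set"
    assume "disjoint_family B" "range B \<subseteq> sigma_sets UNIV ?G" "\<And>i. P (B i)"
    then show "P (\<Union>i. B i)" using union unfolding borel by blast
  qed (use empty in auto)
qed

section \<open>Subdividing balls\<close>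

lemma padic_norm_card_power: "padic_norm (of_nat (CARD('p) ^ n) :: 'p::prime_card padic) = 1 / real CARD('p) ^ n"
proof (rule padic_norm_eq_power_if)
  show "of_nat (CARD('p) ^ n) \<in> (padic_ideal n :: 'p padic set)"
    using of_nat_diff_in_padic_ideal_iff[of "CARD('p) ^ n" 0 n, where 'p = 'p] by (simp add: cong_def)
  have "\<not> CARD('p) ^ Suc n dvd CARD('p) ^ n"
    using prime_gt_1_nat[OF prime_card, where ?'a1 = 'p] by (simp add: power_dvd_imp_le[of _ "Suc n" n] dvd_power_iff_le)
  then show "of_nat (CARD('p) ^ n) \<notin> (padic_ideal (Suc n) :: 'p padic set)"
    using of_nat_diff_in_padic_ideal_iff[of "CARD('p) ^ n" 0 "Suc n", where 'p = 'p]
    by (simp add: cong_def mod_eq_0_iff_dvd)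
qed

text \<open>
  For \<open>s < p\<^sup>k\<close> the balls of radius \<open>p\<^sup>-\<^sup>n\<^sup>-\<^sup>k\<close> with the centres \<open>a + p\<^sup>n s\<close> partition the ball of radius
  \<open>p\<^sup>-\<^sup>n\<close> around \<open>a\<close>.
\<close>

definition subball_center :: "'p::prime_card padic \<Rightarrow> nat \<Rightarrow> nat \<Rightarrow> 'p padic" where
  "subball_center a n s = a + of_nat (CARD('p) ^ n * s)"

lemma subball_center_in_ball: "subball_center a n s \<in> padic_ball a n"
proof -
  have "(of_nat (CARD('a) ^ n) :: 'a padic) \<in> padic_ideal n"
    using padic_norm_card_power[of n, where 'p = 'a] by (simp only: padic_ideal_def mem_Collect_eq order_refl)
  then have "(of_nat (CARD('a) ^ n) * of_nat s :: 'a padic) \<in> padic_ideal n"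
    by (rule padic_ideal_mult_right) simp
  then show ?thesis by (simp add: subball_center_def padic_ball_def)
qed

lemma subball_center_in_integers: "a \<in> padic_integers \<Longrightarrow> subball_center a n s \<in> padic_integers"
  using subball_center_in_ball[of a n s] padic_ball_subset_integers[of a n] by blast

lemma subball_subset: "padic_ball (subball_center a n s) (n + k) \<subseteq> padic_ball a n"
  using padic_ball_antimono[of n "n + k" "subball_center a n s"]
    padic_ball_eq[OF subball_center_in_ball, of a n s] by simp

text \<open>
  The points of the ball are \<open>a + p\<^sup>n y\<close> with \<open>y \<in> \<int>\<^sub>p\<close>, and \<open>s\<close> is the residue of \<open>y\<close> modulo \<open>p\<^sup>k\<close>.
\<close>

lemma ex1_subball:
  fixes x :: "'p::prime_card padic"
  assumes "x \<in> padic_ball a n"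
  shows "\<exists>!s. s < CARD('p) ^ k \<and> x \<in> padic_ball (subball_center a n s) (n + k)"
proof -
  let ?q = "of_nat (CARD('p) ^ n) :: 'p padic"
  have q: "padic_norm ?q = 1 / real CARD('p) ^ n" by (rule padic_norm_card_power)
  then have qn: "?q \<in> padic_ideal n" by (simp only: padic_ideal_def mem_Collect_eq order_refl)
  have q0: "?q \<noteq> 0"
  proof
    assume "?q = 0"
    then have "0 = 1 / real CARD('p) ^ n" using q by (simp only: padic_norm_0)
    then show False using card_pos[where 'p = 'p] by simp
  qed
  define y where "y = (x - a) / ?q"
  have "y \<in> padic_integers"
    using assms card_pos[where 'p = 'p] unfolding y_def padic_integers_def mem_Collect_eq padic_norm_divide q
    by (simp add: padic_ball_def padic_ideal_def pos_le_divide_eq)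
  then obtain s where s: "s < CARD('p) ^ k" "y \<in> padic_ball (of_nat s) k" by (rule padic_integers_residue)
  have xe: "x - subball_center a n s = ?q * (y - of_nat s)"
  proof -
    have "?q * y = x - a" using q0 unfolding y_def by (metis nonzero_mult_div_cancel_left times_divide_eq_right)
    then show ?thesis unfolding subball_center_def of_nat_mult right_diff_distrib by simp
  qed
  have mem: "x \<in> padic_ball (subball_center a n s) (n + k)"
    using padic_ideal_mult[OF qn] s(2) unfolding padic_ball_def mem_Collect_eq xe by simp
  moreover have "t = s" if t: "t < CARD('p) ^ k" "x \<in> padic_ball (subball_center a n t) (n + k)" for t
  proof -
    have "(x - subball_center a n s) - (x - subball_center a n t) \<in> padic_ideal (n + k)"
      using mem t(2) unfolding padic_ball_def mem_Collect_eq by (rule padic_ideal_diff)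
    then have "(of_nat (CARD('p) ^ n * t) - of_nat (CARD('p) ^ n * s) :: 'p padic) \<in> padic_ideal (n + k)"
      by (simp add: subball_center_def)
    then have "[CARD('p) ^ n * t = CARD('p) ^ n * s] (mod CARD('p) ^ n * CARD('p) ^ k)"
      unfolding of_nat_diff_in_padic_ideal_iff by (simp add: power_add)
    then have "[t = s] (mod CARD('p) ^ k)"
      using prime_gt_0_nat[OF prime_card, where ?'a1='p] by (simp add: cong_def flip: mult_mod_right)
    then show ?thesis using s t by (simp add: cong_def)
  qed
  ultimately show ?thesis using s(1) by blast
qed

lemma padic_ball_eq_UN_subballs:
  "padic_ball a n = (\<Union>s<CARD('p) ^ k. padic_ball (subball_center a n s) (n + k))"
  for a :: "'p::prime_card padic"
proof
  show "padic_ball a n \<subseteq> (\<Union>s<CARD('p) ^ k. padic_ball (subball_center a n s) (n + k))"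
    using ex1_subball[of _ a n k] by blast
qed (intro UN_least subball_subset)

lemma disjoint_subballs:
  "disjoint_family_on (\<lambda>s. padic_ball (subball_center a n s) (n + k)) {..<CARD('p) ^ k}"
  for a :: "'p::prime_card padic"
  unfolding disjoint_family_on_def
proof (intro ballI impI)
  fix s t assume st: "s \<in> {..<CARD('p) ^ k}" "t \<in> {..<CARD('p) ^ k}" "s \<noteq> t"
  have False if "x \<in> padic_ball (subball_center a n s) (n + k)" "x \<in> padic_ball (subball_center a n t) (n + k)" for x
  proof -
    have "x \<in> padic_ball a n" using that(1) subball_subset by blast
    from ex1_subball[OF this, of k] st that show False by blast
  qed
  then show "padic_ball (subball_center a n s) (n + k) \<inter> padic_ball (subball_center a n t) (n + k) = {}"
    by blast
qed

text \<open>
  Sufficiently small balls separate the points of a finite set. This expresses the number of zeros as a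
  limit of sums of indicators of events, and so makes it measurable.
\<close>

lemma eventually_card_subballs_meeting:
  fixes Z :: "'p::prime_card padic set"
  assumes fin: "finite Z" and Z: "Z \<subseteq> padic_ball a n"
  shows "\<forall>\<^sub>F m in sequentially.
    card {s \<in> {..<CARD('p) ^ m}. Z \<inter> padic_ball (subball_center a n s) (n + m) \<noteq> {}} = card Z"
proof -
  have "\<forall>\<^sub>F m in sequentially. x \<noteq> y \<longrightarrow> x - y \<notin> padic_ideal m" for x y :: "'p padic"
  proof (cases "x = y")
    case False
    then obtain n where "x - y \<notin> padic_ideal n" using padic_ideal_eq_0_iff[of "x - y"] by auto
    then have "x - y \<notin> padic_ideal m" if "m \<ge> n" for m using padic_ideal_antimono[OF that] by blast
    then show ?thesis by (auto simp: eventually_sequentially)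
  qed auto
  then have "\<forall>\<^sub>F m in sequentially. \<forall>x\<in>Z. \<forall>y\<in>Z. x \<noteq> y \<longrightarrow> x - y \<notin> padic_ideal m"
    using fin by (simp add: eventually_ball_finite)
  then show ?thesis
  proof (rule eventually_mono)
    fix m assume sep: "\<forall>x\<in>Z. \<forall>y\<in>Z. x \<noteq> y \<longrightarrow> x - y \<notin> padic_ideal m"
    let ?B = "\<lambda>s. padic_ball (subball_center a n s) (n + m)"
    let ?S = "{s \<in> {..<CARD('p) ^ m}. Z \<inter> ?B s \<noteq> {}}"
    define \<sigma> where "\<sigma> x = (THE s. s < CARD('p) ^ m \<and> x \<in> ?B s)" for x
    have \<sigma>: "\<sigma> x < CARD('p) ^ m \<and> x \<in> ?B (\<sigma> x)" if "x \<in> Z" for x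
      unfolding \<sigma>_def using theI'[OF ex1_subball, of x a n m] that Z by blast
    have \<sigma>_eq: "\<sigma> x = s" if "x \<in> Z" "s < CARD('p) ^ m" "x \<in> ?B s" for x s
      using ex1_subball[of x a n m] that Z \<sigma>[OF that(1)] by blast
    have "inj_on \<sigma> Z"
    proof (rule inj_onI, rule ccontr)
      fix x y assume xy: "x \<in> Z" "y \<in> Z" "\<sigma> x = \<sigma> y" "x \<noteq> y"
      then have "x \<in> ?B (\<sigma> x)" "y \<in> ?B (\<sigma> x)" using \<sigma>[of x] \<sigma>[of y] by auto
      then have "(x - subball_center a n (\<sigma> x)) - (y - subball_center a n (\<sigma> x)) \<in> padic_ideal (n + m)"
        unfolding padic_ball_def mem_Collect_eq by (rule padic_ideal_diff)
      then have "x - y \<in> padic_ideal m" using padic_ideal_antimono[of m "n + m"] by auto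
      then show False using sep xy by blast
    qed
    moreover have "\<sigma> ` Z = ?S"
    proof
      show "\<sigma> ` Z \<subseteq> ?S" using \<sigma> by blast
      show "?S \<subseteq> \<sigma> ` Z"
      proof
        fix s assume "s \<in> ?S"
        then obtain x where "x \<in> Z" "x \<in> ?B s" "s < CARD('p) ^ m" by blast
        then show "s \<in> \<sigma> ` Z" using \<sigma>_eq by blast
      qed
    qed
    ultimately show "card ?S = card Z" using card_image[of \<sigma> Z] by simp
  qed
qed

section \<open>Zeros of a polynomial in a ball\<close>

definition coeff_eval :: "nat \<Rightarrow> (nat \<Rightarrow> 'a::comm_ring_1) \<Rightarrow> 'a \<Rightarrow> 'a" where
  "coeff_eval d c x = (\<Sum>k\<le>d. c k * x ^ k)"

definition coeff_deriv :: "nat \<Rightarrow> (nat \<Rightarrow> 'a::comm_ring_1) \<Rightarrow> 'a \<Rightarrow> 'a" where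
  "coeff_deriv d c x = (\<Sum>k\<le>d. c k * (of_nat k * x ^ (k - 1)))"

lemma power_congruent:
  fixes x :: "'p::prime_card padic"
  assumes b: "b \<in> padic_integers" and x: "x \<in> padic_ball b n"
  shows "x ^ k - b ^ k \<in> padic_ideal n"
proof (induction k)
  case (Suc k)
  have xi: "x \<in> padic_integers" using padic_ball_subset_integers[OF b] x by blast
  have "x ^ Suc k - b ^ Suc k = x * (x ^ k - b ^ k) + (x - b) * b ^ k" by (simp add: algebra_simps)
  moreover have "x * (x ^ k - b ^ k) \<in> padic_ideal n"
    using xi Suc by (rule padic_ideal_mult_left)
  moreover have "(x - b) * b ^ k \<in> padic_ideal n"
    using x padic_integers_power[OF b] by (auto simp: padic_ball_def intro: padic_ideal_mult_right)
  ultimately show ?case using padic_ideal_add by simp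
qed simp

text \<open>
  Expansion of \<open>x\<^sup>k - y\<^sup>k = (x - y) (x\<^sup>k\<^sup>-\<^sup>1 + \<dots> + y\<^sup>k\<^sup>-\<^sup>1)\<close>: on the ball each of the \<open>k\<close> summands of the second
  factor is congruent to \<open>b\<^sup>k\<^sup>-\<^sup>1\<close> modulo \<open>p\<^sup>n\<close>. That the base point \<open>b\<close> need not be one of
  \<open>x\<close> and \<open>y\<close> is what makes Newton's map a contraction below.
\<close>

lemma power_diff_expand:
  fixes x :: "'p::prime_card padic"
  assumes b: "b \<in> padic_integers" and x: "x \<in> padic_ball b n" and y: "y \<in> padic_ball b n"
  shows "\<exists>e\<in>padic_ideal n. x ^ k - y ^ k = (x - y) * (of_nat k * b ^ (k - 1) + e)"
proof (induction k)
  case (Suc k)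
  then obtain e where e: "e \<in> padic_ideal n" "x ^ k - y ^ k = (x - y) * (of_nat k * b ^ (k - 1) + e)"
    by blast
  have xi: "x \<in> padic_integers" using padic_ball_subset_integers[OF b] x by blast
  define e' where "e' = of_nat k * b ^ (k - 1) * (x - b) + (x * e + (y ^ k - b ^ k))"
  have e': "e' \<in> padic_ideal n"
    unfolding e'_def using x e xi power_congruent[OF b y, of k] b
    by (intro padic_ideal_add padic_ideal_mult_left padic_integers_mult padic_integers_power)
       (auto simp: padic_ball_def)
  have kb: "of_nat k * (b ^ (k - 1) * b) = of_nat k * b ^ k"
    by (cases k) (auto simp: mult_ac)
  have "e' = x * (of_nat k * b ^ (k - 1)) - of_nat k * (b ^ (k - 1) * b) + (x * e + (y ^ k - b ^ k))"
    unfolding e'_def by (simp only: algebra_simps)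
  then have eq: "of_nat (Suc k) * b ^ k + e' = x * (of_nat k * b ^ (k - 1) + e) + y ^ k"
    unfolding kb by (simp add: algebra_simps)
  have "x ^ Suc k - y ^ Suc k = x * (x ^ k - y ^ k) + (x - y) * y ^ k" by (simp add: algebra_simps)
  also have "\<dots> = (x - y) * (x * (of_nat k * b ^ (k - 1) + e) + y ^ k)"
    unfolding e(2) by (simp only: distrib_left mult_ac)
  also have "\<dots> = (x - y) * (of_nat (Suc k) * b ^ (Suc k - 1) + e')"
    unfolding eq[symmetric] by simp
  finally show ?case using e' by blast
qed (auto intro: bexI[of _ 0])

lemma coeff_eval_diff_expand:
  fixes c :: "nat \<Rightarrow> 'p::prime_card padic"
  assumes c: "\<forall>k\<le>d. c k \<in> padic_integers"
    and b: "b \<in> padic_integers" and x: "x \<in> padic_ball b n" and y: "y \<in> padic_ball b n"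
  obtains e where "e \<in> padic_ideal n"
    "coeff_eval d c x - coeff_eval d c y = (x - y) * (coeff_deriv d c b + e)"
proof -
  obtain e where e: "\<And>k. e k \<in> padic_ideal n"
      "\<And>k. x ^ k - y ^ k = (x - y) * (of_nat k * b ^ (k - 1) + e k)"
    using power_diff_expand[OF b x y] by metis
  have "coeff_eval d c x - coeff_eval d c y = (\<Sum>k\<le>d. c k * (x ^ k - y ^ k))"
    by (simp add: coeff_eval_def right_diff_distrib sum_subtractf)
  also have "\<dots> = (x - y) * (coeff_deriv d c b + (\<Sum>k\<le>d. c k * e k))"
    unfolding e(2) coeff_deriv_def sum.distrib[symmetric] sum_distrib_left
    by (intro sum.cong refl) (simp add: algebra_simps)
  finally show ?thesis
    using that[of "\<Sum>k\<le>d. c k * e k"] e(1) c by (auto intro!: padic_ideal_sum padic_ideal_mult_left)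
qed

lemma coeff_deriv_in_integers:
  fixes c :: "nat \<Rightarrow> 'p::prime_card padic"
  assumes "\<forall>k\<le>d. c k \<in> padic_integers" "b \<in> padic_integers"
  shows "coeff_deriv d c b \<in> padic_integers"
  unfolding coeff_deriv_def using assms
  by (intro padic_integers_sum padic_integers_mult padic_integers_power) auto

lemma coeff_eval_congruent:
  fixes c :: "nat \<Rightarrow> 'p::prime_card padic"
  assumes c: "\<forall>k\<le>d. c k \<in> padic_integers" and b: "b \<in> padic_integers" and x: "x \<in> padic_ball b n"
  shows "coeff_eval d c x - coeff_eval d c b \<in> padic_ideal n"
proof -
  obtain e where e: "e \<in> padic_ideal n"
    "coeff_eval d c x - coeff_eval d c b = (x - b) * (coeff_deriv d c b + e)"
    using coeff_eval_diff_expand[OF c b x] padic_ball_self by blast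
  have "e \<in> padic_integers" using e(1) padic_ideal_subset_integers by blast
  then show ?thesis
    unfolding e(2) using x coeff_deriv_in_integers[OF c b]
    by (auto simp: padic_ball_def intro!: padic_ideal_mult_right padic_integers_add)
qed

text \<open>
  If \<open>|g'(b)| > p\<^sup>-\<^sup>n\<close> then \<open>g'(b) + e\<close> with \<open>|e| \<le> p\<^sup>-\<^sup>n\<close> does not vanish, so \<open>g\<close> is injective on the ball.
\<close>

lemma hensel_unique:
  fixes c :: "nat \<Rightarrow> 'p::prime_card padic"
  assumes c: "\<forall>k\<le>d. c k \<in> padic_integers" and b: "b \<in> padic_integers"
    and deriv: "coeff_deriv d c b \<notin> padic_ideal n"
    and x: "x \<in> padic_ball b n" "coeff_eval d c x = 0" and y: "y \<in> padic_ball b n" "coeff_eval d c y = 0"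
  shows "x = y"
proof -
  obtain e where e: "e \<in> padic_ideal n"
    "coeff_eval d c x - coeff_eval d c y = (x - y) * (coeff_deriv d c b + e)"
    using coeff_eval_diff_expand[OF c b x(1) y(1)] by blast
  have "coeff_deriv d c b + e \<noteq> 0"
    using deriv padic_ideal_minus[of e n] e(1) by (auto simp: add_eq_0_iff2)
  then show ?thesis using e(2) x y by simp
qed

text \<open>
  The hypotheses say \<open>|g'(b)| = p\<^sup>-\<^sup>j > p\<^sup>-\<^sup>n\<close>. On the ball \<open>g\<close> multiplies distances by \<open>|g'(b)|\<close>, which gives the
  condition on \<open>g(b)\<close>. Conversely the simplified Newton map \<open>x - g(x) / g'(b)\<close> contracts by the factor
  \<open>p\<^sup>j\<^sup>-\<^sup>n\<close> and, under that condition, maps the ball to itself; its fixed point is a zero.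
\<close>

lemma hensel_exists_iff:
  fixes c :: "nat \<Rightarrow> 'p::prime_card padic"
  assumes c: "\<forall>k\<le>d. c k \<in> padic_integers" and b: "b \<in> padic_integers"
    and j: "j < n" "coeff_deriv d c b \<in> padic_ideal j" "coeff_deriv d c b \<notin> padic_ideal (Suc j)"
  shows "(\<exists>x\<in>padic_ball b n. coeff_eval d c x = 0) \<longleftrightarrow> coeff_eval d c b \<in> padic_ideal (n + j)"
proof
  let ?f = "coeff_eval d c" and ?s = "coeff_deriv d c b"
  assume "\<exists>x\<in>padic_ball b n. ?f x = 0"
  then obtain x where x: "x \<in> padic_ball b n" "?f x = 0" by blast
  obtain e where e: "e \<in> padic_ideal n" "?f b - ?f x = (b - x) * (?s + e)"
    using coeff_eval_diff_expand[OF c b padic_ball_self x(1)] by blast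
  have "e \<in> padic_ideal j" using e(1) padic_ideal_antimono[of j n] j(1) by auto
  then have "(b - x) * (?s + e) \<in> padic_ideal (n + j)"
    using x(1) j(2) by (intro padic_ideal_mult padic_ideal_add)
      (auto simp: padic_ball_def padic_ideal_minus_commute[of b x])
  then show "?f b \<in> padic_ideal (n + j)" using e(2) x(2) by simp
next
  let ?f = "coeff_eval d c" and ?s = "coeff_deriv d c b" and ?B = "padic_ball b n"
  assume fb: "?f b \<in> padic_ideal (n + j)"
  have p: "0 < real CARD('p)" "1 < real CARD('p)" by (rule card_pos card_gt_1)+
  have s: "padic_norm ?s = 1 / real CARD('p) ^ j" using j(2,3) by (rule padic_norm_eq_power_if)
  then have s0: "?s \<noteq> 0" using p by auto
  define T where "T x = x - ?f x / ?s" for x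
  define L where "L = real CARD('p) ^ j / real CARD('p) ^ n"
  have L: "0 \<le> L" "L < 1"
    using p j(1) by (auto simp: L_def power_strict_increasing)
  have lip: "padic_norm (T x - T y) \<le> L * padic_norm (x - y)" if xy: "x \<in> ?B" "y \<in> ?B" for x y
  proof -
    obtain e where e: "e \<in> padic_ideal n" "?f x - ?f y = (x - y) * (?s + e)"
      using coeff_eval_diff_expand[OF c b xy] by blast
    have "T x - T y = (x - y) - (?f x - ?f y) / ?s" by (simp add: T_def diff_divide_distrib)
    also have "\<dots> = - ((x - y) * e / ?s)" unfolding e(2) using s0 by (simp add: field_simps)
    finally have "padic_norm (T x - T y) = padic_norm (x - y) * padic_norm e * real CARD('p) ^ j"
      by (simp add: padic_norm_mult padic_norm_divide s)
    also have "\<dots> \<le> padic_norm (x - y) * (1 / real CARD('p) ^ n) * real CARD('p) ^ j"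
      using e(1) by (intro mult_right_mono mult_left_mono) (auto simp: padic_ideal_def)
    finally show ?thesis by (simp add: L_def mult_ac)
  qed
  have Tb: "T b - b \<in> padic_ideal n"
    using fb p unfolding T_def padic_ideal_def
    by (simp add: padic_norm_divide s power_add field_simps)
  have maps: "T x \<in> ?B" if x: "x \<in> ?B" for x
  proof -
    have "padic_norm (T x - T b) \<le> L * padic_norm (x - b)" using lip[OF x padic_ball_self] .
    also have "\<dots> \<le> 1 * padic_norm (x - b)" using L by (intro mult_right_mono) auto
    finally have "T x - T b \<in> padic_ideal n" using x by (auto simp: padic_ball_def padic_ideal_def)
    from padic_ideal_add[OF this Tb] show ?thesis by (simp add: padic_ball_def)
  qed
  have "\<exists>!x\<in>?B. T x = x"
  proof (rule Banach_fix[OF _ _ L])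
    show "uniform_space_class.complete ?B" by (simp add: complete_eq_closed closed_padic_ball)
    show "?B \<noteq> {}" using padic_ball_self by blast
  qed (use maps lip in \<open>auto simp: dist_padic_def\<close>)
  then obtain x where "x \<in> ?B" "T x = x" by blast
  then show "\<exists>x\<in>?B. ?f x = 0" using s0 by (intro bexI[of _ x]) (auto simp: T_def)
qed

text \<open>
  Where the derivative is too small for Hensel's lemma, a zero at least makes \<open>g(b)\<close> very small, since
  both factors of \<open>g(b) - g(x) = (b - x) (g'(b) + e)\<close> are divisible by \<open>p\<^sup>n\<close>. That both \<open>g(b)\<close> and \<open>g'(b)\<close>
  are small is so improbable that such zeros are negligible on average.
\<close>

lemma singular_zero:
  fixes c :: "nat \<Rightarrow> 'p::prime_card padic"
  assumes c: "\<forall>k\<le>d. c k \<in> padic_integers" and b: "b \<in> padic_integers"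
    and deriv: "coeff_deriv d c b \<in> padic_ideal n"
    and x: "x \<in> padic_ball b n" "coeff_eval d c x = 0"
  shows "coeff_eval d c b \<in> padic_ideal (n + n)"
proof -
  obtain e where e: "e \<in> padic_ideal n"
      "coeff_eval d c b - coeff_eval d c x = (b - x) * (coeff_deriv d c b + e)"
    using coeff_eval_diff_expand[OF c b padic_ball_self x(1)] by blast
  have "(b - x) * (coeff_deriv d c b + e) \<in> padic_ideal (n + n)"
    using x(1) deriv e(1) by (intro padic_ideal_mult padic_ideal_add)
      (auto simp: padic_ball_def padic_ideal_minus_commute[of b x])
  then show ?thesis using e(2) x(2) by simp
qed

text \<open>
  Approximate zeros accumulate at a zero because the ball is compact. The right-hand side involves only
  countably many evaluation points, so it defines an event when the coefficients are random.
\<close>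

lemma ex_zero_iff_approximate_zeros:
  fixes c :: "nat \<Rightarrow> 'p::prime_card padic"
  assumes c: "\<forall>k\<le>d. c k \<in> padic_integers" and b: "b \<in> padic_integers"
  shows "(\<exists>x\<in>padic_ball b n. coeff_eval d c x = 0) \<longleftrightarrow>
    (\<forall>m. \<exists>s::nat. of_nat s \<in> padic_ball b n \<and> coeff_eval d c (of_nat s) \<in> padic_ideal m)"
proof safe
  fix x m assume x: "x \<in> padic_ball b n" "coeff_eval d c x = 0"
  then have xi: "x \<in> padic_integers" using padic_ball_subset_integers[OF b] by blast
  then obtain s where s: "x \<in> padic_ball (of_nat s) (n + m)" by (rule padic_integers_residue)
  then have s': "of_nat s \<in> padic_ball x (n + m)"
    by (simp add: padic_ball_def padic_ideal_minus_commute)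
  have "of_nat s \<in> padic_ball b n"
    using padic_ball_antimono[of n "n + m" x] s' padic_ball_eq[OF x(1)] by auto
  moreover have "coeff_eval d c (of_nat s) - coeff_eval d c x \<in> padic_ideal m"
    using padic_ball_antimono[of m "n + m" x] s' by (intro coeff_eval_congruent[OF c xi]) auto
  ultimately show "\<exists>s::nat. of_nat s \<in> padic_ball b n \<and> coeff_eval d c (of_nat s) \<in> padic_ideal m"
    using x(2) by auto
next
  let ?f = "coeff_eval d c"
  assume "\<forall>m. \<exists>s::nat. of_nat s \<in> padic_ball b n \<and> ?f (of_nat s) \<in> padic_ideal m"
  then have "\<forall>m. \<exists>y. y \<in> padic_ball b n \<and> ?f y \<in> padic_ideal m" by blast
  then obtain y where y: "\<And>m. y m \<in> padic_ball b n" "\<And>m. ?f (y m) \<in> padic_ideal m" by metis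
  have "compact (padic_ball b n)"
    using closed_Int_compact[OF closed_padic_ball compact_padic_integers, of b n]
      padic_ball_subset_integers[OF b] by (simp add: Int_absorb2)
  then obtain x r where x: "x \<in> padic_ball b n" "strict_mono r" "(y \<circ> r) \<longlonglongrightarrow> x"
    using y(1) unfolding compact_def by metis
  have xi: "x \<in> padic_integers" using padic_ball_subset_integers[OF b] x(1) by blast
  have "?f x \<in> padic_ideal m" for m
  proof -
    have "\<forall>\<^sub>F i in sequentially. (y \<circ> r) i \<in> padic_ball x m"
      using x(3) open_padic_ball padic_ball_self by (rule topological_tendstoD)
    then obtain N where N: "\<And>i. i \<ge> N \<Longrightarrow> y (r i) \<in> padic_ball x m"
      by (auto simp: eventually_sequentially)
    define i where "i = max N m"
    have "m \<le> r i" using seq_suble[OF x(2), of i] by (simp add: i_def)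
    then have "?f (y (r i)) \<in> padic_ideal m" using y(2)[of "r i"] padic_ideal_antimono by blast
    moreover have "?f (y (r i)) - ?f x \<in> padic_ideal m"
      using N[of i] by (intro coeff_eval_congruent[OF c xi]) (auto simp: i_def)
    ultimately show ?thesis using padic_ideal_diff by fastforce
  qed
  then have "?f x = 0" using padic_ideal_eq_0_iff by blast
  with x(1) show "\<exists>x\<in>padic_ball b n. ?f x = 0" by blast
qed

lemma card_zeros_le:
  fixes c :: "nat \<Rightarrow> 'a::field"
  assumes "k \<le> d" "c k \<noteq> 0"
  shows "finite {x. coeff_eval d c x = 0} \<and> card {x. coeff_eval d c x = 0} \<le> d"
proof -
  define P where "P = (\<Sum>k\<le>d. Polynomial.monom (c k) k)"
  have "Polynomial.coeff P k = c k" unfolding P_def using assms(1) by (simp add: coeff_sum)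
  then have "P \<noteq> 0" using assms(2) by auto
  moreover have "degree P \<le> d" unfolding P_def
    by (intro degree_sum_le) (auto intro: order_trans[OF degree_monom_le])
  moreover have "{x. coeff_eval d c x = 0} = {x. poly P x = 0}"
    by (simp add: P_def coeff_eval_def poly_sum poly_monom)
  ultimately show ?thesis
    using card_poly_roots_bound[of P] poly_roots_finite[of P] by auto
qed

section \<open>Counting elements\<close>

lemma num_elements_finite: "finite A \<Longrightarrow> num_elements A = of_nat (card A)"
  by (simp add: num_elements_def emeasure_count_space)

lemma num_elements_UN_disjoint:
  assumes "disjoint_family A"
  shows "num_elements (\<Union>i::nat. A i) = (\<Sum>i. num_elements (A i))"
  unfolding num_elements_def using assms by (intro suminf_emeasure[symmetric]) auto

lemma num_elements_UN_finite:
  assumes "finite I" "disjoint_family_on A I"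
  shows "num_elements (\<Union>i\<in>I. A i) = (\<Sum>i\<in>I. num_elements (A i))"
  unfolding num_elements_def using assms by (intro sum_emeasure[symmetric]) auto

lemma num_elements_Un:
  assumes "A \<inter> B = {}"
  shows "num_elements (A \<union> B) = num_elements A + num_elements B"
  unfolding num_elements_def using assms by (intro plus_emeasure[symmetric]) auto

lemma num_elements_image: "inj_on f A \<Longrightarrow> num_elements (f ` A) = num_elements A"
  by (simp add: num_elements_def emeasure_count_space card_image finite_image_iff)

section \<open>Uniformly distributed coefficients\<close>

lemma padic_integers_eq_UN_balls:
  "(padic_integers :: 'p::prime_card padic set) = (\<Union>s<CARD('p) ^ n. padic_ball (of_nat s) n)"
  using padic_ball_eq_UN_subballs[of "0 :: 'p padic" 0 n]
  by (simp add: padic_integers_eq_ball subball_center_def)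

lemma disjoint_residue_balls:
  "disjoint_family_on (\<lambda>s. padic_ball (of_nat s :: 'p::prime_card padic) n) {..<CARD('p) ^ n}"
  using disjoint_subballs[of "0 :: 'p padic" 0 n] by (simp add: subball_center_def)

lemma residue_balls_disjoint:
  assumes "s < CARD('p) ^ n" "t < CARD('p) ^ n" "s \<noteq> t"
  shows "padic_ball (of_nat s :: 'p::prime_card padic) n \<inter> padic_ball (of_nat t) n = {}"
  using disjoint_residue_balls[of n, where 'p = 'p] assms unfolding disjoint_family_on_def by simp

text \<open>
  \<open>\<int>\<^sub>p\<close> is the disjoint union of \<open>p\<^sup>n\<close> translates of \<open>p\<^sup>n\<int>\<^sub>p\<close>, which have equal measure.
\<close>

lemma emeasure_haar_padic_ball:
  fixes \<nu> :: "'p::prime_card padic measure"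
  assumes haar: "haar_measure_on padic_integers \<nu>" and total: "emeasure \<nu> padic_integers = 1"
    and a: "a \<in> padic_integers"
  shows "emeasure \<nu> (padic_ball a n) = ennreal (1 / real CARD('p) ^ n)"
proof -
  have sets: "padic_ball b n \<in> sets \<nu>" if "b \<in> padic_integers" for b
  proof -
    have "padic_ball b n = padic_integers \<inter> padic_ball b n"
      using padic_ball_subset_integers[OF that] by blast
    then show ?thesis
      using haar sets_padic_ball[of b n] unfolding haar_measure_on_def by (auto simp: sets_restrict_space)
  qed
  have inv: "emeasure \<nu> (padic_ball b n) = emeasure \<nu> (padic_ball 0 n)" if "b \<in> padic_integers" for b
  proof -
    have "\<forall>g\<in>padic_integers. \<forall>A\<in>sets \<nu>. emeasure \<nu> ((+) g ` A) = emeasure \<nu> A"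
      using haar unfolding haar_measure_on_def by blast
    then have "emeasure \<nu> ((+) b ` padic_ball 0 n) = emeasure \<nu> (padic_ball 0 n)"
      using that sets[of 0] by (simp add: padic_integers_def)
    then show ?thesis by (simp add: padic_ball_translate)
  qed
  have "1 = (\<Sum>s<CARD('p) ^ n. emeasure \<nu> (padic_ball (of_nat s) n))"
    unfolding total[symmetric]
    unfolding padic_integers_eq_UN_balls[of n]
    using sum_emeasure[OF _ disjoint_residue_balls, of n \<nu>] sets by (simp add: image_subset_iff)
  also have "\<dots> = (\<Sum>s<CARD('p) ^ n. emeasure \<nu> (padic_ball 0 n))"
    by (intro sum.cong refl inv of_nat_in_padic_integers)
  also have "\<dots> = ennreal (real CARD('p) ^ n) * emeasure \<nu> (padic_ball 0 n)"
    by (simp add: ennreal_of_nat_eq_real_of_nat)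
  finally have eq: "ennreal (real CARD('p) ^ n) * emeasure \<nu> (padic_ball 0 n) = 1" by simp
  have p: "0 < real CARD('p) ^ n" using card_pos[where 'p='p] by simp
  have "emeasure \<nu> (padic_ball 0 n) = ennreal (1 / real CARD('p) ^ n) * (ennreal (real CARD('p) ^ n) * emeasure \<nu> (padic_ball 0 n))"
    using p by (simp flip: mult.assoc ennreal_mult)
  also have "\<dots> = ennreal (1 / real CARD('p) ^ n)" unfolding eq by simp
  finally show ?thesis using inv[OF a] by simp
qed

lemma (in prob_space) emeasure_uniform_padic_ball:
  fixes X :: "'a \<Rightarrow> 'p::prime_card padic"
  assumes X: "uniformly_distributed_in M padic_integers X" and a: "a \<in> padic_integers"
  shows "emeasure (distr M (restrict_space borel padic_integers) X) (padic_ball a n) = ennreal (1 / real CARD('p) ^ n)"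
proof (rule emeasure_haar_padic_ball[OF _ _ a])
  have meas: "X \<in> measurable M (restrict_space borel padic_integers)"
    using X by (simp add: uniformly_distributed_in_def)
  interpret D: prob_space "distr M (restrict_space borel padic_integers) X"
    by (rule prob_space_distr[OF meas])
  show "emeasure (distr M (restrict_space borel padic_integers) X) padic_integers = 1"
    using D.emeasure_space_1 by simp
  show "haar_measure_on padic_integers (distr M (restrict_space borel padic_integers) X)"
    using X by (simp add: uniformly_distributed_in_def)
qed

lemma measurable_restrict_integers_borel [measurable (raw)]:
  fixes f :: "'a \<Rightarrow> 'p::prime_card padic"
  assumes "f \<in> measurable N (restrict_space borel padic_integers)"
  shows "f \<in> borel_measurable N"
  using measurable_compose[OF assms measurable_restrict_space1[OF measurable_ident]] by simp

text \<open>
  A uniform variable stays uniform after translation by an independent one, and remains independent of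
  it: conditionally on \<open>Y\<close> the event asks \<open>h(X)\<close> to lie in the ball around \<open>-g(Y)\<close>. Writing the
  uniform variable as \<open>h(X)\<close> allows \<open>X\<close> and \<open>Y\<close> to have values in one type, as independence of a pair
  requires.
\<close>

lemma (in prob_space) emeasure_uniform_shift:
  fixes h :: "'b \<Rightarrow> 'p::prime_card padic"
  assumes h[measurable]: "h \<in> measurable L (restrict_space borel padic_integers)"
    and X: "uniformly_distributed_in M padic_integers (\<lambda>\<omega>. h (X \<omega>))"
    and indep: "indep_var L X N Y"
    and g[measurable]: "g \<in> borel_measurable N" and gi: "\<And>y. y \<in> space N \<Longrightarrow> g y \<in> padic_integers"
    and E[measurable]: "E \<in> sets N"
  shows "emeasure M {\<omega> \<in> space M. Y \<omega> \<in> E \<and> h (X \<omega>) + g (Y \<omega>) \<in> padic_ideal n} =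
     ennreal (1 / real CARD('p) ^ n) * emeasure M {\<omega> \<in> space M. Y \<omega> \<in> E}"
proof -
  let ?O = "restrict_space borel padic_integers :: 'p padic measure"
  have mX[measurable]: "X \<in> measurable M L" and mY[measurable]: "Y \<in> measurable M N"
    using indep_var_rv1[OF indep] indep_var_rv2[OF indep] by auto
  interpret DX: prob_space "distr M L X" by (rule prob_space_distr) simp
  interpret DY: prob_space "distr M N Y" by (rule prob_space_distr) simp
  interpret P: pair_prob_space "distr M L X" "distr M N Y" ..
  have hb[measurable]: "h \<in> borel_measurable L" by (rule measurable_restrict_integers_borel[OF h])
  define Q where "Q = {z \<in> space (L \<Otimes>\<^sub>M N). snd z \<in> E \<and> h (fst z) + g (snd z) \<in> padic_ideal n}"
  have Q[measurable]: "Q \<in> sets (L \<Otimes>\<^sub>M N)" unfolding Q_def by measurable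
  have "emeasure (distr M (L \<Otimes>\<^sub>M N) (\<lambda>\<omega>. (X \<omega>, Y \<omega>))) Q
      = emeasure M ((\<lambda>\<omega>. (X \<omega>, Y \<omega>)) -` Q \<inter> space M)"
    by (rule emeasure_distr) simp_all
  also have "(\<lambda>\<omega>. (X \<omega>, Y \<omega>)) -` Q \<inter> space M =
      {\<omega> \<in> space M. Y \<omega> \<in> E \<and> h (X \<omega>) + g (Y \<omega>) \<in> padic_ideal n}"
    using measurable_space[OF mX] measurable_space[OF mY] by (auto simp: Q_def space_pair_measure)
  finally have "emeasure M {\<omega> \<in> space M. Y \<omega> \<in> E \<and> h (X \<omega>) + g (Y \<omega>) \<in> padic_ideal n}
      = emeasure (distr M (L \<Otimes>\<^sub>M N) (\<lambda>\<omega>. (X \<omega>, Y \<omega>))) Q" by (rule sym)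
  also have "distr M (L \<Otimes>\<^sub>M N) (\<lambda>\<omega>. (X \<omega>, Y \<omega>)) = distr M L X \<Otimes>\<^sub>M distr M N Y"
    using indep unfolding indep_var_distribution_eq by simp
  also have "emeasure \<dots> Q = (\<integral>\<^sup>+ y. emeasure (distr M L X) ((\<lambda>x. (x, y)) -` Q) \<partial>distr M N Y)"
    by (rule P.emeasure_pair_measure_alt2) simp
  also have "\<dots> = (\<integral>\<^sup>+ y. ennreal (1 / real CARD('p) ^ n) * indicator E y \<partial>distr M N Y)"
  proof (rule nn_integral_cong)
    fix y assume "y \<in> space (distr M N Y)"
    then have y: "y \<in> space N" by simp
    show "emeasure (distr M L X) ((\<lambda>x. (x, y)) -` Q) = ennreal (1 / real CARD('p) ^ n) * indicator E y"
    proof (cases "y \<in> E")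
      case True
      have mg: "- g y \<in> padic_integers" using gi[OF y] by (simp add: padic_integers_def)
      have "(\<lambda>x. (x, y)) -` Q = h -` padic_ball (- g y) n \<inter> space L"
        using True y by (auto simp: Q_def space_pair_measure padic_ball_def)
      then have "emeasure (distr M L X) ((\<lambda>x. (x, y)) -` Q) =
          emeasure M (X -` (h -` padic_ball (- g y) n \<inter> space L) \<inter> space M)"
        using measurable_sets[OF hb sets_padic_ball] by (simp add: emeasure_distr)
      also have "X -` (h -` padic_ball (- g y) n \<inter> space L) \<inter> space M
          = (\<lambda>\<omega>. h (X \<omega>)) -` padic_ball (- g y) n \<inter> space M"
        using measurable_space[OF mX] by auto
      also have "emeasure M \<dots> = emeasure (distr M ?O (\<lambda>\<omega>. h (X \<omega>))) (padic_ball (- g y) n)"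
      proof (rule emeasure_distr[symmetric])
        have "padic_ball (- g y) n = padic_integers \<inter> padic_ball (- g y) n"
          using padic_ball_subset_integers[OF mg] by blast
        then show "padic_ball (- g y) n \<in> sets ?O"
          using sets_padic_ball[of "- g y" n] by (auto simp: sets_restrict_space)
      qed simp
      finally show ?thesis using emeasure_uniform_padic_ball[OF X mg] True by simp
    next
      case False
      then have "(\<lambda>x. (x, y)) -` Q = {}" by (auto simp: Q_def)
      with False show ?thesis by simp
    qed
  qed
  also have "\<dots> = ennreal (1 / real CARD('p) ^ n) * emeasure (distr M N Y) E"
    by (rule nn_integral_cmult_indicator) simp
  also have "emeasure (distr M N Y) E = emeasure M (Y -` E \<inter> space M)"
    by (rule emeasure_distr) simp_all
  also have "Y -` E \<inter> space M = {\<omega> \<in> space M. Y \<omega> \<in> E}" by auto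
  finally show ?thesis .
qed

text \<open>
  Needed to reverse the order of the coefficients.
\<close>

lemma (in prob_space) indep_vars_reindex:
  assumes indep: "indep_vars (\<lambda>_. N) X I'" and f: "inj_on f I" "f ` I \<subseteq> I'"
  shows "indep_vars (\<lambda>_. N) (\<lambda>i. X (f i)) I"
proof -
  let ?F = "\<lambda>i. {X i -` A \<inter> space M |A. A \<in> sets N}"
  have ind: "indep_sets ?F I'" and rv: "\<And>i. i \<in> I' \<Longrightarrow> random_variable N (X i)"
    using indep unfolding indep_vars_def2 by auto
  have "indep_sets (\<lambda>i. ?F (f i)) I"
  proof (rule indep_setsI)
    fix i assume "i \<in> I"
    then show "?F (f i) \<subseteq> events" using ind f unfolding indep_sets_def by blast
  next
    fix A J assume J: "J \<noteq> {}" "J \<subseteq> I" "finite J" and A: "\<forall>j\<in>J. A j \<in> ?F (f j)"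
    have inj: "inj_on f J" using f(1) J(2) inj_on_subset by blast
    define B where "B k = A (the_inv_into J f k)" for k
    have B: "B (f j) = A j" if "j \<in> J" for j using that inj by (simp add: B_def the_inv_into_f_f)
    have "prob (\<Inter>k\<in>f ` J. B k) = (\<Prod>k\<in>f ` J. prob (B k))"
      using J f A B by (intro indep_setsD[OF ind]) auto
    moreover have "(\<Inter>k\<in>f ` J. B k) = (\<Inter>j\<in>J. A j)" using B by auto
    moreover have "(\<Prod>k\<in>f ` J. prob (B k)) = (\<Prod>j\<in>J. prob (A j))"
      using B by (simp add: prod.reindex[OF inj])
    ultimately show "prob (\<Inter>j\<in>J. A j) = (\<Prod>j\<in>J. prob (A j))" by simp
  qed
  then show ?thesis unfolding indep_vars_def2 using rv f by auto
qed

locale uniform_padic_coefficients = prob_space M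
  for M :: "'w measure" +
  fixes \<zeta> :: "nat \<Rightarrow> 'w \<Rightarrow> 'p::prime_card padic" and d :: nat
  assumes degree_pos: "1 \<le> d"
    and indep: "indep_vars (\<lambda>_. restrict_space borel padic_integers) \<zeta> {0..d}"
    and uniform: "\<And>k. k \<le> d \<Longrightarrow> uniformly_distributed_in M padic_integers (\<zeta> k)"
begin

abbreviation eval_at :: "'w \<Rightarrow> 'p padic \<Rightarrow> 'p padic" where
  "eval_at \<omega> \<equiv> coeff_eval d (\<lambda>k. \<zeta> k \<omega>)"

abbreviation deriv_at :: "'w \<Rightarrow> 'p padic \<Rightarrow> 'p padic" where
  "deriv_at \<omega> \<equiv> coeff_deriv d (\<lambda>k. \<zeta> k \<omega>)"

lemma coeff_measurable: "k \<le> d \<Longrightarrow> \<zeta> k \<in> measurable M (restrict_space borel padic_integers)"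
  using uniform[of k] by (simp add: uniformly_distributed_in_def)

lemma coeff_borel [measurable]: "k \<le> d \<Longrightarrow> \<zeta> k \<in> borel_measurable M"
  by (intro measurable_restrict_integers_borel coeff_measurable)

lemma coeff_integers: "\<omega> \<in> space M \<Longrightarrow> \<forall>k\<le>d. \<zeta> k \<omega> \<in> padic_integers"
  using measurable_space[OF coeff_measurable] by (auto simp: space_restrict_space)

lemma eval_borel [measurable]: "(\<lambda>\<omega>. eval_at \<omega> x) \<in> borel_measurable M"
  unfolding coeff_eval_def by (intro borel_measurable_sum borel_measurable_padic_mult_const coeff_borel) simp

lemma deriv_borel [measurable]: "(\<lambda>\<omega>. deriv_at \<omega> x) \<in> borel_measurable M"
  unfolding coeff_deriv_def by (intro borel_measurable_sum borel_measurable_padic_mult_const coeff_borel) simp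

lemma emeasure_coeff_shift:
  assumes k: "k \<le> d" "K \<subseteq> {0..d}" "k \<notin> K" and w: "\<And>i. w i \<in> padic_integers"
    and E[measurable]: "E \<in> sets (PiM K (\<lambda>_. restrict_space borel padic_integers))"
  shows "emeasure M {\<omega> \<in> space M. restrict (\<lambda>i. \<zeta> i \<omega>) K \<in> E \<and> \<zeta> k \<omega> + (\<Sum>i\<in>K. \<zeta> i \<omega> * w i) \<in> padic_ideal n}
     = ennreal (1 / real CARD('p) ^ n) * emeasure M {\<omega> \<in> space M. restrict (\<lambda>i. \<zeta> i \<omega>) K \<in> E}"
proof -
  let ?O = "restrict_space borel padic_integers :: 'p padic measure"
  define g where "g y = (\<Sum>i\<in>K. y i * w i)" for y :: "nat \<Rightarrow> 'p padic"
  have fin: "finite K" using k(2) finite_subset by auto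
  have ind: "indep_var (PiM {k} (\<lambda>_. ?O)) (\<lambda>\<omega>. restrict (\<lambda>i. \<zeta> i \<omega>) {k})
      (PiM K (\<lambda>_. ?O)) (\<lambda>\<omega>. restrict (\<lambda>i. \<zeta> i \<omega>) K)"
    using k by (intro indep_var_restrict[OF indep]) auto
  have h: "(\<lambda>f. f k) \<in> measurable (PiM {k} (\<lambda>_. ?O)) ?O"
    by (rule measurable_component_singleton) simp
  have unif: "uniformly_distributed_in M padic_integers (\<lambda>\<omega>. restrict (\<lambda>i. \<zeta> i \<omega>) {k} k)"
    using uniform[OF k(1)] by simp
  have "(\<lambda>y. y i) \<in> borel_measurable (PiM K (\<lambda>_. ?O))" if "i \<in> K" for i
    using that by (intro measurable_restrict_integers_borel measurable_component_singleton)
  then have g: "g \<in> borel_measurable (PiM K (\<lambda>_. ?O))"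
    unfolding g_def by (intro borel_measurable_sum borel_measurable_padic_mult_const)
  have gi: "g y \<in> padic_integers" if "y \<in> space (PiM K (\<lambda>_. ?O))" for y
    using that w unfolding g_def
    by (intro padic_integers_sum padic_integers_mult) (auto simp: space_PiM space_restrict_space)
  have "g (restrict (\<lambda>i. \<zeta> i \<omega>) K) = (\<Sum>i\<in>K. \<zeta> i \<omega> * w i)" for \<omega>
    unfolding g_def by (intro sum.cong) auto
  with emeasure_uniform_shift[OF h unif ind g gi E, of n] show ?thesis by simp
qed

text \<open>
  \<open>g(a)\<close> and \<open>g'(a)\<close> are independent and uniform: the coefficients \<open>\<zeta>\<^sub>0\<close> and \<open>\<zeta>\<^sub>1\<close> enter them triangularly with
  unit diagonal, so two translations as in \<open>emeasure_coeff_shift\<close> remove all other coefficients. The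
  hypothesis \<open>1 \<le> d\<close> of the locale provides \<open>\<zeta>\<^sub>1\<close>.
\<close>

lemma emeasure_eval_deriv:
  assumes a: "a \<in> padic_integers"
  shows "emeasure M {\<omega> \<in> space M. eval_at \<omega> a \<in> padic_ideal i \<and> deriv_at \<omega> a \<in> padic_ideal j}
    = ennreal (1 / real CARD('p) ^ (i + j))"
proof -
  let ?O = "restrict_space borel padic_integers :: 'p padic measure"
  define w where "w k = of_nat k * a ^ (k - 1)" for k
  have w: "w k \<in> padic_integers" for k
    unfolding w_def using a by (intro padic_integers_mult padic_integers_power) auto
  have ev: "eval_at \<omega> a = \<zeta> 0 \<omega> + (\<Sum>k\<in>{1..d}. \<zeta> k \<omega> * a ^ k)" for \<omega>
    unfolding coeff_eval_def by (simp add: sum.atMost_shift sum.atLeast1_atMost_eq del: One_nat_def) (simp add: sum.atLeast1_atMost_eq)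
  have dv1: "deriv_at \<omega> a = (\<Sum>k\<in>{1..d}. \<zeta> k \<omega> * w k)" for \<omega>
    unfolding coeff_deriv_def w_def by (simp add: sum.atMost_shift sum.atLeast1_atMost_eq)
  have "{1..d} = insert 1 {2..d}" using degree_pos by auto
  then have dv2: "deriv_at \<omega> a = \<zeta> 1 \<omega> + (\<Sum>k\<in>{2..d}. \<zeta> k \<omega> * w k)" for \<omega>
    unfolding dv1 by (simp add: w_def)
  define E where "E = {y \<in> space (PiM {1..d} (\<lambda>_. ?O)). (\<Sum>k\<in>{1..d}. y k * w k) \<in> padic_ideal j}"
  have "(\<lambda>y. y k) \<in> borel_measurable (PiM {1..d} (\<lambda>_. ?O))" if "k \<in> {1..d}" for k
    using that by (intro measurable_restrict_integers_borel measurable_component_singleton)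
  then have "(\<lambda>y. \<Sum>k\<in>{1..d}. y k * w k) \<in> borel_measurable (PiM {1..d} (\<lambda>_. ?O))"
    by (intro borel_measurable_sum borel_measurable_padic_mult_const)
  then have E: "E \<in> sets (PiM {1..d} (\<lambda>_. ?O))"
    unfolding E_def by measurable
  have E_iff: "restrict (\<lambda>k. \<zeta> k \<omega>) {1..d} \<in> E \<longleftrightarrow> deriv_at \<omega> a \<in> padic_ideal j" if "\<omega> \<in> space M" for \<omega>
  proof -
    have "(\<Sum>k\<in>{1..d}. restrict (\<lambda>k. \<zeta> k \<omega>) {1..d} k * w k) = deriv_at \<omega> a"
      unfolding dv1 by (intro sum.cong) auto
    moreover have "restrict (\<lambda>k. \<zeta> k \<omega>) {1..d} \<in> space (PiM {1..d} (\<lambda>_. ?O))"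
      using coeff_integers[OF that] by (auto simp: space_PiM space_restrict_space)
    ultimately show ?thesis unfolding E_def by simp
  qed
  have "{\<omega> \<in> space M. eval_at \<omega> a \<in> padic_ideal i \<and> deriv_at \<omega> a \<in> padic_ideal j}
      = {\<omega> \<in> space M. restrict (\<lambda>k. \<zeta> k \<omega>) {1..d} \<in> E \<and> \<zeta> 0 \<omega> + (\<Sum>k\<in>{1..d}. \<zeta> k \<omega> * a ^ k) \<in> padic_ideal i}"
    using E_iff by (auto simp: ev)
  also have "emeasure M \<dots> = ennreal (1 / real CARD('p) ^ i) * emeasure M {\<omega> \<in> space M. restrict (\<lambda>k. \<zeta> k \<omega>) {1..d} \<in> E}"
    using a by (intro emeasure_coeff_shift E padic_integers_power) auto
  also have "{\<omega> \<in> space M. restrict (\<lambda>k. \<zeta> k \<omega>) {1..d} \<in> E}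
     = {\<omega> \<in> space M. restrict (\<lambda>k. \<zeta> k \<omega>) {2..d} \<in> space (PiM {2..d} (\<lambda>_. ?O)) \<and>
          \<zeta> 1 \<omega> + (\<Sum>k\<in>{2..d}. \<zeta> k \<omega> * w k) \<in> padic_ideal j}"
    using E_iff coeff_integers by (auto simp: dv2 space_PiM space_restrict_space)
  also have "emeasure M \<dots> = ennreal (1 / real CARD('p) ^ j) *
      emeasure M {\<omega> \<in> space M. restrict (\<lambda>k. \<zeta> k \<omega>) {2..d} \<in> space (PiM {2..d} (\<lambda>_. ?O))}"
    using w degree_pos by (intro emeasure_coeff_shift sets.top) auto
  also have "{\<omega> \<in> space M. restrict (\<lambda>k. \<zeta> k \<omega>) {2..d} \<in> space (PiM {2..d} (\<lambda>_. ?O))} = space M"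
    using coeff_integers by (auto simp: space_PiM space_restrict_space)
  also have "ennreal (1 / real CARD('p) ^ i) * (ennreal (1 / real CARD('p) ^ j) * emeasure M (space M))
     = ennreal (1 / real CARD('p) ^ (i + j))"
    by (simp add: emeasure_space_1 power_add flip: ennreal_mult)
  finally show ?thesis .
qed

end

section \<open>The expected number of zeros in an affine chart\<close>

text \<open>
  Partial sums of the mean of \<open>|g'(b)|\<close>: the value \<open>q\<^sup>-\<^sup>j\<close> is taken with probability \<open>q\<^sup>-\<^sup>j - q\<^sup>-\<^sup>j\<^sup>-\<^sup>1\<close>.
\<close>

lemma sum_alternating_powers:
  fixes q :: real
  assumes "q > 1"
  shows "(\<Sum>j<k. 1 / q ^ (2 * j) - 1 / q ^ (2 * j + 1)) = q / (q + 1) * (1 - 1 / q ^ (2 * k))"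
proof (induction k)
  case (Suc k)
  define u where "u = 1 / q ^ (2 * k)"
  have "1 / q ^ (2 * k + 1) = u / q" "1 / q ^ (2 * Suc k) = u / (q * q)"
    by (simp_all add: u_def)
  moreover have "u - u / q = q / (q + 1) * (u - u / (q * q))"
  proof -
    have nz: "q \<noteq> 0" "q + 1 \<noteq> 0" using assms by auto
    have "q / (q + 1) * (u - u / (q * q)) = q / (q + 1) * (u * (q - 1) * (q + 1) / (q * q))"
      using nz by (simp add: divide_simps) (simp add: algebra_simps)
    also have "\<dots> = u * (q - 1) / q" using nz by simp
    also have "\<dots> = u - u / q" using nz by (simp add: right_diff_distrib diff_divide_distrib)
    finally show ?thesis by simp
  qed
  ultimately have "1 / q ^ (2 * k) - 1 / q ^ (2 * k + 1) = q / (q + 1) * (1 / q ^ (2 * k) - 1 / q ^ (2 * Suc k))"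
    by (simp only: u_def)
  then show ?case unfolding sum.lessThan_Suc Suc by (simp add: algebra_simps)
qed simp

context uniform_padic_coefficients
begin

definition degenerate :: "'w \<Rightarrow> bool" where
  "degenerate \<omega> \<longleftrightarrow> (\<forall>k\<le>d. \<zeta> k \<omega> = 0)"

text \<open>
  The value \<open>0\<close> for the zero polynomial, which is an event of probability \<open>0\<close>, keeps all counts bounded by
  \<open>d\<close>, so that they can be subtracted.
\<close>

definition zero_count :: "'p padic set \<Rightarrow> 'w \<Rightarrow> ennreal" where
  "zero_count A \<omega> = (if degenerate \<omega> then 0 else num_elements {x \<in> A. eval_at \<omega> x = 0})"

lemma finite_zeros: "\<not> degenerate \<omega> \<Longrightarrow> finite {x \<in> A. eval_at \<omega> x = 0}"
proof -
  assume "\<not> degenerate \<omega>"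
  then obtain k where "k \<le> d" "\<zeta> k \<omega> \<noteq> 0" by (auto simp: degenerate_def)
  then have "finite {x. eval_at \<omega> x = 0}" using card_zeros_le[of k d "\<lambda>k. \<zeta> k \<omega>"] by blast
  then show ?thesis by (rule rev_finite_subset) auto
qed

lemma zero_count_le: "zero_count A \<omega> \<le> of_nat d"
proof (cases "degenerate \<omega>")
  case False
  then obtain k where "k \<le> d" "\<zeta> k \<omega> \<noteq> 0" by (auto simp: degenerate_def)
  then have "finite {x. eval_at \<omega> x = 0}" "card {x. eval_at \<omega> x = 0} \<le> d"
    using card_zeros_le[of k d "\<lambda>k. \<zeta> k \<omega>"] by blast+
  then have "card {x \<in> A. eval_at \<omega> x = 0} \<le> d"
    using card_mono[of "{x. eval_at \<omega> x = 0}" "{x \<in> A. eval_at \<omega> x = 0}"] by force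
  then show ?thesis
    using finite_zeros[OF False] False by (simp add: zero_count_def num_elements_finite)
qed (simp add: zero_count_def)

lemma zero_count_UN_disjoint:
  assumes "disjoint_family A"
  shows "zero_count (\<Union>i::nat. A i) \<omega> = (\<Sum>i. zero_count (A i) \<omega>)"
proof -
  have "disjoint_family (\<lambda>i. {x \<in> A i. eval_at \<omega> x = 0})"
    using assms unfolding disjoint_family_on_def by blast
  moreover have "(\<Union>i. {x \<in> A i. eval_at \<omega> x = 0}) = {x \<in> (\<Union>i. A i). eval_at \<omega> x = 0}" by blast
  ultimately show ?thesis
    using num_elements_UN_disjoint[of "\<lambda>i. {x \<in> A i. eval_at \<omega> x = 0}"] by (simp add: zero_count_def)
qed

lemma zero_count_UN_finite:
  assumes "finite I" "disjoint_family_on A I"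
  shows "zero_count (\<Union>i\<in>I. A i) \<omega> = (\<Sum>i\<in>I. zero_count (A i) \<omega>)"
proof -
  have "disjoint_family_on (\<lambda>i. {x \<in> A i. eval_at \<omega> x = 0}) I"
    using assms(2) unfolding disjoint_family_on_def by blast
  moreover have "(\<Union>i\<in>I. {x \<in> A i. eval_at \<omega> x = 0}) = {x \<in> (\<Union>i\<in>I. A i). eval_at \<omega> x = 0}" by blast
  ultimately show ?thesis
    using num_elements_UN_finite[OF assms(1), of "\<lambda>i. {x \<in> A i. eval_at \<omega> x = 0}"]
    by (simp add: zero_count_def)
qed

lemma zero_count_Un:
  assumes "A \<inter> B = {}"
  shows "zero_count (A \<union> B) \<omega> = zero_count A \<omega> + zero_count B \<omega>"
proof -
  have "{x \<in> A. eval_at \<omega> x = 0} \<inter> {x \<in> B. eval_at \<omega> x = 0} = {}" using assms by blast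
  moreover have "{x \<in> A. eval_at \<omega> x = 0} \<union> {x \<in> B. eval_at \<omega> x = 0} = {x \<in> A \<union> B. eval_at \<omega> x = 0}" by blast
  ultimately show ?thesis
    using num_elements_Un[of "{x \<in> A. eval_at \<omega> x = 0}" "{x \<in> B. eval_at \<omega> x = 0}"]
    by (simp add: zero_count_def)
qed

lemma zero_count_empty [simp]: "zero_count {} \<omega> = 0"
  by (simp add: zero_count_def num_elements_def)

lemma sets_degenerate [measurable]: "{\<omega> \<in> space M. degenerate \<omega>} \<in> sets M"
proof -
  have "{\<omega> \<in> space M. degenerate \<omega>} = {\<omega> \<in> space M. \<forall>k\<in>{..d}. \<zeta> k \<omega> = 0}"
    by (auto simp: degenerate_def)
  also have "\<dots> \<in> sets M"
  proof (rule sets.sets_Collect_finite_All')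
    fix k assume "k \<in> {..d}"
    then have [measurable]: "\<zeta> k \<in> borel_measurable M" by (simp add: coeff_borel)
    show "{\<omega> \<in> space M. \<zeta> k \<omega> = 0} \<in> sets M" by measurable
  qed auto
  finally show ?thesis .
qed

lemma emeasure_first_coeff_ball:
  assumes "a \<in> padic_integers"
  shows "emeasure M {\<omega> \<in> space M. \<zeta> 0 \<omega> \<in> padic_ball a n} = ennreal (1 / real CARD('p) ^ n)"
proof -
  let ?O = "restrict_space borel padic_integers :: 'p padic measure"
  have "padic_ball a n = padic_integers \<inter> padic_ball a n"
    using padic_ball_subset_integers[OF assms] by blast
  then have "padic_ball a n \<in> sets ?O"
    using sets_padic_ball[of a n] by (auto simp: sets_restrict_space)
  then have "emeasure (distr M ?O (\<zeta> 0)) (padic_ball a n) = emeasure M (\<zeta> 0 -` padic_ball a n \<inter> space M)"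
    by (intro emeasure_distr coeff_measurable) auto
  also have "\<zeta> 0 -` padic_ball a n \<inter> space M = {\<omega> \<in> space M. \<zeta> 0 \<omega> \<in> padic_ball a n}" by auto
  finally show ?thesis using emeasure_uniform_padic_ball[OF uniform assms, of 0 n] by simp
qed

lemma inverse_card_power_tendsto_0: "(\<lambda>n. 1 / real CARD('p) ^ n) \<longlonglongrightarrow> 0"
  using LIMSEQ_power_zero[of "1 / real CARD('p)"] card_gt_1[where 'p = 'p] by (simp add: power_one_over)

text \<open>
  Already \<open>\<zeta>\<^sub>0\<close> vanishes with probability at most \<open>p\<^sup>-\<^sup>n\<close> for every \<open>n\<close>.
\<close>

lemma AE_not_degenerate: "AE \<omega> in M. \<not> degenerate \<omega>"
proof (rule AE_I')
  have le: "emeasure M {\<omega> \<in> space M. degenerate \<omega>} \<le> ennreal (1 / real CARD('p) ^ n)" for n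
    unfolding emeasure_first_coeff_ball[of 0 n, symmetric, OF zero_in_padic_ideal[of 0, unfolded padic_ideal_0]]
    by (intro emeasure_mono) (auto simp: degenerate_def padic_ball_def)
  have "(\<lambda>n. ennreal (1 / real CARD('p) ^ n)) \<longlonglongrightarrow> ennreal 0"
    using inverse_card_power_tendsto_0 by (intro tendsto_ennrealI)
  then have "emeasure M {\<omega> \<in> space M. degenerate \<omega>} \<le> ennreal 0"
    using le by (intro LIMSEQ_le_const) auto
  then show "{\<omega> \<in> space M. degenerate \<omega>} \<in> null_sets M" by (auto simp: null_sets_def)
qed auto

text \<open>
  The number of small balls that contain a zero is eventually the number of zeros, and containing a
  zero is an event by \<open>ex_zero_iff_approximate_zeros\<close>.
\<close>

lemma zero_count_ball_measurable:
  assumes a: "a \<in> padic_integers"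
  shows "zero_count (padic_ball a n) \<in> borel_measurable M"
proof -
  let ?B = "\<lambda>m s. padic_ball (subball_center a n s) (n + m)"
  define E where "E m s = {\<omega> \<in> space M. \<exists>x\<in>?B m s. eval_at \<omega> x = 0}" for m s
  have E[measurable]: "E m s \<in> sets M" for m s
  proof -
    have "E m s = {\<omega> \<in> space M. \<forall>i. \<exists>t::nat. of_nat t \<in> ?B m s \<and> eval_at \<omega> (of_nat t) \<in> padic_ideal i}"
      unfolding E_def
      using ex_zero_iff_approximate_zeros[OF coeff_integers subball_center_in_integers[OF a]] by blast
    also have "\<dots> \<in> sets M" by measurable
    finally show ?thesis .
  qed
  define F where "F m \<omega> = (if degenerate \<omega> then 0 else \<Sum>s<CARD('p) ^ m. indicator (E m s) \<omega> :: ennreal)" for m \<omega>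
  have "F m \<in> borel_measurable M" for m unfolding F_def by measurable
  moreover have "(\<lambda>m. F m \<omega>) \<longlonglongrightarrow> zero_count (padic_ball a n) \<omega>" if \<omega>: "\<omega> \<in> space M" for \<omega>
  proof (cases "degenerate \<omega>")
    case False
    let ?Z = "{x \<in> padic_ball a n. eval_at \<omega> x = 0}"
    have fin: "finite ?Z" by (rule finite_zeros[OF False])
    have "\<forall>\<^sub>F m in sequentially. card {s \<in> {..<CARD('p) ^ m}. ?Z \<inter> ?B m s \<noteq> {}} = card ?Z"
      by (rule eventually_card_subballs_meeting[OF fin]) auto
    then have "\<forall>\<^sub>F m in sequentially. F m \<omega> = zero_count (padic_ball a n) \<omega>"
    proof (rule eventually_mono)
      fix m assume eq: "card {s \<in> {..<CARD('p) ^ m}. ?Z \<inter> ?B m s \<noteq> {}} = card ?Z"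
      have ind: "indicator (E m s) \<omega> = (if ?Z \<inter> ?B m s \<noteq> {} then 1 else 0 :: ennreal)" for s
        using \<omega> subball_subset[of a n s m] unfolding E_def by (auto simp: indicator_def)
      have "F m \<omega> = of_nat (card {s \<in> {..<CARD('p) ^ m}. ?Z \<inter> ?B m s \<noteq> {}})"
        unfolding F_def ind using False by (simp add: sum.If_cases Int_def)
      then show "F m \<omega> = zero_count (padic_ball a n) \<omega>"
        using False fin eq by (simp add: zero_count_def num_elements_finite)
    qed
    then show ?thesis by (rule tendsto_eventually)
  qed (simp add: F_def zero_count_def)
  ultimately show ?thesis using borel_measurable_LIMSEQ_order[of M F "zero_count (padic_ball a n)"] by simp
qed

text \<open>
  The events \<open>|g'(b)| = p\<^sup>-\<^sup>j, |g(b)| \<le> p\<^sup>-\<^sup>m\<^sup>-\<^sup>j\<close>, which for \<open>j < m\<close> give exactly one zero in the ball of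
  radius \<open>p\<^sup>-\<^sup>m\<close> around \<open>b\<close>.
\<close>

definition simple_zero_event :: "'p padic \<Rightarrow> nat \<Rightarrow> nat \<Rightarrow> 'w set" where
  "simple_zero_event b m j = {\<omega> \<in> space M. deriv_at \<omega> b \<in> padic_ideal j \<and> deriv_at \<omega> b \<notin> padic_ideal (Suc j)
     \<and> eval_at \<omega> b \<in> padic_ideal (m + j)}"

text \<open>
  The only event outside the previous ones on which there can be zeros in that ball.
\<close>

definition singular_event :: "'p padic \<Rightarrow> nat \<Rightarrow> 'w set" where
  "singular_event b m = {\<omega> \<in> space M. eval_at \<omega> b \<in> padic_ideal (m + m) \<and> deriv_at \<omega> b \<in> padic_ideal m}"

lemma sets_zero_events [measurable]: "simple_zero_event b m j \<in> sets M" "singular_event b m \<in> sets M"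
  unfolding simple_zero_event_def singular_event_def by measurable

lemma emeasure_simple_zero_event:
  assumes b: "b \<in> padic_integers"
  shows "emeasure M (simple_zero_event b m j) =
    ennreal (1 / real CARD('p) ^ m * (1 / real CARD('p) ^ (2 * j) - 1 / real CARD('p) ^ (2 * j + 1)))"
proof -
  let ?A = "\<lambda>j'. {\<omega> \<in> space M. eval_at \<omega> b \<in> padic_ideal (m + j) \<and> deriv_at \<omega> b \<in> padic_ideal j'}"
  have sub: "?A (Suc j) \<subseteq> ?A j" using padic_ideal_antimono[of j "Suc j"] by auto
  have diff: "simple_zero_event b m j = ?A j - ?A (Suc j)" by (auto simp: simple_zero_event_def)
  have "emeasure M (?A j - ?A (Suc j)) = emeasure M (?A j) - emeasure M (?A (Suc j))"
    using sub by (intro emeasure_Diff) auto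
  moreover have "emeasure M (?A j) = ennreal (1 / real CARD('p) ^ (m + j + j))"
    "emeasure M (?A (Suc j)) = ennreal (1 / real CARD('p) ^ (m + j + Suc j))"
    by (rule emeasure_eval_deriv[OF b])+
  moreover have "ennreal (1 / real CARD('p) ^ (m + j + j)) - ennreal (1 / real CARD('p) ^ (m + j + Suc j))
      = ennreal (1 / real CARD('p) ^ (m + j + j) - 1 / real CARD('p) ^ (m + j + Suc j))"
    by (rule ennreal_minus) (rule divide_nonneg_nonneg, simp_all)
  moreover have "1 / real CARD('p) ^ (m + j + j) - 1 / real CARD('p) ^ (m + j + Suc j)
     = 1 / real CARD('p) ^ m * (1 / real CARD('p) ^ (2 * j) - 1 / real CARD('p) ^ (2 * j + 1))"
  proof -
    have "m + j + j = m + 2 * j" "m + j + Suc j = m + (2 * j + 1)" by auto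
    then have eq: "real CARD('p) ^ (m + j + j) = real CARD('p) ^ m * real CARD('p) ^ (2 * j)"
      "real CARD('p) ^ (m + j + Suc j) = real CARD('p) ^ m * real CARD('p) ^ (2 * j + 1)"
      by (simp_all only: power_add)
    have "1 / (u * v) - 1 / (u * w) = 1 / u * (1 / v - 1 / w)" for u v w :: real
      by (simp add: right_diff_distrib)
    then show ?thesis unfolding eq .
  qed
  ultimately show ?thesis unfolding diff by (simp only:)
qed

text \<open>
  At most one of the simple events occurs, since \<open>j\<close> is determined by \<open>|g'(b)|\<close>; Hensel's lemma says that
  then the count is \<open>1\<close>, and the singular event contributes at most \<open>d\<close>.
\<close>

lemma zero_count_sandwich:
  assumes b: "b \<in> padic_integers" and \<omega>: "\<omega> \<in> space M" and nd: "\<not> degenerate \<omega>"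
  shows "(\<Sum>j<m. indicator (simple_zero_event b m j) \<omega>) \<le> zero_count (padic_ball b m) \<omega>" (is "?S \<le> ?N")
    and "zero_count (padic_ball b m) \<omega> \<le> (\<Sum>j<m. indicator (simple_zero_event b m j) \<omega>) + of_nat d * indicator (singular_event b m) \<omega>"
proof -
  note c = coeff_integers[OF \<omega>]
  let ?Z = "{x \<in> padic_ball b m. eval_at \<omega> x = 0}"
  have N: "?N = num_elements ?Z" using nd by (simp add: zero_count_def)
  have "?S \<le> ?N \<and> ?N \<le> ?S + of_nat d * indicator (singular_event b m) \<omega>"
  proof (cases "deriv_at \<omega> b \<in> padic_ideal m")
    case True
    have "\<omega> \<notin> simple_zero_event b m j" if "j < m" for j
      using True padic_ideal_antimono[of "Suc j" m] that by (auto simp: simple_zero_event_def)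
    then have S: "?S = 0" by (intro sum.neutral) (auto simp: indicator_def)
    show ?thesis
    proof (cases "?Z = {}")
      case True
      then show ?thesis unfolding N S True by (simp add: num_elements_def)
    next
      case False
      then have "eval_at \<omega> b \<in> padic_ideal (m + m)" using singular_zero[OF c b True] by blast
      then have "\<omega> \<in> singular_event b m" using True \<omega> by (simp add: singular_event_def)
      then show ?thesis unfolding S using zero_count_le by simp
    qed
  next
    case False
    have "deriv_at \<omega> b \<in> padic_ideal 0" using coeff_deriv_in_integers[OF c b] by (simp add: padic_ideal_0)
    then obtain j where j: "j < m" "deriv_at \<omega> b \<in> padic_ideal j" "deriv_at \<omega> b \<notin> padic_ideal (Suc j)"
      using ex_least_nat_less[of "\<lambda>i. deriv_at \<omega> b \<notin> padic_ideal i" m] False by blast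
    have other: "\<omega> \<notin> simple_zero_event b m i" if "i \<noteq> j" for i
    proof (cases "i < j")
      case True
      then show ?thesis using j(2) padic_ideal_antimono[of "Suc i" j] by (auto simp: simple_zero_event_def)
    next
      case False
      then show ?thesis using that j(3) padic_ideal_antimono[of "Suc j" i] by (auto simp: simple_zero_event_def)
    qed
    have "?S = (\<Sum>i<m. if i = j then indicator (simple_zero_event b m j) \<omega> else 0)"
      using other by (intro sum.cong) (auto simp: indicator_def)
    also have "\<dots> = indicator (simple_zero_event b m j) \<omega>" using j(1) by simp
    finally have S: "?S = indicator (simple_zero_event b m j) \<omega>" .
    have "?Z = {} \<or> (\<exists>x. ?Z = {x})"
      using hensel_unique[OF c b False] by blast
    then have "num_elements ?Z = (if ?Z = {} then 0 else 1)"
      by (elim disjE exE) (simp_all only: num_elements_finite finite.intros, simp_all)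
    moreover have "?Z \<noteq> {} \<longleftrightarrow> \<omega> \<in> simple_zero_event b m j"
      using hensel_exists_iff[OF c b j] j \<omega> unfolding simple_zero_event_def by blast
    ultimately have "num_elements ?Z = indicator (simple_zero_event b m j) \<omega>"
      by (cases "\<omega> \<in> simple_zero_event b m j") simp_all
    then have "?N = ?S" unfolding N S .
    then show ?thesis by (simp only: order_refl) simp
  qed
  then show "?S \<le> ?N" "?N \<le> ?S + of_nat d * indicator (singular_event b m) \<omega>" by auto
qed

lemma expectation_zero_count_bounds:
  assumes b: "b \<in> padic_integers"
  shows "ennreal (real CARD('p) / (real CARD('p) + 1) / real CARD('p) ^ m * (1 - 1 / real CARD('p) ^ (2 * m))) \<le> (\<integral>\<^sup>+ \<omega>. zero_count (padic_ball b m) \<omega> \<partial>M)"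
    and "(\<integral>\<^sup>+ \<omega>. zero_count (padic_ball b m) \<omega> \<partial>M) \<le>
      ennreal (real CARD('p) / (real CARD('p) + 1) / real CARD('p) ^ m * (1 - 1 / real CARD('p) ^ (2 * m)) + real d / real CARD('p) ^ (3 * m))"
proof -
  let ?q = "real CARD('p)"
  let ?S = "\<lambda>\<omega>. \<Sum>j<m. indicator (simple_zero_event b m j) \<omega> :: ennreal"
  let ?R = "\<lambda>\<omega>. of_nat d * indicator (singular_event b m) \<omega> :: ennreal"
  have q: "1 < ?q" by (rule card_gt_1)
  have nonneg: "0 \<le> 1 / ?q ^ (2 * j) - 1 / ?q ^ (2 * j + 1)" for j
    using q by (simp add: field_simps)
  have "(\<integral>\<^sup>+ \<omega>. ?S \<omega> \<partial>M) = (\<Sum>j<m. emeasure M (simple_zero_event b m j))"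
    by (subst nn_integral_sum) auto
  also have "\<dots> = (\<Sum>j<m. ennreal (1 / ?q ^ m * (1 / ?q ^ (2 * j) - 1 / ?q ^ (2 * j + 1))))"
    by (simp add: emeasure_simple_zero_event[OF b])
  also have "\<dots> = ennreal (\<Sum>j<m. 1 / ?q ^ m * (1 / ?q ^ (2 * j) - 1 / ?q ^ (2 * j + 1)))"
    using nonneg by (intro sum_ennreal mult_nonneg_nonneg) auto
  also have "(\<Sum>j<m. 1 / ?q ^ m * (1 / ?q ^ (2 * j) - 1 / ?q ^ (2 * j + 1)))
      = real CARD('p) / (real CARD('p) + 1) / ?q ^ m * (1 - 1 / ?q ^ (2 * m))"
    unfolding sum_distrib_left[symmetric] sum_alternating_powers[OF q] by simp
  finally have S: "(\<integral>\<^sup>+ \<omega>. ?S \<omega> \<partial>M) = ennreal (real CARD('p) / (real CARD('p) + 1) / ?q ^ m * (1 - 1 / ?q ^ (2 * m)))" .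
  have "(\<integral>\<^sup>+ \<omega>. ?R \<omega> \<partial>M) = of_nat d * emeasure M (singular_event b m)"
    by (simp add: nn_integral_cmult)
  also have "\<dots> = ennreal (real d / ?q ^ (3 * m))"
    unfolding singular_event_def emeasure_eval_deriv[OF b] ennreal_of_nat_eq_real_of_nat
    by (simp add: ennreal_mult[symmetric] mult.commute numeral_3_eq_3 add.assoc)
  finally have R: "(\<integral>\<^sup>+ \<omega>. ?R \<omega> \<partial>M) = ennreal (real d / ?q ^ (3 * m))" .
  show "ennreal (real CARD('p) / (real CARD('p) + 1) / ?q ^ m * (1 - 1 / ?q ^ (2 * m))) \<le> (\<integral>\<^sup>+ \<omega>. zero_count (padic_ball b m) \<omega> \<partial>M)"
    unfolding S[symmetric] using AE_not_degenerate zero_count_sandwich(1)[OF b]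
    by (intro nn_integral_mono_AE) auto
  have "(\<integral>\<^sup>+ \<omega>. zero_count (padic_ball b m) \<omega> \<partial>M) \<le> (\<integral>\<^sup>+ \<omega>. ?S \<omega> + ?R \<omega> \<partial>M)"
    using AE_not_degenerate zero_count_sandwich(2)[OF b] by (intro nn_integral_mono_AE) auto
  also have "\<dots> = (\<integral>\<^sup>+ \<omega>. ?S \<omega> \<partial>M) + (\<integral>\<^sup>+ \<omega>. ?R \<omega> \<partial>M)"
    by (intro nn_integral_add) auto
  also have "\<dots> = ennreal (real CARD('p) / (real CARD('p) + 1) / ?q ^ m * (1 - 1 / ?q ^ (2 * m)) + real d / ?q ^ (3 * m))"
    unfolding S R using q by (intro ennreal_plus[symmetric] mult_nonneg_nonneg) (auto simp: field_simps one_le_power)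
  finally show "(\<integral>\<^sup>+ \<omega>. zero_count (padic_ball b m) \<omega> \<partial>M) \<le>
      ennreal (real CARD('p) / (real CARD('p) + 1) / ?q ^ m * (1 - 1 / ?q ^ (2 * m)) + real d / ?q ^ (3 * m))" .
qed

text \<open>
  The bounds on small balls, summed over a partition into \<open>p\<^sup>k\<close> of them, squeeze the expectation as
  \<open>k \<rightarrow> \<infinity>\<close>.
\<close>

lemma expectation_zero_count_ball:
  assumes a: "a \<in> padic_integers"
  shows "(\<integral>\<^sup>+ \<omega>. zero_count (padic_ball a n) \<omega> \<partial>M) = ennreal (real CARD('p) / (real CARD('p) + 1) / real CARD('p) ^ n)"
proof -
  let ?q = "real CARD('p)"
  have q: "1 < ?q" by (rule card_gt_1)
  let ?I = "\<integral>\<^sup>+ \<omega>. zero_count (padic_ball a n) \<omega> \<partial>M"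
  \<comment> \<open>Both the truncation of the geometric series and the singular event cost a multiple of this.\<close>
  define \<epsilon> where "\<epsilon> k = 1 / ?q ^ (2 * (n + k))" for k
  have eps: "0 \<le> \<epsilon> k" "\<epsilon> k \<le> 1" for k using q by (auto simp: \<epsilon>_def one_le_power)
  have I: "?I = (\<Sum>s<CARD('p) ^ k. \<integral>\<^sup>+ \<omega>. zero_count (padic_ball (subball_center a n s) (n + k)) \<omega> \<partial>M)" for k
  proof -
    have "zero_count (padic_ball a n) \<omega> = (\<Sum>s<CARD('p) ^ k. zero_count (padic_ball (subball_center a n s) (n + k)) \<omega>)" for \<omega>
      unfolding padic_ball_eq_UN_subballs[of a n k]
      by (rule zero_count_UN_finite[OF finite_lessThan disjoint_subballs])
    then have "?I = (\<integral>\<^sup>+ \<omega>. (\<Sum>s<CARD('p) ^ k. zero_count (padic_ball (subball_center a n s) (n + k)) \<omega>) \<partial>M)"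
      by (intro nn_integral_cong)
    also have "\<dots> = (\<Sum>s<CARD('p) ^ k. \<integral>\<^sup>+ \<omega>. zero_count (padic_ball (subball_center a n s) (n + k)) \<omega> \<partial>M)"
      by (intro nn_integral_sum zero_count_ball_measurable subball_center_in_integers a)
    finally show ?thesis .
  qed
  have sum_const: "(\<Sum>s<CARD('p) ^ k. ennreal x) = ennreal (?q ^ k * x)" for k x
    by (cases "x \<ge> 0") (simp_all add: ennreal_of_nat_eq_real_of_nat ennreal_mult ennreal_neg mult_nonneg_nonpos)
  have lower: "ennreal (real CARD('p) / (real CARD('p) + 1) / ?q ^ n * (1 - \<epsilon> k)) \<le> ?I" for k
  proof -
    have "(\<Sum>s<CARD('p) ^ k. ennreal (real CARD('p) / (real CARD('p) + 1) / ?q ^ (n + k) * (1 - \<epsilon> k))) \<le> ?I"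
      unfolding I[of k] \<epsilon>_def
      by (intro sum_mono expectation_zero_count_bounds(1) subball_center_in_integers a)
    moreover have "?q ^ k * (real CARD('p) / (real CARD('p) + 1) / ?q ^ (n + k) * (1 - \<epsilon> k)) = real CARD('p) / (real CARD('p) + 1) / ?q ^ n * (1 - \<epsilon> k)"
      using q by (simp add: power_add)
    ultimately show ?thesis unfolding sum_const by simp
  qed
  have upper: "?I \<le> ennreal (real CARD('p) / (real CARD('p) + 1) / ?q ^ n * (1 - \<epsilon> k) + real d / ?q ^ n * \<epsilon> k)" for k
  proof -
    have "?I \<le> (\<Sum>s<CARD('p) ^ k. ennreal (real CARD('p) / (real CARD('p) + 1) / ?q ^ (n + k) * (1 - \<epsilon> k) + real d / ?q ^ (3 * (n + k))))"
      unfolding I[of k] \<epsilon>_def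
      by (intro sum_mono expectation_zero_count_bounds(2) subball_center_in_integers a)
    moreover have "3 * (n + k) = n + k + 2 * (n + k)" by simp
    then have "?q ^ (3 * (n + k)) = ?q ^ n * ?q ^ k * ?q ^ (2 * (n + k))" by (simp only: power_add)
    then have "?q ^ k * (real CARD('p) / (real CARD('p) + 1) / ?q ^ (n + k) * (1 - \<epsilon> k) + real d / ?q ^ (3 * (n + k)))
       = real CARD('p) / (real CARD('p) + 1) / ?q ^ n * (1 - \<epsilon> k) + real d / ?q ^ n * \<epsilon> k"
      using q by (simp add: power_add[of _ n k] distrib_left \<epsilon>_def)
    ultimately show ?thesis unfolding sum_const by simp
  qed
  have "strict_mono (\<lambda>k. 2 * (n + k))" by (simp add: strict_mono_def)
  from LIMSEQ_subseq_LIMSEQ[OF inverse_card_power_tendsto_0 this]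
  have lim: "\<epsilon> \<longlonglongrightarrow> 0" by (simp add: \<epsilon>_def[abs_def] comp_def)
  have "(\<lambda>k. real CARD('p) / (real CARD('p) + 1) / ?q ^ n * (1 - \<epsilon> k)) \<longlonglongrightarrow> real CARD('p) / (real CARD('p) + 1) / ?q ^ n * (1 - 0)"
    by (intro tendsto_intros lim)
  then have "(\<lambda>k. ennreal (real CARD('p) / (real CARD('p) + 1) / ?q ^ n * (1 - \<epsilon> k))) \<longlonglongrightarrow> ennreal (real CARD('p) / (real CARD('p) + 1) / ?q ^ n)"
    by (simp add: tendsto_ennrealI)
  then have le: "ennreal (real CARD('p) / (real CARD('p) + 1) / ?q ^ n) \<le> ?I" using lower by (intro LIMSEQ_le_const2) auto
  have "(\<lambda>k. real CARD('p) / (real CARD('p) + 1) / ?q ^ n * (1 - \<epsilon> k) + real d / ?q ^ n * \<epsilon> k) \<longlonglongrightarrow> real CARD('p) / (real CARD('p) + 1) / ?q ^ n * (1 - 0) + real d / ?q ^ n * 0"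
    by (intro tendsto_intros lim)
  then have "(\<lambda>k. ennreal (real CARD('p) / (real CARD('p) + 1) / ?q ^ n * (1 - \<epsilon> k) + real d / ?q ^ n * \<epsilon> k)) \<longlonglongrightarrow> ennreal (real CARD('p) / (real CARD('p) + 1) / ?q ^ n)"
    by (simp add: tendsto_ennrealI)
  then have ge: "?I \<le> ennreal (real CARD('p) / (real CARD('p) + 1) / ?q ^ n)" using upper by (intro LIMSEQ_le_const) auto
  show ?thesis using le ge by (rule antisym[rotated])
qed

end

section \<open>From balls to Borel sets\<close>

text \<open>
  The complement step in the two applications of Dynkin's lemma below.
\<close>

lemma ennreal_proportional_complement:
  fixes x x' y y' C :: ennreal
  assumes "x + x' = C * (y + y')" "x = C * y" "x \<noteq> \<top>"
  shows "x' = C * y'"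
proof -
  have "x + x' = x + C * y'" using assms(1) unfolding assms(2) by (simp add: distrib_left)
  then show ?thesis using assms(3) by (simp add: ennreal_add_left_cancel)
qed

text \<open>
  Describes the Haar measure of \<open>\<int>\<^sub>p\<close> by its values on balls and leaves the measure outside of \<open>\<int>\<^sub>p\<close> open, so
  that the law of \<open>\<zeta>\<^sub>0\<close> on \<open>\<rat>\<^sub>p\<close> qualifies. One such measure then serves both charts.
\<close>

definition padic_uniform_measure :: "'p::prime_card padic measure \<Rightarrow> bool" where
  "padic_uniform_measure h \<longleftrightarrow> sets h = sets borel \<and>
     (\<forall>a\<in>padic_integers. \<forall>n. emeasure h (padic_ball a n) = ennreal (1 / real CARD('p) ^ n))"

context uniform_padic_coefficients
begin

lemma padic_uniform_measure_coeff: "padic_uniform_measure (distr M borel (\<zeta> 0))"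
  unfolding padic_uniform_measure_def
proof (intro conjI ballI allI)
  fix a :: "'p padic" and n assume a: "a \<in> padic_integers"
  have "emeasure (distr M borel (\<zeta> 0)) (padic_ball a n) = emeasure M (\<zeta> 0 -` padic_ball a n \<inter> space M)"
    by (intro emeasure_distr coeff_borel) auto
  also have "\<zeta> 0 -` padic_ball a n \<inter> space M = {\<omega> \<in> space M. \<zeta> 0 \<omega> \<in> padic_ball a n}" by auto
  finally show "emeasure (distr M borel (\<zeta> 0)) (padic_ball a n) = ennreal (1 / real CARD('p) ^ n)"
    using emeasure_first_coeff_ball[OF a, of n] by simp
qed simp

text \<open>
  Measurability and expectation are extended from balls to Borel sets together: in the complement and the
  union step the expectation can be computed only after measurability is known.
\<close>

lemma zero_count_Borel:
  assumes h: "padic_uniform_measure h" and A: "A \<in> sets borel"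
  shows "zero_count (A \<inter> padic_integers) \<in> borel_measurable M \<and>
    (\<integral>\<^sup>+ \<omega>. zero_count (A \<inter> padic_integers) \<omega> \<partial>M)
      = ennreal (real CARD('p) / (real CARD('p) + 1)) * emeasure h (A \<inter> padic_integers)"
  using A
proof (induction rule: padic_borel_induct)
  case (ball a n)
  show ?case
  proof (cases "a \<in> padic_integers")
    case True
    then show ?thesis
      using h by (simp add: padic_ball_Int_integers zero_count_ball_measurable expectation_zero_count_ball
          padic_uniform_measure_def flip: ennreal_mult)
  qed (simp add: padic_ball_Int_integers)
next
  case empty
  show ?case by simp
next
  case (compl A)
  let ?C = "ennreal (real CARD('p) / (real CARD('p) + 1))"
  let ?x = "zero_count (A \<inter> padic_integers)" and ?x' = "zero_count (- A \<inter> padic_integers)"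
  have sets: "sets h = sets borel" using h by (simp add: padic_uniform_measure_def)
  have part: "padic_integers = (A \<inter> padic_integers) \<union> (- A \<inter> padic_integers)"
    and disj: "(A \<inter> padic_integers) \<inter> (- A \<inter> padic_integers) = {}" by auto
  have O0: "padic_integers = padic_ball (0 :: 'p padic) 0" by (rule padic_integers_eq_ball)
  have mO: "zero_count padic_integers \<in> borel_measurable M" unfolding O0
    by (rule zero_count_ball_measurable) simp
  have add: "zero_count padic_integers \<omega> = ?x \<omega> + ?x' \<omega>" for \<omega>
    using zero_count_Un[OF disj] part by simp
  have fin: "?x \<omega> \<noteq> \<top>" for \<omega>
    using zero_count_le[of "A \<inter> padic_integers" \<omega>] by (auto simp: top_unique)
  have "?x' = (\<lambda>\<omega>. zero_count padic_integers \<omega> - ?x \<omega>)"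
    using fin by (auto simp: add)
  moreover have mx: "?x \<in> borel_measurable M" using compl by simp
  ultimately have m': "?x' \<in> borel_measurable M" using borel_measurable_minus_ennreal[OF mO mx] by simp
  have "(\<integral>\<^sup>+ \<omega>. ?x' \<omega> \<partial>M) = ?C * emeasure h (- A \<inter> padic_integers)"
  proof (rule ennreal_proportional_complement)
    have "(\<integral>\<^sup>+ \<omega>. ?x \<omega> \<partial>M) + (\<integral>\<^sup>+ \<omega>. ?x' \<omega> \<partial>M) = (\<integral>\<^sup>+ \<omega>. zero_count padic_integers \<omega> \<partial>M)"
      unfolding add by (rule nn_integral_add[symmetric, OF mx m'])
    also have "\<dots> = ?C * emeasure h padic_integers"
      unfolding O0 using h by (simp add: expectation_zero_count_ball padic_uniform_measure_def)
    also have "emeasure h padic_integers = emeasure h (A \<inter> padic_integers) + emeasure h (- A \<inter> padic_integers)"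
      using compl sets by (subst part, intro plus_emeasure[symmetric]) auto
    finally show "(\<integral>\<^sup>+ \<omega>. ?x \<omega> \<partial>M) + (\<integral>\<^sup>+ \<omega>. ?x' \<omega> \<partial>M) =
        ?C * (emeasure h (A \<inter> padic_integers) + emeasure h (- A \<inter> padic_integers))" .
    show "(\<integral>\<^sup>+ \<omega>. ?x \<omega> \<partial>M) = ?C * emeasure h (A \<inter> padic_integers)" using compl by simp
    have "(\<integral>\<^sup>+ \<omega>. ?x \<omega> \<partial>M) \<le> (\<integral>\<^sup>+ \<omega>. of_nat d \<partial>M)" by (intro nn_integral_mono zero_count_le)
    also have "\<dots> = of_nat d" by (simp add: emeasure_space_1)
    finally show "(\<integral>\<^sup>+ \<omega>. ?x \<omega> \<partial>M) \<noteq> \<top>" by (auto simp: top_unique)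
  qed
  with m' show ?case by simp
next
  case (union A)
  let ?C = "ennreal (real CARD('p) / (real CARD('p) + 1))"
  let ?A = "\<lambda>i. A i \<inter> padic_integers"
  have sets: "sets h = sets borel" using h by (simp add: padic_uniform_measure_def)
  have disj: "disjoint_family ?A" using union(1) by (auto simp: disjoint_family_on_def)
  have UN: "(\<Union>i. A i) \<inter> padic_integers = (\<Union>i. ?A i)" by auto
  have m: "zero_count (?A i) \<in> borel_measurable M" for i using union(3) by simp
  have zc: "zero_count (\<Union>i. ?A i) \<omega> = (\<Sum>i. zero_count (?A i) \<omega>)" for \<omega>
    by (rule zero_count_UN_disjoint[OF disj])
  have "(\<integral>\<^sup>+ \<omega>. zero_count (\<Union>i. ?A i) \<omega> \<partial>M) = (\<Sum>i. \<integral>\<^sup>+ \<omega>. zero_count (?A i) \<omega> \<partial>M)"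
    unfolding zc by (rule nn_integral_suminf[OF m])
  also have "\<dots> = ?C * (\<Sum>i. emeasure h (?A i))"
    using union(3) by simp
  also have "(\<Sum>i. emeasure h (?A i)) = emeasure h (\<Union>i. ?A i)"
    using disj union(2) sets by (intro suminf_emeasure) auto
  finally have "(\<integral>\<^sup>+ \<omega>. zero_count (\<Union>i. ?A i) \<omega> \<partial>M) = ?C * emeasure h (\<Union>i. ?A i)" .
  moreover have "zero_count (\<Union>i. ?A i) = (\<lambda>\<omega>. \<Sum>i. zero_count (?A i) \<omega>)" using zc by auto
  then have "zero_count (\<Union>i. ?A i) \<in> borel_measurable M" using m by simp
  ultimately show ?case unfolding UN by simp
qed

text \<open>
  Passes from \<open>zero_count\<close> to the true count, which for the zero polynomial is the number of elements of
  \<open>A\<close>. That is a constant, so measurability survives on the exceptional event too.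
\<close>

lemma num_zeros_Borel:
  assumes h: "padic_uniform_measure h" and A: "A \<in> sets borel" "A \<subseteq> padic_integers"
  shows "(\<lambda>\<omega>. num_elements {x \<in> A. eval_at \<omega> x = 0}) \<in> borel_measurable M"
    and "(\<integral>\<^sup>+ \<omega>. num_elements {x \<in> A. eval_at \<omega> x = 0} \<partial>M)
      = ennreal (real CARD('p) / (real CARD('p) + 1)) * emeasure h A"
proof -
  have A': "A \<inter> padic_integers = A" using A(2) by auto
  note zc = zero_count_Borel[OF h A(1), unfolded A']
  have "num_elements {x \<in> A. eval_at \<omega> x = 0} = (if degenerate \<omega> then num_elements A else zero_count A \<omega>)" for \<omega>
    by (auto simp: zero_count_def degenerate_def coeff_eval_def)
  moreover have "(\<lambda>\<omega>. if degenerate \<omega> then num_elements A else zero_count A \<omega>) \<in> borel_measurable M"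
    using zc by (intro measurable_If sets_degenerate) auto
  ultimately show "(\<lambda>\<omega>. num_elements {x \<in> A. eval_at \<omega> x = 0}) \<in> borel_measurable M" by simp
  have "(\<integral>\<^sup>+ \<omega>. num_elements {x \<in> A. eval_at \<omega> x = 0} \<partial>M) = (\<integral>\<^sup>+ \<omega>. zero_count A \<omega> \<partial>M)"
    using AE_not_degenerate by (intro nn_integral_cong_AE) (auto simp: zero_count_def)
  then show "(\<integral>\<^sup>+ \<omega>. num_elements {x \<in> A. eval_at \<omega> x = 0} \<partial>M)
      = ennreal (real CARD('p) / (real CARD('p) + 1)) * emeasure h A" using zc by simp
qed

text \<open>
  Transfers all results from the chart \<open>[1 : x]\<close> to the chart \<open>[x : 1]\<close>.
\<close>

lemma reversed_coefficients: "uniform_padic_coefficients M (\<lambda>k. \<zeta> (d - k)) d"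
proof unfold_locales
  show "indep_vars (\<lambda>_. restrict_space borel padic_integers) (\<lambda>k. \<zeta> (d - k)) {0..d}"
    by (rule indep_vars_reindex[OF indep]) (auto simp: inj_on_def)
qed (use degree_pos uniform in auto)

end

section \<open>The Haar measure of a sector of the unit sphere\<close>

text \<open>
  \<open>\<int>\<^sub>p\<^sup>2\<close> is the disjoint union of \<open>p\<^sup>m\<^sup>+\<^sup>n\<close> translates of the box.
\<close>

lemma emeasure_plane_ball:
  fixes \<nu> :: "('p::prime_card padic \<times> 'p padic) measure"
  assumes sets: "sets \<nu> = sets borel"
    and inv: "\<And>g A. A \<in> sets borel \<Longrightarrow> emeasure \<nu> ((+) g ` A) = emeasure \<nu> A"
    and total: "emeasure \<nu> (padic_integers \<times> padic_integers) = 1"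
  shows "emeasure \<nu> (padic_ball a m \<times> padic_ball b n) = ennreal (1 / real CARD('p) ^ m * (1 / real CARD('p) ^ n))"
proof -
  let ?q = "real CARD('p)"
  have box: "padic_ball a m \<times> padic_ball b n \<in> sets borel" for a b :: "'p padic" and m n
    by (intro borel_open open_Times open_padic_ball)
  have shift: "emeasure \<nu> (padic_ball a m \<times> padic_ball b n) = emeasure \<nu> (padic_ball 0 m \<times> padic_ball 0 n)" for a b m n
  proof -
    have "(+) (a, b) ` (padic_ball 0 m \<times> padic_ball 0 n) = (+) a ` padic_ball 0 m \<times> (+) b ` padic_ball 0 n"
      by (auto simp: image_iff)
    then show ?thesis using inv[OF box, of "(a, b)" 0 m 0 n] by (simp add: padic_ball_translate)
  qed
  let ?I = "{..<CARD('p) ^ m} \<times> {..<CARD('p) ^ n}"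
  let ?B = "\<lambda>(s, t). padic_ball (of_nat s :: 'p padic) m \<times> padic_ball (of_nat t :: 'p padic) n"
  have "padic_integers \<times> padic_integers = (\<Union>i\<in>?I. ?B i)"
    by (subst padic_integers_eq_UN_balls[of m], subst padic_integers_eq_UN_balls[of n]) auto
  moreover have "disjoint_family_on ?B ?I"
    unfolding disjoint_family_on_def
  proof (intro ballI impI)
    fix i j assume ij: "i \<in> ?I" "j \<in> ?I" "i \<noteq> j"
    then consider "fst i \<noteq> fst j" | "snd i \<noteq> snd j" by (auto simp: prod_eq_iff)
    then show "?B i \<inter> ?B j = {}"
    proof cases
      case 1
      then have "padic_ball (of_nat (fst i) :: 'p padic) m \<inter> padic_ball (of_nat (fst j)) m = {}"
        using ij by (intro residue_balls_disjoint) auto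
      then show ?thesis by (simp add: split_beta Times_Int_Times)
    next
      case 2
      then have "padic_ball (of_nat (snd i) :: 'p padic) n \<inter> padic_ball (of_nat (snd j)) n = {}"
        using ij by (intro residue_balls_disjoint) auto
      then show ?thesis by (simp add: split_beta Times_Int_Times)
    qed
  qed
  ultimately have "1 = (\<Sum>i\<in>?I. emeasure \<nu> (?B i))"
    unfolding total[symmetric] using sum_emeasure[of ?B ?I \<nu>] box sets by (auto simp: image_subset_iff)
  also have "\<dots> = (\<Sum>i\<in>?I. emeasure \<nu> (padic_ball 0 m \<times> padic_ball 0 n))"
    by (intro sum.cong refl) (auto intro: shift)
  also have "\<dots> = ennreal (?q ^ m * ?q ^ n) * emeasure \<nu> (padic_ball 0 m \<times> padic_ball 0 n)"
    by (simp add: ennreal_of_nat_eq_real_of_nat flip: ennreal_mult)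
  finally have eq: "ennreal (?q ^ m * ?q ^ n) * emeasure \<nu> (padic_ball 0 m \<times> padic_ball 0 n) = 1" by simp
  have q: "0 < ?q" by (rule card_pos)
  have "emeasure \<nu> (padic_ball 0 m \<times> padic_ball 0 n)
     = ennreal (1 / ?q ^ m * (1 / ?q ^ n)) * (ennreal (?q ^ m * ?q ^ n) * emeasure \<nu> (padic_ball 0 m \<times> padic_ball 0 n))"
    using q by (simp flip: mult.assoc ennreal_mult)
  then have "emeasure \<nu> (padic_ball 0 m \<times> padic_ball 0 n) = ennreal (1 / ?q ^ m * (1 / ?q ^ n))" unfolding eq by simp
  with shift[of a m b n] show ?thesis by (rule trans)
qed

lemma padic_norm_eq_1_iff: "padic_norm x = 1 \<longleftrightarrow> x \<in> padic_integers \<and> x \<notin> padic_ideal 1"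
  using padic_norm_eq_power_if[of x 0] card_gt_1[where 'p = 'a]
  by (auto simp: padic_ideal_0 padic_integers_def padic_ideal_def)

lemma padic_norm_eq_1_ball:
  assumes "padic_norm s = 1" "x \<in> padic_ball s (Suc n)"
  shows "padic_norm x = 1"
proof -
  have s: "s \<in> padic_integers" "s \<notin> padic_ideal 1" using assms(1) by (auto simp: padic_norm_eq_1_iff)
  have "x \<in> padic_integers" using padic_ball_subset_integers[OF s(1)] assms(2) by blast
  moreover have "x \<notin> padic_ideal 1"
  proof
    assume "x \<in> padic_ideal 1"
    moreover have "x - s \<in> padic_ideal 1"
      using assms(2) padic_ideal_antimono[of 1 "Suc n"] by (auto simp: padic_ball_def)
    ultimately have "x - (x - s) \<in> padic_ideal 1" by (rule padic_ideal_diff)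
    with s show False by simp
  qed
  ultimately show ?thesis by (simp add: padic_norm_eq_1_iff)
qed

text \<open>
  The part of the unit sphere over the points \<open>[1 : x]\<close> with \<open>x \<in> A\<close>, provided that \<open>A \<subseteq> \<int>\<^sub>p\<close>.
\<close>

definition sector :: "'p::prime_card padic set \<Rightarrow> ('p padic \<times> 'p padic) set" where
  "sector A = {v. padic_norm (fst v) = 1 \<and> snd v / fst v \<in> A}"

text \<open>
  If \<open>v\<^sub>0\<close> is a unit congruent to \<open>s\<close> modulo \<open>p\<^sup>n\<close>, then \<open>v\<^sub>1 / v\<^sub>0\<close> is congruent to \<open>a\<close> exactly when \<open>v\<^sub>1\<close> is
  congruent to \<open>s a\<close>. The level \<open>n + 1\<close> for \<open>v\<^sub>0\<close> is chosen so that, also for \<open>n = 0\<close>, the residue decides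
  whether \<open>v\<^sub>0\<close> is a unit.
\<close>

lemma sector_ball_eq:
  fixes a :: "'p::prime_card padic"
  assumes a: "a \<in> padic_integers"
  shows "sector (padic_ball a n) = (\<Union>s\<in>{s. s < CARD('p) ^ Suc n \<and> padic_norm (of_nat s :: 'p padic) = 1}.
      padic_ball (of_nat s) (Suc n) \<times> padic_ball (of_nat s * a) n)" (is "_ = ?R")
proof (intro equalityI subsetI)
  fix v :: "'p padic \<times> 'p padic"
  assume "v \<in> sector (padic_ball a n)"
  then have v: "padic_norm (fst v) = 1" "snd v / fst v - a \<in> padic_ideal n" by (auto simp: sector_def padic_ball_def)
  then have vi: "fst v \<in> padic_integers" by (simp add: padic_integers_def)
  then obtain s where s: "s < CARD('p) ^ Suc n" "fst v \<in> padic_ball (of_nat s) (Suc n)"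
    by (rule padic_integers_residue)
  have "of_nat s \<in> padic_ball (fst v) (Suc n)" using s(2) by (simp add: padic_ball_def padic_ideal_minus_commute)
  then have s1: "padic_norm (of_nat s :: 'p padic) = 1" by (rule padic_norm_eq_1_ball[OF v(1)])
  have v0: "fst v \<noteq> 0" using v(1) by auto
  have "fst v - of_nat s \<in> padic_ideal n" using s(2) padic_ideal_antimono[of n "Suc n"] by (auto simp: padic_ball_def)
  then have "fst v * (snd v / fst v - a) + (fst v - of_nat s) * a \<in> padic_ideal n"
    by (intro padic_ideal_add padic_ideal_mult_left[OF vi v(2)] padic_ideal_mult_right[OF _ a])
  moreover have "fst v * (snd v / fst v - a) + (fst v - of_nat s) * a = snd v - of_nat s * a"
    using v0 by (simp add: algebra_simps)
  ultimately have "snd v \<in> padic_ball (of_nat s * a) n" by (simp add: padic_ball_def)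
  then show "v \<in> ?R" using s s1 by (auto simp: mem_Times_iff)
next
  fix v :: "'p padic \<times> 'p padic"
  assume "v \<in> ?R"
  then obtain s where s: "padic_norm (of_nat s :: 'p padic) = 1" "fst v \<in> padic_ball (of_nat s) (Suc n)"
    "snd v \<in> padic_ball (of_nat s * a) n" by auto
  have v: "padic_norm (fst v) = 1" by (rule padic_norm_eq_1_ball[OF s(1,2)])
  then have v0: "fst v \<noteq> 0" by auto
  have inv: "inverse (fst v) \<in> padic_integers" using v by (simp add: padic_integers_def padic_norm_inverse)
  have "fst v - of_nat s \<in> padic_ideal n" using s(2) padic_ideal_antimono[of n "Suc n"] by (auto simp: padic_ball_def)
  then have "(fst v - of_nat s) * a \<in> padic_ideal n" by (rule padic_ideal_mult_right[OF _ a])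
  moreover have "snd v - of_nat s * a \<in> padic_ideal n" using s(3) by (simp add: padic_ball_def)
  ultimately have "(snd v - of_nat s * a) - (fst v - of_nat s) * a \<in> padic_ideal n"
    by (rule padic_ideal_diff[rotated])
  then have "((snd v - of_nat s * a) - (fst v - of_nat s) * a) * inverse (fst v) \<in> padic_ideal n"
    using inv by (rule padic_ideal_mult_right)
  moreover have "((snd v - of_nat s * a) - (fst v - of_nat s) * a) * inverse (fst v) = snd v / fst v - a"
    using v0 by (simp add: field_simps)
  ultimately show "v \<in> sector (padic_ball a n)" using v by (simp add: sector_def padic_ball_def)
qed

text \<open>
  The boxes in \<open>sector_ball_eq\<close> have the same measure for every \<open>a\<close>, so it suffices to treat \<open>a = 0\<close>, where the
  sector is the product of the units and \<open>p\<^sup>n\<int>\<^sub>p\<close>.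
\<close>

lemma emeasure_sector_ball:
  fixes \<nu> :: "('p::prime_card padic \<times> 'p padic) measure"
  assumes sets: "sets \<nu> = sets borel"
    and inv: "\<And>g A. A \<in> sets borel \<Longrightarrow> emeasure \<nu> ((+) g ` A) = emeasure \<nu> A"
    and total: "emeasure \<nu> (padic_integers \<times> padic_integers) = 1"
    and a: "a \<in> padic_integers"
  shows "sector (padic_ball a n) \<in> sets borel"
    and "emeasure \<nu> (sector (padic_ball a n)) = ennreal ((1 - 1 / real CARD('p)) * (1 / real CARD('p) ^ n))"
proof -
  let ?q = "real CARD('p)"
  let ?J = "{s. s < CARD('p) ^ Suc n \<and> padic_norm (of_nat s :: 'p padic) = 1}"
  let ?B = "\<lambda>c s. padic_ball (of_nat s :: 'p padic) (Suc n) \<times> padic_ball (of_nat s * c :: 'p padic) n"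
  note ball = emeasure_plane_ball[OF sets inv total]
  have box: "?B c s \<in> sets borel" for c s
    by (intro borel_open open_Times open_padic_ball)
  have fin: "finite ?J" by simp
  have disj: "disjoint_family_on (?B c) ?J" for c
    unfolding disjoint_family_on_def
  proof (intro ballI impI)
    fix s t assume "s \<in> ?J" "t \<in> ?J" "s \<noteq> t"
    then have "padic_ball (of_nat s :: 'p padic) (Suc n) \<inter> padic_ball (of_nat t) (Suc n) = {}"
      by (intro residue_balls_disjoint) auto
    then show "?B c s \<inter> ?B c t = {}" by (simp add: Times_Int_Times)
  qed
  show "sector (padic_ball a n) \<in> sets borel"
    unfolding sector_ball_eq[OF a] using box fin by (intro sets.finite_UN) auto
  have "emeasure \<nu> (sector (padic_ball a n)) = (\<Sum>s\<in>?J. emeasure \<nu> (?B a s))"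
    unfolding sector_ball_eq[OF a]
    using box sets by (intro sum_emeasure[symmetric] disj fin) auto
  also have "\<dots> = (\<Sum>s\<in>?J. emeasure \<nu> (?B 0 s))" by (simp only: ball)
  also have "\<dots> = emeasure \<nu> (\<Union>s\<in>?J. ?B 0 s)"
  proof (intro sum_emeasure disj fin)
    show "?B 0 ` ?J \<subseteq> Sigma_Algebra.sets \<nu>" unfolding sets using box by blast
  qed
  also have "(\<Union>s\<in>?J. ?B 0 s) = sector (padic_ball 0 n)"
    by (rule sector_ball_eq[symmetric]) simp
  also have "sector (padic_ball 0 n) = padic_ball 0 0 \<times> padic_ball 0 n - padic_ball 0 1 \<times> padic_ball (0 :: 'p padic) n"
  proof -
    have "snd v / fst v \<in> padic_ball 0 n \<longleftrightarrow> snd v \<in> padic_ball 0 n" if "padic_norm (fst v) = 1" for v :: "'p padic \<times> 'p padic"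
      using that by (simp add: padic_ball_def padic_ideal_def padic_norm_divide)
    then show ?thesis
      by (auto simp: sector_def padic_norm_eq_1_iff padic_integers_eq_ball padic_ideal_eq_ball)
  qed
  also have "emeasure \<nu> \<dots> = emeasure \<nu> (padic_ball 0 0 \<times> padic_ball 0 n) - emeasure \<nu> (padic_ball 0 1 \<times> padic_ball 0 n)"
    using padic_ball_antimono[of 0 1 "0 :: 'p padic"] sets
    by (intro emeasure_Diff) (auto simp: ball intro!: borel_open open_Times open_padic_ball)
  also have "\<dots> = ennreal (1 / ?q ^ 0 * (1 / ?q ^ n)) - ennreal (1 / ?q ^ 1 * (1 / ?q ^ n))"
    by (rule arg_cong2[where f = minus]; rule ball)
  also have "\<dots> = ennreal (1 / ?q ^ 0 * (1 / ?q ^ n) - 1 / ?q ^ 1 * (1 / ?q ^ n))"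
    by (rule ennreal_minus) simp
  also have "1 / ?q ^ 0 * (1 / ?q ^ n) - 1 / ?q ^ 1 * (1 / ?q ^ n) = (1 - 1 / ?q) * (1 / ?q ^ n)"
    by (simp add: diff_divide_distrib)
  finally show "emeasure \<nu> (sector (padic_ball a n)) = ennreal ((1 - 1 / ?q) * (1 / ?q ^ n))" .
qed

text \<open>
  Only translation invariance and normalization of the measure are assumed, so that the lemma also applies
  to its image under exchange of the two coordinates.
\<close>

lemma emeasure_sector:
  fixes \<nu> :: "('p::prime_card padic \<times> 'p padic) measure"
  assumes sets: "sets \<nu> = sets borel"
    and inv: "\<And>g A. A \<in> sets borel \<Longrightarrow> emeasure \<nu> ((+) g ` A) = emeasure \<nu> A"
    and total: "emeasure \<nu> (padic_integers \<times> padic_integers) = 1"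
    and h: "padic_uniform_measure h" and A: "A \<in> sets borel"
  shows "sector (A \<inter> padic_integers) \<in> sets borel \<and>
    emeasure \<nu> (sector (A \<inter> padic_integers)) = ennreal (1 - 1 / real CARD('p)) * emeasure h (A \<inter> padic_integers)"
  using A
proof (induction rule: padic_borel_induct)
  case (ball a n)
  note sb = emeasure_sector_ball[OF sets inv total]
  have "0 \<le> 1 - 1 / real CARD('p)" using card_gt_1[where 'p = 'p] by simp
  then have "ennreal ((1 - 1 / real CARD('p)) * (1 / real CARD('p) ^ n)) =
      ennreal (1 - 1 / real CARD('p)) * ennreal (1 / real CARD('p) ^ n)"
    by (rule ennreal_mult) simp
  moreover have "sector {} = ({} :: ('p padic \<times> 'p padic) set)" by (simp add: sector_def)
  ultimately show ?case
    using h sb[of a n] unfolding padic_ball_Int_integers padic_uniform_measure_def by auto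
next
  case empty
  show ?case by (simp add: sector_def)
next
  case (compl A)
  let ?C = "ennreal (1 - 1 / real CARD('p))"
  have hsets: "sets h = sets borel" using h by (simp add: padic_uniform_measure_def)
  have O0: "padic_integers = padic_ball (0 :: 'p padic) 0" by (rule padic_integers_eq_ball)
  have sO: "sector (padic_integers :: 'p padic set) \<in> sets borel" "emeasure \<nu> (sector padic_integers) = ?C * emeasure h padic_integers"
  proof -
    have "emeasure h padic_integers = 1" using h by (simp add: O0 padic_uniform_measure_def)
    then show "sector (padic_integers :: 'p padic set) \<in> Sigma_Algebra.sets borel"
        "emeasure \<nu> (sector padic_integers) = ?C * emeasure h padic_integers"
      using emeasure_sector_ball[OF sets inv total, of 0 0] by (simp_all add: O0[symmetric])
  qed
  have part: "sector padic_integers = sector (A \<inter> padic_integers) \<union> sector (- A \<inter> padic_integers)"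
    and disj: "sector (A \<inter> padic_integers) \<inter> sector (- A \<inter> padic_integers) = {}" by (auto simp: sector_def)
  have "sector (- A \<inter> padic_integers) = sector padic_integers - sector (A \<inter> padic_integers)"
    using part disj by blast
  then have m': "sector (- A \<inter> padic_integers) \<in> sets borel" using sO compl by auto
  have "emeasure \<nu> (sector (- A \<inter> padic_integers)) = ?C * emeasure h (- A \<inter> padic_integers)"
  proof (rule ennreal_proportional_complement)
    have "emeasure \<nu> (sector (A \<inter> padic_integers)) + emeasure \<nu> (sector (- A \<inter> padic_integers)) = emeasure \<nu> (sector padic_integers)"
      unfolding part using compl m' disj sets by (intro plus_emeasure) auto
    also have "\<dots> = ?C * emeasure h padic_integers" by (rule sO)
    also have "emeasure h padic_integers = emeasure h (A \<inter> padic_integers) + emeasure h (- A \<inter> padic_integers)"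
      using compl hsets by (subst plus_emeasure) (auto intro!: arg_cong[of _ _ "emeasure h"])
    finally show "emeasure \<nu> (sector (A \<inter> padic_integers)) + emeasure \<nu> (sector (- A \<inter> padic_integers)) =
        ?C * (emeasure h (A \<inter> padic_integers) + emeasure h (- A \<inter> padic_integers))" .
    show "emeasure \<nu> (sector (A \<inter> padic_integers)) = ?C * emeasure h (A \<inter> padic_integers)" using compl by simp
    have "emeasure \<nu> (sector (A \<inter> padic_integers)) \<le> emeasure \<nu> (sector padic_integers)"
      using sO part sets by (intro emeasure_mono) auto
    also have "\<dots> < \<top>"
      unfolding sO using h by (simp add: O0 padic_uniform_measure_def ennreal_mult_less_top)
    finally show "emeasure \<nu> (sector (A \<inter> padic_integers)) \<noteq> \<top>" by simp
  qed
  with m' show ?case by simp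
next
  case (union A)
  let ?C = "ennreal (1 - 1 / real CARD('p))"
  let ?A = "\<lambda>i. A i \<inter> padic_integers"
  have hsets: "sets h = sets borel" using h by (simp add: padic_uniform_measure_def)
  have UN: "(\<Union>i. A i) \<inter> padic_integers = (\<Union>i. ?A i)" by auto
  have sUN: "sector (\<Union>i. ?A i) = (\<Union>i. sector (?A i))" by (auto simp: sector_def)
  have disj: "disjoint_family ?A" "disjoint_family (\<lambda>i. sector (?A i))"
    using union(1) by (auto simp: disjoint_family_on_def sector_def)
  have m: "sector (?A i) \<in> sets borel" for i using union(3) by simp
  have "emeasure \<nu> (\<Union>i. sector (?A i)) = (\<Sum>i. emeasure \<nu> (sector (?A i)))"
    using m disj sets by (intro suminf_emeasure[symmetric]) auto
  also have "\<dots> = ?C * (\<Sum>i. emeasure h (?A i))" using union(3) by simp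
  also have "(\<Sum>i. emeasure h (?A i)) = emeasure h (\<Union>i. ?A i)"
    using disj union(2) hsets by (intro suminf_emeasure) auto
  finally show ?case unfolding UN sUN using m by auto
qed

section \<open>The two charts of the projective line\<close>

text \<open>
  The point at infinity of the first chart is \<open>[0 : 1]\<close>, the origin of the second one.
\<close>

definition finite_chart :: "'a::field \<Rightarrow> 'a proj_line" where
  "finite_chart x = proj_point (1, x)"

definition infinite_chart :: "'a::field \<Rightarrow> 'a proj_line" where
  "infinite_chart x = proj_point (x, 1)"

lemma proj_point_eq_iff:
  assumes "v \<noteq> 0" "w \<noteq> 0"
  shows "proj_point v = proj_point w \<longleftrightarrow> proportional v w"
proof -
  have "proportional u u" if "u \<noteq> 0" for u :: "'a \<times> 'a"
    using that by (auto simp: proportional_def intro!: exI[of _ 1])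
  then show ?thesis
    using Quotient_rel[OF Quotient_proj_line, of v w] assms by auto
qed

lemma proj_point_scale:
  fixes v :: "'a::field \<times> 'a"
  assumes "v \<noteq> 0" "c \<noteq> 0"
  shows "proj_point (c * fst v, c * snd v) = proj_point v"
proof -
  have "(c * fst v, c * snd v) \<noteq> 0" using assms by (auto simp: prod_eq_iff)
  then show ?thesis
    using proj_point_eq_iff[of v "(c * fst v, c * snd v)"] assms by (auto simp: proportional_def)
qed

lemma proj_point_finite_chart: "fst v \<noteq> 0 \<Longrightarrow> proj_point v = finite_chart (snd v / fst v)"
  for v :: "'a::field \<times> 'a"
  using proj_point_scale[of v "inverse (fst v)"]
  by (auto simp: finite_chart_def prod_eq_iff divide_inverse mult.commute)

lemma proj_point_infinite_chart: "snd v \<noteq> 0 \<Longrightarrow> proj_point v = infinite_chart (fst v / snd v)"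
  for v :: "'a::field \<times> 'a"
  using proj_point_scale[of v "inverse (snd v)"]
  by (auto simp: infinite_chart_def prod_eq_iff divide_inverse mult.commute)

lemma inj_finite_chart: "inj finite_chart"
proof (rule injI)
  fix x y :: 'a assume "finite_chart x = finite_chart y"
  then have "proportional (1, x) (1, y)"
    unfolding finite_chart_def by (subst (asm) proj_point_eq_iff) (auto simp: zero_prod_def)
  then show "x = y" by (auto simp: proportional_def)
qed

lemma inj_infinite_chart: "inj infinite_chart"
proof (rule injI)
  fix x y :: 'a assume "infinite_chart x = infinite_chart y"
  then have "proportional (x, 1) (y, 1)"
    unfolding infinite_chart_def by (subst (asm) proj_point_eq_iff) (auto simp: zero_prod_def)
  then show "x = y" by (auto simp: proportional_def)
qed

text \<open>
  \<open>[1 : x] = [y : 1]\<close> means \<open>x y = 1\<close>, which is impossible for \<open>x \<in> \<int>\<^sub>p\<close> and \<open>y \<in> p\<int>\<^sub>p\<close>.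
\<close>

lemma charts_disjoint:
  fixes x y :: "'p::prime_card padic"
  assumes "x \<in> padic_integers" "y \<in> padic_ideal 1"
  shows "finite_chart x \<noteq> infinite_chart y"
proof
  assume "finite_chart x = infinite_chart y"
  then have "proportional (1, x) (y, 1)"
    unfolding finite_chart_def infinite_chart_def by (subst (asm) proj_point_eq_iff) (auto simp: zero_prod_def)
  then have "x * y = 1" by (auto simp: proportional_def mult.commute)
  moreover have "x * y \<in> padic_ideal 1" using assms by (rule padic_ideal_mult_left)
  moreover have "(1 :: 'p padic) \<notin> padic_ideal 1" using padic_norm_eq_1_iff[of "1 :: 'p padic"] by simp
  ultimately show False by simp
qed

text \<open>
  The coordinate of larger norm is used as denominator. In the second case the quotient has norm less than
  \<open>1\<close>, hence at most \<open>1/p\<close>.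
\<close>

lemma charts_cover:
  fixes v :: "'p::prime_card padic \<times> 'p padic"
  assumes "v \<noteq> 0"
  obtains (finite) "fst v \<noteq> 0" "snd v / fst v \<in> padic_integers" "proj_point v = finite_chart (snd v / fst v)"
    | (infinite) "snd v \<noteq> 0" "fst v / snd v \<in> padic_ideal 1" "proj_point v = infinite_chart (fst v / snd v)"
proof (cases "padic_norm (snd v) \<le> padic_norm (fst v)")
  case True
  have "fst v \<noteq> 0"
  proof
    assume "fst v = 0"
    with True have "padic_norm (snd v) = 0" using padic_norm_nonneg[of "snd v"] by simp
    then show False using \<open>fst v = 0\<close> assms by (simp add: prod_eq_iff)
  qed
  moreover from this have "0 < padic_norm (fst v)"
    using padic_norm_nonneg[of "fst v"] padic_norm_eq_0_iff[of "fst v"] by linarith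
  ultimately show thesis
    using finite proj_point_finite_chart[of v] True by (simp add: padic_integers_def padic_norm_divide)
next
  case False
  then have pos: "0 < padic_norm (snd v)" using padic_norm_nonneg[of "fst v"] by linarith
  then have nz: "snd v \<noteq> 0" by auto
  have less: "padic_norm (fst v / snd v) < 1" using False pos by (simp add: padic_norm_divide)
  then have "fst v / snd v \<in> padic_ideal 1"
    using padic_norm_eq_1_iff[of "fst v / snd v"] by (auto simp: padic_integers_def)
  then show thesis using infinite nz proj_point_infinite_chart[of v] by simp
qed

text \<open>
  A continuous lift to the punctured plane composed with the quotient map is continuous by definition of
  the quotient topology.
\<close>

lemma borel_measurable_chart:
  fixes g :: "'p::prime_card padic \<Rightarrow> 'p padic \<times> 'p padic"
  assumes "continuous_on UNIV g" "\<And>x. g x \<noteq> 0" "U \<in> sets borel"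
  shows "(\<lambda>x. proj_point (g x)) -` U \<in> sets borel"
proof -
  have "(\<lambda>x. proj_point (g x)) \<in> borel_measurable borel"
  proof (rule borel_measurableI)
    fix S :: "'p padic proj_line set" assume "open S"
    then have "open {v. v \<noteq> 0 \<and> proj_point v \<in> S}" by (simp add: open_proj_line_def)
    then have "open (g -` {v. v \<noteq> 0 \<and> proj_point v \<in> S})"
      using continuous_on_open_vimage[OF open_UNIV, of g] assms(1) by fastforce
    moreover have "g -` {v. v \<noteq> 0 \<and> proj_point v \<in> S} = (\<lambda>x. proj_point (g x)) -` S"
      using assms(2) by auto
    ultimately show "(\<lambda>x. proj_point (g x)) -` S \<inter> space borel \<in> sets borel" by simp
  qed
  from measurable_sets[OF this assms(3)] show ?thesis by simp
qed

lemma sets_chart_vimage: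
  fixes U :: "'p::prime_card padic proj_line set"
  assumes "U \<in> sets borel"
  shows "finite_chart -` U \<in> sets borel" "infinite_chart -` U \<in> sets borel"
proof -
  have "continuous_on UNIV (\<lambda>x. (1 :: 'p padic, x))" "continuous_on UNIV (\<lambda>x :: 'p padic. (x, 1 :: 'p padic))"
    by (intro continuous_on_Pair continuous_on_const continuous_on_id)+
  then show "finite_chart -` U \<in> sets borel" "infinite_chart -` U \<in> sets borel"
    using borel_measurable_chart[of "\<lambda>x. (1, x)" U] borel_measurable_chart[of "\<lambda>x. (x, 1)" U] assms
    by (simp_all add: finite_chart_def[abs_def] infinite_chart_def[abs_def] zero_prod_def)
qed

section \<open>Counting zeros in the charts\<close>

lemma binary_form_scale: "binary_form d c (a * fst v, a * snd v) = a ^ d * binary_form d c v"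
proof -
  have "c k * (a * x) ^ (d - k) * (a * y) ^ k = a ^ d * (c k * x ^ (d - k) * y ^ k)" if "k \<le> d" for k x y
  proof -
    have "a ^ d = a ^ (d - k) * a ^ k" using that by (simp flip: power_add)
    then show ?thesis by (simp add: power_mult_distrib mult_ac)
  qed
  then show ?thesis
    unfolding binary_form_def by (simp only: split_beta fst_conv snd_conv sum_distrib_left) (intro sum.cong, auto)
qed

lemma binary_form_finite_chart: "binary_form d c (1, x) = coeff_eval d c x"
  by (simp add: binary_form_def coeff_eval_def)

lemma binary_form_infinite_chart: "binary_form d c (x, 1) = coeff_eval d (\<lambda>k. c (d - k)) x"
proof -
  have "(\<Sum>k\<le>d. c (d - k) * x ^ k) = (\<Sum>k\<le>d. c k * x ^ (d - k))"
    by (rule sum.reindex_bij_witness[of _ "\<lambda>k. d - k" "\<lambda>k. d - k"]) auto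
  then show ?thesis by (simp add: binary_form_def coeff_eval_def)
qed

lemma num_proj_zeroes:
  fixes c :: "nat \<Rightarrow> 'p::prime_card padic"
  shows "num_elements (proj_zeroes (binary_form d c) \<inter> U) =
    num_elements {x \<in> finite_chart -` U \<inter> padic_integers. coeff_eval d c x = 0} +
    num_elements {x \<in> infinite_chart -` U \<inter> padic_ideal 1. coeff_eval d (\<lambda>k. c (d - k)) x = 0}"
    (is "num_elements ?Z = num_elements ?A + num_elements ?B")
proof -
  have "?Z = finite_chart ` ?A \<union> infinite_chart ` ?B"
  proof (intro equalityI subsetI)
    fix P assume "P \<in> ?Z"
    then obtain v where v: "v \<noteq> 0" "binary_form d c v = 0" "P = proj_point v" "P \<in> U"
      by (auto simp: proj_zeroes_def)
    from v(1) show "P \<in> finite_chart ` ?A \<union> infinite_chart ` ?B"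
    proof (cases rule: charts_cover)
      case finite
      have "binary_form d c (1, snd v / fst v) = 0"
        using binary_form_scale[of d c "inverse (fst v)" v] v(2) finite(1) by (simp add: divide_inverse mult.commute)
      then have "snd v / fst v \<in> ?A" using finite v by (simp add: binary_form_finite_chart)
      then show ?thesis using finite v by blast
    next
      case infinite
      have "binary_form d c (fst v / snd v, 1) = 0"
        using binary_form_scale[of d c "inverse (snd v)" v] v(2) infinite(1) by (simp add: divide_inverse mult.commute)
      then have "fst v / snd v \<in> ?B" using infinite v by (simp add: binary_form_infinite_chart)
      then show ?thesis using infinite v by blast
    qed
  next
    fix P assume "P \<in> finite_chart ` ?A \<union> infinite_chart ` ?B"
    then show "P \<in> ?Z"
    proof
      assume "P \<in> finite_chart ` ?A"
      then obtain x where "P = proj_point (1, x)" "P \<in> U" "binary_form d c (1, x) = 0"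
        by (auto simp: finite_chart_def binary_form_finite_chart)
      moreover have "(1, x) \<noteq> (0 :: 'p padic \<times> 'p padic)" by (simp add: zero_prod_def)
      ultimately show ?thesis unfolding proj_zeroes_def by blast
    next
      assume "P \<in> infinite_chart ` ?B"
      then obtain x where "P = proj_point (x, 1)" "P \<in> U" "binary_form d c (x, 1) = 0"
        by (auto simp: infinite_chart_def binary_form_infinite_chart)
      moreover have "(x, 1) \<noteq> (0 :: 'p padic \<times> 'p padic)" by (simp add: zero_prod_def)
      ultimately show ?thesis unfolding proj_zeroes_def by blast
    qed
  qed
  moreover have "finite_chart ` ?A \<inter> infinite_chart ` ?B = {}" using charts_disjoint by blast
  moreover have "num_elements (finite_chart ` ?A) = num_elements ?A" "num_elements (infinite_chart ` ?B) = num_elements ?B"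
    by (intro num_elements_image inj_on_subset[OF inj_finite_chart] inj_on_subset[OF inj_infinite_chart]; simp)+
  ultimately show ?thesis by (simp add: num_elements_Un)
qed

section \<open>The invariant measure in the charts\<close>

text \<open>
  Each chart contributes a sector of the unit sphere, after an exchange of coordinates in the second
  chart. Each sector has \<open>1 - 1/p\<close> times the Haar measure of its base, and the normalization in the definition
  of the measure on the projective line cancels this factor.
\<close>

lemma proj_line_measure_charts:
  fixes \<mu> :: "('p::prime_card padic \<times> 'p padic) measure" and h :: "'p padic measure"
  assumes haar: "haar_measure_on UNIV \<mu>" and total: "emeasure \<mu> (padic_integers \<times> padic_integers) = 1"
    and h: "padic_uniform_measure h" and U: "U \<in> sets borel"
  shows "proj_line_measure \<mu> U = emeasure h (finite_chart -` U \<inter> padic_integers) + emeasure h (infinite_chart -` U \<inter> padic_ideal 1)"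
proof -
  let ?C = "ennreal (1 - 1 / real CARD('p))"
  let ?A = "finite_chart -` U" and ?B = "infinite_chart -` U \<inter> padic_ideal 1"
  have sets: "sets \<mu> = sets borel" using haar by (auto simp: haar_measure_on_def sets_restrict_space)
  have space: "space \<mu> = UNIV" using haar by (simp add: haar_measure_on_def)
  have inv: "emeasure \<mu> ((+) g ` A) = emeasure \<mu> A" if "A \<in> sets borel" for g A
    using haar that unfolding haar_measure_on_def sets[symmetric] by blast
  have A: "?A \<in> sets borel" and B: "?B \<in> sets borel" using sets_chart_vimage[OF U] by auto
  have Bi: "?B \<inter> padic_integers = ?B" using padic_ideal_subset_integers by blast
  \<comment> \<open>The second chart is the first one for the measure with exchanged coordinates.\<close>
  define \<nu> where "\<nu> = distr \<mu> borel prod.swap"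
  have swap_m: "prod.swap \<in> measurable \<mu> borel"
  proof -
    have "prod.swap \<in> borel_measurable (borel :: ('p padic \<times> 'p padic) measure)"
      by (intro borel_measurable_continuous_onI continuous_on_swap)
    then show ?thesis using measurable_cong_sets[OF sets refl] by blast
  qed
  have \<nu>: "emeasure \<nu> S = emeasure \<mu> (prod.swap -` S)" if "S \<in> sets borel" for S
    unfolding \<nu>_def using emeasure_distr[OF swap_m that] by (simp add: space)
  have swap_sets: "prod.swap -` S \<in> sets borel" if "S \<in> sets borel" for S :: "('p padic \<times> 'p padic) set"
    using measurable_sets[OF swap_m that] by (simp add: space sets)
  have \<nu>_sets: "sets \<nu> = sets borel" by (simp add: \<nu>_def)
  have \<nu>_inv: "emeasure \<nu> ((+) g ` S) = emeasure \<nu> S" if S: "S \<in> sets borel" for g S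
  proof -
    have image_eq: "(+) g ` S = (+) (- g) -` S" for g and S :: "('p padic \<times> 'p padic) set"
      by (auto simp: image_iff intro!: bexI[of _ "- g + _"])
    have "prod.swap -` ((+) g ` S) = (+) (prod.swap g) ` (prod.swap -` S)"
      unfolding image_eq by (auto simp: prod.swap_def minus_prod_def)
    moreover have "(+) g ` S \<in> sets borel"
    proof -
      have "(+) (- g) \<in> borel_measurable (borel :: ('p padic \<times> 'p padic) measure)"
      proof (rule borel_measurable_continuous_onI)
        have "continuous_on UNIV (\<lambda>x. (- fst g + fst x, - snd g + snd x))" by (intro continuous_intros)
        then show "continuous_on UNIV ((+) (- g))" by (simp add: plus_prod_def)
      qed
      from measurable_sets[OF this S] show ?thesis by (simp add: image_eq)
    qed
    ultimately show ?thesis using \<nu> S inv[OF swap_sets[OF S]] by simp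
  qed
  have \<nu>_total: "emeasure \<nu> (padic_integers \<times> padic_integers) = 1"
  proof -
    have "padic_integers \<times> padic_integers \<in> sets (borel :: ('p padic \<times> 'p padic) measure)"
      unfolding padic_integers_eq_ball by (intro borel_open open_Times open_padic_ball)
    moreover have "prod.swap -` (padic_integers \<times> padic_integers) = (padic_integers :: 'p padic set) \<times> (padic_integers :: 'p padic set)"
      by auto
    ultimately show ?thesis using \<nu> total by simp
  qed
  note sA = emeasure_sector[OF sets inv total h A]
  note sB = emeasure_sector[OF \<nu>_sets \<nu>_inv \<nu>_total h B, unfolded Bi]
  have "{a \<in> padic_unit_sphere. proj_point a \<in> U} = sector (?A \<inter> padic_integers) \<union> prod.swap -` sector ?B"
    (is "?S = ?S1 \<union> ?S2")
  proof (intro equalityI subsetI)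
    fix v assume v: "v \<in> ?S"
    then have max: "max (padic_norm (fst v)) (padic_norm (snd v)) = 1" and U: "proj_point v \<in> U"
      by (auto simp: padic_unit_sphere_def)
    then have "v \<noteq> 0" by auto
    then show "v \<in> ?S1 \<union> ?S2"
    proof (cases rule: charts_cover)
      case finite
      have "0 < padic_norm (fst v)" using finite(1) padic_norm_nonneg[of "fst v"] padic_norm_eq_0_iff[of "fst v"] by linarith
      then have "padic_norm (snd v) \<le> padic_norm (fst v)"
        using finite(2) by (simp add: padic_integers_def padic_norm_divide)
      then have "padic_norm (fst v) = 1" using max by simp
      then show ?thesis using finite U by (simp add: sector_def)
    next
      case infinite
      have "0 < padic_norm (snd v)" using infinite(1) padic_norm_nonneg[of "snd v"] padic_norm_eq_0_iff[of "snd v"] by linarith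
      moreover have "fst v / snd v \<in> padic_integers" using infinite(2) padic_ideal_subset_integers by blast
      ultimately have "padic_norm (fst v) \<le> padic_norm (snd v)"
        by (simp add: padic_integers_def padic_norm_divide)
      then have "padic_norm (snd v) = 1" using max by simp
      then show ?thesis using infinite U by (simp add: sector_def)
    qed
  next
    fix v assume "v \<in> ?S1 \<union> ?S2"
    then show "v \<in> ?S"
    proof
      assume v: "v \<in> ?S1"
      then have n: "padic_norm (fst v) = 1" "padic_norm (snd v) \<le> 1"
        by (auto simp: sector_def padic_integers_def padic_norm_divide)
      then have "fst v \<noteq> 0" by auto
      from proj_point_finite_chart[OF this] v n show ?thesis
        by (auto simp: padic_unit_sphere_def sector_def)
    next
      assume v: "v \<in> ?S2"
      then have "fst v / snd v \<in> padic_integers" using padic_ideal_subset_integers by (auto simp: sector_def)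
      with v have n: "padic_norm (snd v) = 1" "padic_norm (fst v) \<le> 1"
        by (auto simp: sector_def padic_integers_def padic_norm_divide)
      then have "snd v \<noteq> 0" by auto
      from proj_point_infinite_chart[OF this] v n show ?thesis
        by (auto simp: padic_unit_sphere_def sector_def)
    qed
  qed
  moreover have "?S1 \<inter> ?S2 = {}"
  proof -
    have False if v: "v \<in> ?S1" "v \<in> ?S2" for v
    proof -
      have "padic_norm (fst v) = 1" "padic_norm (snd v) = 1" "fst v / snd v \<in> padic_ideal 1"
        using v by (auto simp: sector_def)
      moreover have "padic_norm (fst v / snd v) = 1" using calculation by (simp add: padic_norm_divide)
      ultimately show False by (simp add: padic_norm_eq_1_iff)
    qed
    then show ?thesis by blast
  qed
  moreover have "?S1 \<in> Sigma_Algebra.sets \<mu>" "?S2 \<in> Sigma_Algebra.sets \<mu>"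
    unfolding sets using sA swap_sets sB by blast+
  ultimately have "emeasure \<mu> ?S = emeasure \<mu> ?S1 + emeasure \<mu> ?S2"
    by (simp only: plus_emeasure)
  also have "emeasure \<mu> ?S1 = ?C * emeasure h (?A \<inter> padic_integers)" using sA by simp
  also have "emeasure \<mu> ?S2 = ?C * emeasure h ?B" using sB \<nu>[OF conjunct1[OF sB]] by simp
  also have "?C * emeasure h (?A \<inter> padic_integers) + ?C * emeasure h ?B = ?C * (emeasure h (?A \<inter> padic_integers) + emeasure h ?B)"
    by (simp add: distrib_left)
  finally have S: "emeasure \<mu> ?S = ?C * (emeasure h (?A \<inter> padic_integers) + emeasure h ?B)" .
  have "ennreal (1 / (1 - 1 / real CARD('p))) * ?C = 1"
    using card_gt_1[where 'p = 'p] by (simp flip: ennreal_mult)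
  then show ?thesis unfolding proj_line_measure_def S mult.assoc[symmetric] by simp
qed

lemma proj_line_measure_UNIV:
  fixes \<mu> :: "('p::prime_card padic \<times> 'p padic) measure" and h :: "'p padic measure"
  assumes haar: "haar_measure_on UNIV \<mu>" and total: "emeasure \<mu> (padic_integers \<times> padic_integers) = 1"
    and h: "padic_uniform_measure h"
  shows "proj_line_measure \<mu> UNIV = ennreal ((real CARD('p) + 1) / real CARD('p))"
proof -
  have "emeasure h padic_integers = ennreal 1"
    "emeasure h (padic_ideal 1 :: 'p padic set) = ennreal (1 / real CARD('p))"
    using h unfolding padic_uniform_measure_def padic_integers_eq_ball padic_ideal_eq_ball by auto
  then have "proj_line_measure \<mu> UNIV = ennreal 1 + ennreal (1 / real CARD('p))"
    using proj_line_measure_charts[OF haar total h, of UNIV] by simp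
  also have "\<dots> = ennreal (1 + 1 / real CARD('p))" by (rule ennreal_plus[symmetric]) auto
  also have "1 + 1 / real CARD('p) = (real CARD('p) + 1) / real CARD('p)"
    using card_pos[where 'p = 'p] by (simp add: add_divide_distrib)
  finally show ?thesis .
qed

theorem proposition6:
  fixes M :: "'w measure"
    and \<zeta> :: "nat \<Rightarrow> 'w \<Rightarrow> 'p::prime_card padic"
    and d :: nat
    and \<mu> :: "('p padic \<times> 'p padic) measure"
  assumes "d \<ge> 1"
    and "prob_space M"
    and "prob_space.indep_vars M (\<lambda>_. restrict_space borel padic_integers) \<zeta> {0..d}"
    and "\<forall>k\<in>{0..d}. uniformly_distributed_in M padic_integers (\<zeta> k)"
    and "haar_measure_on UNIV \<mu>"
    and "emeasure \<mu> (padic_integers \<times> padic_integers) = 1"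
  shows "(\<integral>\<^sup>+ \<omega>. num_elements (proj_zeroes (binary_form d (\<lambda>k. \<zeta> k \<omega>))) \<partial>M) = 1
    \<and> (\<forall>U \<in> sets borel.
         (\<lambda>\<omega>. num_elements (proj_zeroes (binary_form d (\<lambda>k. \<zeta> k \<omega>)) \<inter> U)) \<in> borel_measurable M
         \<and> (\<integral>\<^sup>+ \<omega>. num_elements (proj_zeroes (binary_form d (\<lambda>k. \<zeta> k \<omega>)) \<inter> U) \<partial>M)
              = proj_line_measure \<mu> U / proj_line_measure \<mu> UNIV)"
proof -
  interpret prob_space M by fact
  interpret F: uniform_padic_coefficients M \<zeta> d
    by unfold_locales (use assms in auto)
  interpret R: uniform_padic_coefficients M "\<lambda>k. \<zeta> (d - k)" d
    by (rule F.reversed_coefficients)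
  let ?q = "real CARD('p)"
  let ?N = "\<lambda>U \<omega>. num_elements (proj_zeroes (binary_form d (\<lambda>k. \<zeta> k \<omega>)) \<inter> U)"
  note h = F.padic_uniform_measure_coeff
  note total = proj_line_measure_UNIV[OF assms(5,6) h]
  have q: "0 < ?q" by (rule card_pos)
  have main: "?N U \<in> borel_measurable M \<and> (\<integral>\<^sup>+ \<omega>. ?N U \<omega> \<partial>M) = proj_line_measure \<mu> U / proj_line_measure \<mu> UNIV"
    if U: "U \<in> sets borel" for U
  proof -
    let ?A = "finite_chart -` U \<inter> padic_integers" and ?B = "infinite_chart -` U \<inter> padic_ideal 1"
    let ?h = "distr M borel (\<zeta> 0)" and ?C = "ennreal (?q / (?q + 1))"
    have A: "?A \<in> sets borel" "?A \<subseteq> padic_integers" and B: "?B \<in> sets borel" "?B \<subseteq> padic_integers"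
      using sets_chart_vimage[OF U] padic_ideal_subset_integers by auto
    note zA = F.num_zeros_Borel[OF h A] and zB = R.num_zeros_Borel[OF h B]
    have "?N U \<in> borel_measurable M"
      unfolding num_proj_zeroes using zA(1) zB(1) by simp
    moreover have "(\<integral>\<^sup>+ \<omega>. ?N U \<omega> \<partial>M) = ?C * emeasure ?h ?A + ?C * emeasure ?h ?B"
      unfolding num_proj_zeroes using zA zB by (simp add: nn_integral_add)
    moreover have "?C * emeasure ?h ?A + ?C * emeasure ?h ?B = ?C * proj_line_measure \<mu> U"
      unfolding proj_line_measure_charts[OF assms(5,6) h U] by (simp add: distrib_left)
    moreover have "proj_line_measure \<mu> U / proj_line_measure \<mu> UNIV = ?C * proj_line_measure \<mu> U"
      unfolding total divide_ennreal_def using q by (simp add: inverse_ennreal mult.commute)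
    ultimately show ?thesis by simp
  qed
  moreover have "(\<integral>\<^sup>+ \<omega>. ?N UNIV \<omega> \<partial>M) = 1"
  proof -
    have "proj_line_measure \<mu> UNIV / proj_line_measure \<mu> UNIV = 1"
      unfolding total using q by (subst divide_ennreal) auto
    then show ?thesis using main[of UNIV] by simp
  qed
  ultimately show ?thesis by simp
qed

end
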